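(* Let $F$ be a finite field of characteristic $2$. Let $n>m\ge 1$, $k\ge 3$, $l\in\{1,2\}$, $H_1\cong D_8$, $H_2\cong Q_8$, and let $$G_l\cong M_2(m+1,1)\mathbin{\mathsf Y}M_2(n+1,1,1)\mathbin{\mathsf Y}H_l\mathbin{\mathsf Y}D_8^{\mathsf Y(k-3)}.$$ Then $|V_*(FG_l)|=2|F|^{\frac{|G_l|+|\Omega_1(G_l)|}{2}-1}$ if $m=1$, and $|V_*(FG_l)|=4|F|^{\frac{|G_l|+|\Omega_1(G_l)|}{2}-1}$ if $m\ge 2$.
   Context: $V(FG)=\{\sum_{g}\alpha_g g\in FG:\sum_g\alpha_g=1\}$; $(\sum_g\alpha_g g)^*=\sum_g\alpha_g g^{-1}$; $V_*(FG)=\{x\in V(FG):x^*=x^{-1}\}$. $\Omega_1(G)=\{g\in G:g^2=1\}$. $D_8$, $Q_8$ are the dihedral and quaternion groups of order $8$. $M_2(u,v)=\langle a,b\mid a^{2^u}=b^{2^v}=1,\ a^b=a^{1+2^{u-1}}\rangle$ for $u\ge2,v\ge1$. $M_2(w,1,1)=\langle a,b,d\mid a^{2^w}=b^{2}=d^2=1,\ [a,b]=d,\ [d,a]=[d,b]=1\rangle$ for $w\ge 1$. $H\mathbin{\mathsf Y}K$ denotes the central product; here all factors have derived subgroup of order $2$, and the central product is formed by identifying these derived subgroups with one common subgroup $\langle c\rangle$, so that factors intersect exactly in $\langle c\rangle$. $D_8^{\mathsf Y j}$ is the central product of $j$ copies of $D_8$ (omitted if $j=0$). *)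

theory Defs
  imports "HOL-Algebra.Algebra" "HOL-Library.Cardinality"
begin

section \<open>Groups given by generators and relations\<close>

text \<open>A letter is a generator together with a sign: \<open>(x, True)\<close> stands for \<open>x\<close> and
  \<open>(x, False)\<close> for its inverse. A relation \<open>u = v\<close> is the pair of words \<open>(u, v)\<close>. The presented
  group consists of the words over \<open>A\<close> modulo the least congruence that contains free
  cancellation and the relations.\<close>

type_synonym 'x word = "('x \<times> bool) list"

definition word_inv :: "'x word \<Rightarrow> 'x word" where
  "word_inv w = rev (map (\<lambda>(x, s). (x, \<not> s)) w)"

definition word_conj :: "'x word \<Rightarrow> 'x word \<Rightarrow> 'x word" where
  "word_conj u v = word_inv v @ u @ v"

definition word_comm :: "'x word \<Rightarrow> 'x word \<Rightarrow> 'x word" where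
  "word_comm u v = word_inv u @ word_inv v @ u @ v"

definition gen_pow :: "'x \<Rightarrow> nat \<Rightarrow> 'x word" where
  "gen_pow x k = replicate k (x, True)"

abbreviation words :: "'x set \<Rightarrow> 'x word set" where
  "words A \<equiv> lists (A \<times> UNIV)"

inductive_set presentation_cong :: "'x set \<Rightarrow> ('x word \<times> 'x word) set \<Rightarrow> ('x word \<times> 'x word) set"
  for A :: "'x set" and R :: "('x word \<times> 'x word) set" where
  cong_refl: "w \<in> words A \<Longrightarrow> (w, w) \<in> presentation_cong A R"
| cong_sym: "(u, v) \<in> presentation_cong A R \<Longrightarrow> (v, u) \<in> presentation_cong A R"
| cong_trans: "(u, v) \<in> presentation_cong A R \<Longrightarrow> (v, w) \<in> presentation_cong A R
    \<Longrightarrow> (u, w) \<in> presentation_cong A R"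
| cong_append: "(u, v) \<in> presentation_cong A R \<Longrightarrow> (u', v') \<in> presentation_cong A R
    \<Longrightarrow> (u @ u', v @ v') \<in> presentation_cong A R"
| cong_cancel: "x \<in> A \<Longrightarrow> ([(x, s), (x, \<not> s)], []) \<in> presentation_cong A R"
| cong_relation: "(u, v) \<in> R \<Longrightarrow> u \<in> words A \<Longrightarrow> v \<in> words A \<Longrightarrow> (u, v) \<in> presentation_cong A R"

definition presented_group :: "'x set \<Rightarrow> ('x word \<times> 'x word) set \<Rightarrow> 'x word set monoid" where
  "presented_group A R =
    \<lparr>carrier = words A // presentation_cong A R,
     monoid.mult = (\<lambda>U V. \<Union>u\<in>U. \<Union>v\<in>V. presentation_cong A R `` {u @ v}),
     one = presentation_cong A R `` {[]}\<rparr>"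

datatype gen = GA | GB | GD

definition D8 :: "gen word set monoid" where
  "D8 = presented_group {GA, GB}
    {(gen_pow GA 4, []), (gen_pow GB 2, []),
     (word_conj (gen_pow GA 1) (gen_pow GB 1), word_inv (gen_pow GA 1))}"

definition Q8 :: "gen word set monoid" where
  "Q8 = presented_group {GA, GB}
    {(gen_pow GA 4, []), (gen_pow GB 2, gen_pow GA 2),
     (word_conj (gen_pow GA 1) (gen_pow GB 1), word_inv (gen_pow GA 1))}"

text \<open>\<open>M2 u v\<close> is $M_2(u,v)$ and \<open>M2_11 w\<close> is $M_2(w,1,1)$.\<close>

definition M2 :: "nat \<Rightarrow> nat \<Rightarrow> gen word set monoid" where
  "M2 u v = presented_group {GA, GB}
    {(gen_pow GA (2 ^ u), []), (gen_pow GB (2 ^ v), []),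
     (word_conj (gen_pow GA 1) (gen_pow GB 1), gen_pow GA (1 + 2 ^ (u - 1)))}"

definition M2_11 :: "nat \<Rightarrow> gen word set monoid" where
  "M2_11 w = presented_group {GA, GB, GD}
    {(gen_pow GA (2 ^ w), []), (gen_pow GB 2, []), (gen_pow GD 2, []),
     (word_comm (gen_pow GA 1) (gen_pow GB 1), gen_pow GD 1),
     (word_comm (gen_pow GD 1) (gen_pow GA 1), []),
     (word_comm (gen_pow GD 1) (gen_pow GB 1), [])}"

section \<open>Central products\<close>

text \<open>The central product of a list of groups, each having a derived subgroup \<open>{\<one>, c\<^sub>i}\<close> of order
  \<open>2\<close>: the direct product modulo the subgroup generated by the elements \<open>c\<^sub>i c\<^sub>j\<close> with \<open>i \<noteq> j\<close>.
  As \<open>c\<^sub>j\<close> is its own inverse, this makes all the \<open>c\<^sub>i\<close> equal and nothing more.\<close>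

definition direct_product :: "('a, 'b) monoid_scheme list \<Rightarrow> (nat \<Rightarrow> 'a) monoid" where
  "direct_product Gs = product_group {..<length Gs} (\<lambda>i. Gs ! i)"

definition derived_identifications :: "('a, 'b) monoid_scheme list \<Rightarrow> (nat \<Rightarrow> 'a) set" where
  "derived_identifications Gs = {x \<in> carrier (direct_product Gs).
     \<exists>i<length Gs. \<exists>j<length Gs. i \<noteq> j \<and>
       x i \<in> derived (Gs ! i) (carrier (Gs ! i)) - {\<one>\<^bsub>Gs ! i\<^esub>} \<and>
       x j \<in> derived (Gs ! j) (carrier (Gs ! j)) - {\<one>\<^bsub>Gs ! j\<^esub>} \<and>
       (\<forall>k<length Gs. k \<noteq> i \<longrightarrow> k \<noteq> j \<longrightarrow> x k = \<one>\<^bsub>Gs ! k\<^esub>)}"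

definition central_product :: "('a, 'b) monoid_scheme list \<Rightarrow> (nat \<Rightarrow> 'a) set monoid" where
  "central_product Gs =
     direct_product Gs Mod generate (direct_product Gs) (derived_identifications Gs)"

section \<open>Group algebras of finite groups and unitary units\<close>

text \<open>An element of the group algebra of a finite group is its coefficient function, extended by
  \<open>0\<close> outside the group.\<close>

definition group_algebra :: "('a, 'b) monoid_scheme \<Rightarrow> ('a \<Rightarrow> 'f::field) ring" where
  "group_algebra G =
    \<lparr>carrier = {x. \<forall>g. g \<notin> carrier G \<longrightarrow> x g = 0},
     monoid.mult = (\<lambda>x y g. if g \<in> carrier G
               then \<Sum>h\<in>carrier G. x h * y (inv\<^bsub>G\<^esub> h \<otimes>\<^bsub>G\<^esub> g) else 0),
     one = (\<lambda>g. if g = \<one>\<^bsub>G\<^esub> then 1 else 0),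
     ring.zero = (\<lambda>g. 0),
     ring.add = (\<lambda>x y g. x g + y g)\<rparr>"

definition star :: "('a, 'b) monoid_scheme \<Rightarrow> ('a \<Rightarrow> 'f::field) \<Rightarrow> 'a \<Rightarrow> 'f" where
  "star G x = (\<lambda>g. if g \<in> carrier G then x (inv\<^bsub>G\<^esub> g) else 0)"

definition V :: "('a, 'b) monoid_scheme \<Rightarrow> ('a \<Rightarrow> 'f::field) set" where
  "V G = {x \<in> carrier (group_algebra G). (\<Sum>g\<in>carrier G. x g) = 1}"

text \<open>Membership in \<open>Units\<close> is the existence of the inverse in the condition that \<open>star G x\<close>
  is the inverse of \<open>x\<close>; \<open>inv\<close> is unspecified on non-units.\<close>

definition V_star :: "('a, 'b) monoid_scheme \<Rightarrow> ('a \<Rightarrow> 'f::field) set" where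
  "V_star G = {x \<in> V G. x \<in> Units (group_algebra G) \<and> star G x = inv\<^bsub>group_algebra G\<^esub> x}"

definition Omega1 :: "('a, 'b) monoid_scheme \<Rightarrow> 'a set" where
  "Omega1 G = {g \<in> carrier G. g [^]\<^bsub>G\<^esub> (2::nat) = \<one>\<^bsub>G\<^esub>}"

text \<open>In a finite group, inversion pairs off the elements outside \<open>Omega1 G\<close>, so
  \<open>order G + card (Omega1 G)\<close> is even and positive; the natural number
  \<open>(order G + card (Omega1 G)) div 2 - 1\<close> is therefore computed without truncation.\<close>

end

theory Submission
  imports Defs "HOL-Library.Function_Algebras"
begin

text \<open>
  Let \<open>G \<rightarrow> A\<close> be a central extension with kernel \<open>{1, c}\<close> of order two and \<open>A\<close> abelian. An element
  \<open>x\<close> of \<open>FG\<close> lies over a unitary element of \<open>FA\<close> iff \<open>x x\<^sup>* = 1 + (1 + c) w\<close> for some \<open>w\<close>, the defect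
  of \<open>x\<close>, which can be read in \<open>FA\<close>. A defect is symmetric, and at a self-inverse class it vanishes unless the
  elements \<open>g\<close> of that class satisfy \<open>g\<^sup>2 = c\<close>. All fibres of \<open>x \<mapsto> w\<close> have as many elements as the
  unitary group of \<open>FG\<close>. Hence, if every such \<open>w\<close> is a defect, the two unitary groups have orders
  \<open>\<theta> |F|\<^sup>e\<close> with the same factor \<open>\<theta>\<close>, where \<open>e\<close> is half the sum of the group order and the number of
  solutions of \<open>g\<^sup>2 = 1\<close>, minus one. Defects are closed under addition and contain all \<open>z + z\<^sup>*\<close>, so one
  only has to find defects concentrated at a class \<open>g\<close> with \<open>g\<^sup>2 = c\<close>: \<open>1 + b (h + g h)\<close> has one if
  the involution \<open>h\<close> inverts \<open>g\<close>, and \<open>1 + b (p + p\<^sup>-\<^sup>1)\<close> has one if \<open>g = p\<^sup>2\<close>; the element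
  \<open>1 + b (g + g s)\<close> moves a defect from \<open>g\<close> to \<open>g s\<close> for an involution \<open>s\<close> commuting with \<open>g\<close>.

  For an abelian 2-group \<open>A\<close> one divides by involutions that are fourth powers until the exponent
  divides four. There a unitary element is a group element times a symmetric element, and so \<open>\<theta>\<close> is
  the number of involutions in \<open>A\<^sup>2\<close>, plus one. For the groups of the theorem \<open>A = G / G'\<close>
  gives \<open>\<theta> = 2\<close> if \<open>m = 1\<close> and \<open>\<theta> = 4\<close> otherwise. If \<open>m \<ge> 2\<close> then \<open>c\<close> is the fourth power of an element
  with central square; if \<open>m = 1\<close> every \<open>g\<close> with \<open>g\<^sup>2 = c\<close> is inverted by an involution.
\<close>

subsection \<open>Sums and counting in characteristic two\<close>

text \<open>The exponent takes care of itself. Let s be the number of self-inverse classes in A and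
  t the number of classes of elements g with g^2 = c. Over each unitary element of FA lie |F|^|A|
  elements of FG, the possible defects number |F|^((|A| - s)/2 + t), and |G| = 2|A|, |Omega1 G| = 2s
  - 2t; these figures turn e for A into e for G, so only the factor is carried along. Defects add
  because A is abelian: in the norm of a product the second defect is multiplied by a unitary
  element of FA and by its star, which cancel. Concentrated defects may have any coefficient because
  every element of a finite field of characteristic two is a square. The groups of the theorem enter
  through squares and commutators only. In integer coordinates both become parity conditions: for m
  = 1 an inverting involution is a zero of a quadratic form that pairs oddly with g under the
  commutator form. That the presentations do not collapse, so that the coordinates are faithful,
  follows by evaluating words in the integer Heisenberg group.\<close>

lemma char2_add_self:
  assumes "CHAR('f::field) = 2"
  shows "x + x = (0 :: 'f)"
proof -
  have "of_nat 2 = (0 :: 'f)"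
    using of_nat_CHAR[where 'a = 'f] unfolding assms .
  then have "(2 :: 'f) = 0" by simp
  then show ?thesis by (metis mult_2 mult_zero_left)
qed

lemma char2_add_eq_0_iff:
  assumes "CHAR('f::field) = 2"
  shows "x + y = 0 \<longleftrightarrow> x = (y :: 'f)"
proof -
  have "x + y = 0 \<longleftrightarrow> x + y = y + y" by (simp only: char2_add_self[OF assms])
  then show ?thesis by (simp only: add_right_cancel)
qed

lemma char2_add_assoc_cancel:
  assumes "CHAR('f::field) = 2"
  shows "x + (x + y) = (y :: 'f)"
  by (simp add: add.assoc[symmetric] char2_add_self[OF assms])

text \<open>An arbitrary injection into the naturals orders each two-element orbit of
  \<open>i\<close>; \<open>R\<close> collects the smaller elements. It serves both to cancel sums in
  pairs and to count functions invariant under \<open>i\<close>.\<close>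

lemma involution_transversal:
  assumes fin: "finite S"
    and i: "\<And>x. x \<in> S \<Longrightarrow> i x \<in> S" "\<And>x. x \<in> S \<Longrightarrow> i (i x) = x"
  obtains R where "R \<subseteq> S" "R \<inter> i ` R = {}" "R \<union> i ` R = {x \<in> S. i x \<noteq> x}"
    "card (R \<union> i ` R) = 2 * card R" "inj_on i R"
proof -
  obtain f :: "'a \<Rightarrow> nat" where f: "inj_on f S"
    using finite_imp_inj_to_nat_seg[OF fin] by blast
  define R where "R = {x \<in> S. f x < f (i x)}"
  have R: "R \<subseteq> S" by (auto simp: R_def)
  have disj: "R \<inter> i ` R = {}"
  proof -
    have "i x \<notin> R" if "x \<in> R" for x
      using that i(1)[of x] i(2)[of x] by (auto simp: R_def)
    then show ?thesis by blast
  qed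
  have un: "R \<union> i ` R = {x \<in> S. i x \<noteq> x}"
  proof (intro equalityI subsetI)
    fix x assume "x \<in> R \<union> i ` R"
    then show "x \<in> {x \<in> S. i x \<noteq> x}"
      unfolding R_def using i by auto
  next
    fix x assume x: "x \<in> {x \<in> S. i x \<noteq> x}"
    then have ne: "f x \<noteq> f (i x)"
      using f i by (auto dest: inj_onD)
    show "x \<in> R \<union> i ` R"
    proof (cases "f x < f (i x)")
      case True
      then show ?thesis using x by (simp add: R_def)
    next
      case False
      then have "i x \<in> R" using x ne i by (simp add: R_def)
      then have "i (i x) \<in> i ` R" by blast
      then show ?thesis using x i by simp
    qed
  qed
  have inj: "inj_on i R"
    by (rule inj_on_inverseI[where g = i]) (use R i in auto)
  have "finite R" using R fin finite_subset by blast
  then have "card (R \<union> i ` R) = 2 * card R"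
    using disj inj by (simp add: card_Un_disjoint card_image)
  then show thesis using that R disj un inj by blast
qed

text \<open>A two-element orbit contributes \<open>F x + F x = 0\<close>, which leaves the fixed
  points.\<close>

lemma sum_involution:
  fixes F :: "'a \<Rightarrow> 'f::field"
  assumes "CHAR('f) = 2" and "finite S"
    and i: "\<And>x. x \<in> S \<Longrightarrow> i x \<in> S" "\<And>x. x \<in> S \<Longrightarrow> i (i x) = x"
    and F: "\<And>x. x \<in> S \<Longrightarrow> F (i x) = F x"
  shows "sum F S = sum F {x \<in> S. i x = x}"
proof -
  obtain R where R: "R \<subseteq> S" "R \<inter> i ` R = {}" "R \<union> i ` R = {x \<in> S. i x \<noteq> x}"
      "card (R \<union> i ` R) = 2 * card R" "inj_on i R"
    by (rule involution_transversal[OF assms(2) i])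
  have finR: "finite R" using R(1) assms(2) finite_subset by blast
  have "sum F (i ` R) = sum F R"
    unfolding sum.reindex[OF R(5)] using F R(1) by (auto intro: sum.cong)
  then have "sum F {x \<in> S. i x \<noteq> x} = sum F R + sum F R"
    unfolding R(3)[symmetric] using finR R(2) by (simp add: sum.union_disjoint)
  then have 0: "sum F {x \<in> S. i x \<noteq> x} = 0"
    by (simp add: char2_add_self[OF assms(1)])
  have "S = {x \<in> S. i x = x} \<union> {x \<in> S. i x \<noteq> x}" by auto
  then have "sum F S = sum F ({x \<in> S. i x = x} \<union> {x \<in> S. i x \<noteq> x})" by simp
  also have "\<dots> = sum F {x \<in> S. i x = x} + sum F {x \<in> S. i x \<noteq> x}"
    using assms(2) by (intro sum.union_disjoint) auto
  finally show ?thesis using 0 by simp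
qed

lemma sum_square_char2:
  fixes f :: "'a \<Rightarrow> 'f::field"
  assumes "CHAR('f) = 2"
  shows "(sum f S)\<^sup>2 = (\<Sum>x\<in>S. (f x)\<^sup>2)"
proof (induction S rule: infinite_finite_induct)
  case (insert x S)
  have "(a + b)\<^sup>2 = a\<^sup>2 + b\<^sup>2" for a b :: 'f
  proof -
    have "(a + b)\<^sup>2 = a\<^sup>2 + b\<^sup>2 + (a * b + a * b)"
      by (simp add: power2_eq_square algebra_simps)
    then show ?thesis by (simp add: char2_add_self[OF assms])
  qed
  then show ?case using insert by simp
qed auto

text \<open>Squaring is injective because \<open>- z = z\<close>, hence surjective on a finite
  field. Such a root is the coefficient that realises a prescribed defect.\<close>

lemma square_surj_char2:
  fixes x :: "'f::{field,finite}"
  assumes "CHAR('f) = 2"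
  obtains y where "y\<^sup>2 = x"
proof -
  have "inj (\<lambda>y :: 'f. y\<^sup>2)"
  proof (rule injI)
    fix y z :: 'f
    assume "y\<^sup>2 = z\<^sup>2"
    then have "y = z \<or> y = - z" by (simp add: power2_eq_iff)
    moreover have "- z = z" using char2_add_self[OF assms, of z] by (rule minus_unique)
    ultimately show "y = z" by auto
  qed
  then have "surj (\<lambda>y :: 'f. y\<^sup>2)" by (simp add: finite_UNIV_inj_surj)
  then show thesis using that by (metis surjE)
qed

section \<open>Counting functions on a finite set\<close>

lemma card_fibres:
  assumes "finite S" and "\<And>y. y \<in> Y \<Longrightarrow> card {x \<in> S. f x = y} = k" and "f ` S \<subseteq> Y" and "finite Y"
  shows "card S = k * card Y"
proof -
  have "card S = card (\<Union>y\<in>Y. {x \<in> S. f x = y})"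
    using assms(3) by (intro arg_cong[where f = card]) auto
  also have "\<dots> = (\<Sum>y\<in>Y. card {x \<in> S. f x = y})"
    using assms by (intro card_UN_disjoint) auto
  also have "\<dots> = k * card Y" using assms(2) by simp
  finally show ?thesis .
qed

lemma card_supported_functions:
  assumes "finite S"
  shows "card {w :: 'a \<Rightarrow> 'f::{zero,finite}. \<forall>x. x \<notin> S \<longrightarrow> w x = 0} = CARD('f) ^ card S"
proof -
  have "bij_betw (\<lambda>w x. if x \<in> S then w x else 0) (S \<rightarrow>\<^sub>E (UNIV :: 'f set))
      {w. \<forall>x. x \<notin> S \<longrightarrow> w x = 0}"
  proof (rule bij_betw_byWitness[where f' = "\<lambda>w. restrict w S"])
    show "\<forall>a\<in>S \<rightarrow>\<^sub>E UNIV. (\<lambda>x\<in>S. if x \<in> S then a x else 0) = a"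
      by (auto simp: fun_eq_iff PiE_def extensional_def)
  qed (auto simp: fun_eq_iff)
  then show ?thesis
    using bij_betw_same_card card_PiE[OF assms, of "\<lambda>_. UNIV :: 'f set"] by fastforce
qed

lemma finite_supported_functions:
  assumes "finite S"
  shows "finite {w :: 'a \<Rightarrow> 'f::{zero,finite}. \<forall>x. x \<notin> S \<longrightarrow> w x = 0}"
  by (rule card_ge_0_finite)
    (simp only: card_supported_functions[OF assms] zero_less_power zero_less_card_finite)

text \<open>Such a function is free on one element of each two-element orbit and on the fixed points
  outside \<open>Y\<close>; all other values are forced.\<close>

lemma card_invariant_functions:
  assumes fin: "finite S"
    and i: "\<And>x. x \<in> S \<Longrightarrow> i x \<in> S" "\<And>x. x \<in> S \<Longrightarrow> i (i x) = x"
    and Y: "Y \<subseteq> {x \<in> S. i x = x}"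
  shows "card {w :: 'a \<Rightarrow> 'f::{zero,finite}. (\<forall>x. x \<notin> S \<longrightarrow> w x = 0) \<and>
      (\<forall>x\<in>S. w (i x) = w x) \<and> (\<forall>y\<in>Y. w y = 0)}
    = CARD('f) ^ ((card S - card {x \<in> S. i x = x}) div 2 + (card {x \<in> S. i x = x} - card Y))"
proof -
  obtain R where R: "R \<subseteq> S" "R \<inter> i ` R = {}" "R \<union> i ` R = {x \<in> S. i x \<noteq> x}" 
      "card (R \<union> i ` R) = 2 * card R" "inj_on i R"
    by (rule involution_transversal[OF fin i])
  define Fix where "Fix = {x \<in> S. i x = x}"
  define Z where "Z = R \<union> (Fix - Y)"
  have XR: "S - Fix = R \<union> i ` R" unfolding R(3) Fix_def by auto
  have finF: "finite Fix" "finite R" "finite Y"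
    using fin R(1) Y by (auto simp: Fix_def intro: finite_subset)
  have sub: "Fix \<subseteq> S" "Y \<subseteq> Fix" using Y by (auto simp: Fix_def)
  have "card R = (card S - card Fix) div 2"
    using R(4) XR card_Diff_subset[of Fix S] finF sub by simp
  moreover have "R \<inter> (Fix - Y) = {}" using XR sub by auto
  then have "card Z = card R + (card Fix - card Y)"
    unfolding Z_def using finF sub by (simp add: card_Un_disjoint card_Diff_subset)
  ultimately have cZ: "card Z = (card S - card Fix) div 2 + (card Fix - card Y)" by simp
  have finZ: "finite Z" using finF by (simp add: Z_def)
  \<comment> \<open>Extends free values on \<open>Z\<close> by invariance: a point in the image of
    \<open>R\<close> under \<open>i\<close> takes the value of its partner.\<close>
  let ?ext = "\<lambda>w x. if x \<in> Z then w x else if x \<in> i ` R then w (i x) else (0 :: 'f)"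
  let ?S = "{w :: 'a \<Rightarrow> 'f. (\<forall>x. x \<notin> S \<longrightarrow> w x = 0) \<and> (\<forall>x\<in>S. w (i x) = w x) \<and> (\<forall>y\<in>Y. w y = 0)}"
  have iRZ: "x \<in> i ` R \<Longrightarrow> x \<notin> Z" for x using R(2) XR by (auto simp: Z_def)
  have iiR: "x \<in> i ` R \<Longrightarrow> i x \<in> R" for x using i R(1) by auto
  have "bij_betw ?ext {w. \<forall>x. x \<notin> Z \<longrightarrow> w x = 0} ?S"
  proof (rule bij_betw_byWitness[where f' = "\<lambda>w x. if x \<in> Z then w x else 0"])
    show "\<forall>a\<in>{w. \<forall>x. x \<notin> Z \<longrightarrow> w x = 0}. (\<lambda>x. if x \<in> Z then ?ext a x else 0) = a"
      by (auto simp: fun_eq_iff)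
    show "\<forall>a'\<in>?S. ?ext (\<lambda>x. if x \<in> Z then a' x else 0) = a'"
    proof
      fix w assume w: "w \<in> ?S"
      have "?ext (\<lambda>x. if x \<in> Z then w x else 0) x = w x" for x
      proof -
        consider "x \<in> Z" | "x \<in> i ` R" "x \<notin> Z" | "x \<in> Y" "x \<notin> Z" "x \<notin> i ` R" | "x \<notin> S" "x \<notin> Z" "x \<notin> i ` R"
          using XR by (auto simp: Z_def)
        then show ?thesis
        proof cases
          case 2
          then have "i x \<in> Z" "x \<in> S" using iiR i R(1) by (auto simp: Z_def)
          then show ?thesis using 2 w by auto
        qed (use w in auto)
      qed
      then show "?ext (\<lambda>x. if x \<in> Z then w x else 0) = w" by auto
    qed
    show "?ext ` {w. \<forall>x. x \<notin> Z \<longrightarrow> w x = 0} \<subseteq> ?S"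
    proof (rule image_subsetI)
      fix w :: "'a \<Rightarrow> 'f" assume w: "w \<in> {w. \<forall>x. x \<notin> Z \<longrightarrow> w x = 0}"
      have "Z \<subseteq> S" "i ` R \<subseteq> S" using XR sub R(1) by (auto simp: Z_def)
      then have 1: "\<forall>x. x \<notin> S \<longrightarrow> ?ext w x = 0" by auto
      have 2: "?ext w (i x) = ?ext w x" if x: "x \<in> S" for x
      proof -
        consider "x \<in> R" | "x \<in> i ` R" | "x \<in> Fix" using XR x by blast
        then show ?thesis
        proof cases
          case 1
          then have "x \<in> Z" "i x \<in> i ` R" "i x \<notin> Z" using iRZ by (auto simp: Z_def)
          then show ?thesis using i(2)[OF x] by simp
        next
          case 2
          then have "i x \<in> Z" "x \<notin> Z" using iRZ iiR by (auto simp: Z_def)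
          then show ?thesis using 2 by simp
        next
          case 3
          then show ?thesis by (simp add: Fix_def)
        qed
      qed
      have 3: "?ext w y = 0" if "y \<in> Y" for y
      proof -
        have "y \<notin> R \<union> i ` R" "y \<notin> Z" using that sub XR by (auto simp: Z_def)
        then show ?thesis by auto
      qed
      show "?ext w \<in> ?S" using 1 2 3 by blast
    qed
    show "(\<lambda>w x. if x \<in> Z then w x else 0) ` ?S \<subseteq> {w. \<forall>x. x \<notin> Z \<longrightarrow> w x = 0}" by auto
  qed
  from bij_betw_same_card[OF this] have "card ?S = CARD('f) ^ card Z"
    using card_supported_functions[OF finZ, where 'f = 'f] by simp
  then show ?thesis unfolding cZ Fix_def .
qed

subsection \<open>The group algebra of a finite group\<close>

abbreviation galg_mult :: "('a, 'b) monoid_scheme \<Rightarrow> ('a \<Rightarrow> 'f::field) \<Rightarrow> ('a \<Rightarrow> 'f) \<Rightarrow> 'a \<Rightarrow> 'f"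
    (infixl "\<diamondop>\<index>" 70) where
  "x \<diamondop>\<^bsub>G\<^esub> y \<equiv> x \<otimes>\<^bsub>group_algebra G\<^esub> y"

definition single :: "'a \<Rightarrow> 'f \<Rightarrow> 'a \<Rightarrow> 'f::zero" where
  "single g \<alpha> = (\<lambda>k. if k = g then \<alpha> else 0)"

text \<open>Only one of the two inverse equations and no condition on the coefficient sum:
  finiteness and characteristic two supply the rest in \<open>V_star_eq_unitaries\<close>.\<close>

definition unitaries :: "('a, 'b) monoid_scheme \<Rightarrow> ('a \<Rightarrow> 'f::field) set" where
  "unitaries G = {x \<in> carrier (group_algebra G). x \<diamondop>\<^bsub>G\<^esub> star G x = single \<one>\<^bsub>G\<^esub> 1}"

lemma mem_group_algebra_iff: "x \<in> carrier (group_algebra G) \<longleftrightarrow> (\<forall>g. g \<notin> carrier G \<longrightarrow> x g = 0)"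
  by (simp add: group_algebra_def)

lemma fun_add_self_char2:
  assumes "CHAR('f::field) = 2"
  shows "x + x = (0 :: 'a \<Rightarrow> 'f)"
  by (rule ext) (simp only: plus_fun_apply zero_fun_apply char2_add_self[OF assms])

lemma fun_two_eq_0_char2:
  assumes "CHAR('f::field) = 2"
  shows "(2 :: 'a \<Rightarrow> 'f) = 0"
  using fun_add_self_char2[OF assms, of 1] by (simp only: one_add_one)

lemma fun_add_cancel_char2:
  assumes "CHAR('f::field) = 2"
  shows "x + (x + y) = (y :: 'a \<Rightarrow> 'f)"
  by (rule ext) (simp only: plus_fun_apply char2_add_assoc_cancel[OF assms])

locale finite_group = group G for G (structure) +
  assumes fin: "finite (carrier G)"
begin

abbreviation "FG \<equiv> carrier (group_algebra G)"

lemma galg_mult_apply: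
  "g \<in> carrier G \<Longrightarrow> (x \<diamondop> y) g = (\<Sum>h\<in>carrier G. x h * y (inv h \<otimes> g))"
  by (simp add: group_algebra_def)

lemma galg_mult_outside: "g \<notin> carrier G \<Longrightarrow> (x \<diamondop> y) g = 0"
  by (simp add: group_algebra_def)

lemma galg_mult_closed [simp, intro]: "x \<diamondop> y \<in> FG"
  by (simp add: mem_group_algebra_iff galg_mult_outside)

lemma galg_add_closed [simp, intro]: "x \<in> FG \<Longrightarrow> y \<in> FG \<Longrightarrow> x + y \<in> FG"
  by (simp add: mem_group_algebra_iff)

lemma star_closed [simp, intro]: "star G x \<in> FG"
  by (simp add: mem_group_algebra_iff star_def)

lemma single_closed [simp, intro]: "g \<in> carrier G \<Longrightarrow> single g \<alpha> \<in> FG"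
  by (auto simp: mem_group_algebra_iff single_def)

lemma galg_one: "\<one>\<^bsub>group_algebra G\<^esub> = single \<one> 1"
  by (simp add: group_algebra_def single_def)

lemma galg_eqI:
  "x \<in> FG \<Longrightarrow> y \<in> FG \<Longrightarrow> (\<And>g. g \<in> carrier G \<Longrightarrow> x g = y g) \<Longrightarrow> x = y"
  by (rule ext) (metis mem_group_algebra_iff)

lemma finite_galg: "finite (FG :: ('a \<Rightarrow> 'f::{field,finite}) set)"
  using finite_supported_functions[OF fin, where 'f = 'f]
  by (simp add: group_algebra_def)

lemma card_galg: "card (FG :: ('a \<Rightarrow> 'f::{field,finite}) set) = CARD('f) ^ order G"
  using card_supported_functions[OF fin, where 'f = 'f]
  by (simp add: group_algebra_def order_def)

lemma galg_distrib_right: "(x + y) \<diamondop> z = x \<diamondop> z + y \<diamondop> z"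
  by (auto simp: group_algebra_def fun_eq_iff distrib_right sum.distrib)

lemma galg_distrib_left: "x \<diamondop> (y + z) = x \<diamondop> y + x \<diamondop> z"
  by (auto simp: group_algebra_def fun_eq_iff distrib_left sum.distrib)

lemmas galg_distribs = galg_distrib_left galg_distrib_right

lemma inv_mult_cancel [simp]:
  assumes "g \<in> carrier G" "h \<in> carrier G"
  shows "inv g \<otimes> (g \<otimes> h) = h" "g \<otimes> (inv g \<otimes> h) = h"
  using assms by (simp_all add: m_assoc[symmetric])

lemma mult_inv_cancel:
  assumes "g \<in> carrier G" "h \<in> carrier G"
  shows "g \<otimes> h \<otimes> inv h = g" "g \<otimes> inv h \<otimes> h = g"
  using assms by (simp_all add: m_assoc)

lemma sum_translate_left:
  assumes "g \<in> carrier G"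
  shows "(\<Sum>h\<in>carrier G. F (g \<otimes> h)) = (\<Sum>h\<in>carrier G. F h)"
  by (rule sum.reindex_bij_witness[where i = "\<lambda>h. inv g \<otimes> h" and j = "\<lambda>h. g \<otimes> h"])
    (use assms in auto)

lemma galg_assoc: "(x \<diamondop> y) \<diamondop> z = x \<diamondop> (y \<diamondop> z)"
proof (rule galg_eqI)
  fix g assume g: "g \<in> carrier G"
  have "((x \<diamondop> y) \<diamondop> z) g
      = (\<Sum>h\<in>carrier G. \<Sum>k\<in>carrier G. x k * y (inv k \<otimes> h) * z (inv h \<otimes> g))"
    using g by (simp add: galg_mult_apply sum_distrib_right)
  also have "\<dots> = (\<Sum>k\<in>carrier G. \<Sum>h\<in>carrier G. x k * y (inv k \<otimes> h) * z (inv h \<otimes> g))"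
    by (rule sum.swap)
  also have "\<dots> = (\<Sum>k\<in>carrier G. x k * (y \<diamondop> z) (inv k \<otimes> g))"
  proof (rule sum.cong[OF refl])
    fix k assume k: "k \<in> carrier G"
    have "(\<Sum>h\<in>carrier G. x k * y (inv k \<otimes> h) * z (inv h \<otimes> g))
        = (\<Sum>l\<in>carrier G. x k * y (inv k \<otimes> (k \<otimes> l)) * z (inv (k \<otimes> l) \<otimes> g))"
      by (rule sum_translate_left[OF k, symmetric])
    also have "\<dots> = (\<Sum>l\<in>carrier G. x k * y l * z (inv l \<otimes> (inv k \<otimes> g)))"
      using k g by (intro sum.cong refl) (simp add: inv_mult_group m_assoc)
    finally show "(\<Sum>h\<in>carrier G. x k * y (inv k \<otimes> h) * z (inv h \<otimes> g))
        = x k * (y \<diamondop> z) (inv k \<otimes> g)"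
      using k g by (simp add: galg_mult_apply sum_distrib_left mult.assoc)
  qed
  finally show "((x \<diamondop> y) \<diamondop> z) g = (x \<diamondop> (y \<diamondop> z)) g"
    using g by (simp add: galg_mult_apply)
qed auto

lemma single_mult_apply:
  assumes "g \<in> carrier G" "k \<in> carrier G"
  shows "(single g \<alpha> \<diamondop> x) k = \<alpha> * x (inv g \<otimes> k)"
proof -
  have "(single g \<alpha> \<diamondop> x) k = (\<Sum>h\<in>carrier G. if h = g then \<alpha> * x (inv g \<otimes> k) else 0)"
    using assms by (auto simp: galg_mult_apply single_def intro!: sum.cong)
  then show ?thesis using assms fin by simp
qed

lemma mult_single_apply:
  assumes "g \<in> carrier G" "k \<in> carrier G"
  shows "(x \<diamondop> single g \<alpha>) k = x (k \<otimes> inv g) * \<alpha>"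
proof -
  have "inv h \<otimes> k = g \<longleftrightarrow> h = k \<otimes> inv g" if "h \<in> carrier G" for h
    using that assms by (metis inv_closed inv_solve_left' inv_solve_right m_closed)
  then have "(x \<diamondop> single g \<alpha>) k
      = (\<Sum>h\<in>carrier G. if h = k \<otimes> inv g then x (k \<otimes> inv g) * \<alpha> else 0)"
    using assms by (auto simp: galg_mult_apply single_def intro!: sum.cong)
  then show ?thesis using assms fin by simp
qed

lemma single_mult_single:
  assumes "g \<in> carrier G" "h \<in> carrier G"
  shows "single g \<alpha> \<diamondop> single h \<beta> = single (g \<otimes> h) (\<alpha> * \<beta>)"
proof (rule galg_eqI)
  fix k assume k: "k \<in> carrier G"
  have "inv g \<otimes> k = h \<longleftrightarrow> k = g \<otimes> h"
    using k assms by (metis inv_solve_left')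
  then show "(single g \<alpha> \<diamondop> single h \<beta>) k = single (g \<otimes> h) (\<alpha> * \<beta>) k"
    using assms k by (simp add: single_mult_apply) (simp add: single_def)
qed (use assms in auto)

lemma galg_one_left [simp]: "x \<in> FG \<Longrightarrow> single \<one> 1 \<diamondop> x = x"
  by (rule galg_eqI) (auto simp: single_mult_apply)

lemma galg_one_right [simp]: "x \<in> FG \<Longrightarrow> x \<diamondop> single \<one> 1 = x"
  by (rule galg_eqI) (auto simp: mult_single_apply)

section \<open>The involution, and the norm of \<open>x\<close>, meaning the product of
  \<open>x\<close> and \<open>star G x\<close>\<close>

lemma star_apply: "g \<in> carrier G \<Longrightarrow> star G x g = x (inv g)"
  by (simp add: star_def)

lemma star_add: "star G (x + y) = star G x + star G y"
  by (auto simp: star_def fun_eq_iff)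

lemma star_star [simp]: "x \<in> FG \<Longrightarrow> star G (star G x) = x"
  by (rule galg_eqI) (auto simp: star_apply)

lemma star_single: "g \<in> carrier G \<Longrightarrow> star G (single g \<alpha>) = single (inv g) \<alpha>"
  by (rule galg_eqI) (auto simp: star_apply, auto simp: single_def)

lemma star_one [simp]: "star G (single \<one> \<alpha>) = single \<one> \<alpha>"
  by (simp add: star_single)

lemma star_mult: "star G (x \<diamondop> y) = star G y \<diamondop> star G x"
proof (rule galg_eqI)
  fix g assume g: "g \<in> carrier G"
  have "(star G y \<diamondop> star G x) g = (\<Sum>l\<in>carrier G. y (inv l) * x (inv g \<otimes> l))"
    using g by (auto simp: galg_mult_apply star_apply inv_mult_group intro!: sum.cong)
  also have "\<dots> = (\<Sum>h\<in>carrier G. y (inv (g \<otimes> h)) * x (inv g \<otimes> (g \<otimes> h)))"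
    by (rule sum_translate_left[OF g, symmetric])
  also have "\<dots> = (\<Sum>h\<in>carrier G. x h * y (inv h \<otimes> inv g))"
    using g by (auto simp: inv_mult_group m_assoc[symmetric] mult.commute intro!: sum.cong)
  also have "\<dots> = star G (x \<diamondop> y) g"
    using g by (simp add: star_apply galg_mult_apply)
  finally show "star G (x \<diamondop> y) g = (star G y \<diamondop> star G x) g" ..
qed auto

lemma norm_apply:
  assumes "g \<in> carrier G"
  shows "(x \<diamondop> star G x) g = (\<Sum>h\<in>carrier G. x h * x (inv g \<otimes> h))"
  using assms by (auto simp: galg_mult_apply star_apply inv_mult_group intro!: sum.cong)

lemma norm_star: "star G (x \<diamondop> star G x) = x \<diamondop> star G x" if "x \<in> FG"
  using that by (simp add: star_mult)

text \<open>In the coefficient sum the terms for \<open>h\<close> and \<open>g \<otimes> h\<close>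
  agree, and translation by \<open>g \<noteq> \<one>\<close> fixes nothing, so everything cancels.
  This obstruction keeps defects away from classes of involutions.\<close>

lemma norm_involution:
  fixes x :: "'a \<Rightarrow> 'f::field"
  assumes "CHAR('f) = 2" "g \<in> carrier G" "g \<otimes> g = \<one>" "g \<noteq> \<one>"
  shows "(x \<diamondop> star G x) g = 0"
proof -
  have inv: "inv g = g" using assms by (simp add: inv_equality)
  have gg: "g \<otimes> (g \<otimes> h) = h" if "h \<in> carrier G" for h
    using that assms by (simp add: m_assoc[symmetric])
  have ne: "g \<otimes> h \<noteq> h" if "h \<in> carrier G" for h
    using that assms r_cancel_one' by metis
  have "(\<Sum>h\<in>carrier G. x h * x (g \<otimes> h)) = (\<Sum>h\<in>{h \<in> carrier G. g \<otimes> h = h}. x h * x (g \<otimes> h))"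
    by (rule sum_involution[OF assms(1) fin]) (use assms gg in \<open>auto simp: mult.commute\<close>)
  also have "{h \<in> carrier G. g \<otimes> h = h} = {}" using ne by auto
  finally show ?thesis using assms inv by (simp add: norm_apply)
qed

text \<open>Right multiplication by \<open>x\<close> is undone by \<open>y\<close>, so it is
  injective and, the algebra being finite, onto. Hence some \<open>z\<close> satisfies
  \<open>z x = 1\<close>, and it must equal \<open>y\<close>.\<close>

lemma galg_right_inverse_left:
  fixes x :: "'a \<Rightarrow> 'f::{field,finite}"
  assumes "x \<in> FG" "y \<in> FG" "x \<diamondop> y = single \<one> 1"
  shows "y \<diamondop> x = single \<one> 1"
proof -
  let ?r = "\<lambda>z. z \<diamondop> x"
  have cancel: "?r z \<diamondop> y = z" if "z \<in> FG" for z
    using that assms(3) by (simp only: galg_assoc galg_one_right)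
  have "inj_on ?r FG"
    by (rule inj_on_inverseI[where g = "\<lambda>z. z \<diamondop> y"]) (rule cancel)
  moreover have "?r ` FG \<subseteq> FG" by blast
  ultimately have "?r ` FG = FG" by (intro endo_inj_surj[OF finite_galg])
  moreover have "single \<one> 1 \<in> FG" by simp
  ultimately obtain z where z: "z \<in> FG" "?r z = single \<one> 1" by (metis imageE)
  have "y = ?r z \<diamondop> y" using assms(2) by (simp only: z(2) galg_one_left)
  also have "\<dots> = z" by (rule cancel[OF z(1)])
  finally show ?thesis using z(2) by simp
qed

lemma galg_monoid: "monoid (group_algebra G)"
  by (rule monoidI) (auto simp: galg_one galg_assoc)

text \<open>At \<open>\<one>\<close> all products are squares, and squaring is additive.\<close>

lemma norm_at_one:
  fixes x :: "'a \<Rightarrow> 'f::field"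
  assumes "CHAR('f) = 2"
  shows "(x \<diamondop> star G x) \<one> = (\<Sum>g\<in>carrier G. x g)\<^sup>2"
  unfolding sum_square_char2[OF assms] norm_apply[OF one_closed]
  by (rule sum.cong) (simp_all add: power2_eq_square)

lemma sum_unitary:
  fixes x :: "'a \<Rightarrow> 'f::field"
  assumes "CHAR('f) = 2" "x \<in> unitaries G"
  shows "(\<Sum>g\<in>carrier G. x g) = 1"
proof -
  have "(\<Sum>g\<in>carrier G. x g)\<^sup>2 = 1"
    using norm_at_one[OF assms(1), of x] assms(2) by (simp add: unitaries_def single_def)
  moreover have "- 1 = (1 :: 'f)" using char2_add_self[OF assms(1)] by (rule minus_unique)
  ultimately show ?thesis by (metis power2_eq_1_iff)
qed

text \<open>The coefficient sum of a unitary element has square 1, hence is 1; its right inverse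
  \<open>star G x\<close> is two-sided by finiteness.\<close>

lemma V_star_eq_unitaries:
  assumes "CHAR('f::{field,finite}) = 2"
  shows "V_star G = (unitaries G :: ('a \<Rightarrow> 'f) set)"
proof (intro equalityI subsetI)
  interpret M: monoid "group_algebra G :: ('a \<Rightarrow> 'f) ring" by (rule galg_monoid)
  fix x :: "'a \<Rightarrow> 'f"
  { assume "x \<in> V_star G"
    then have "x \<in> FG" "x \<in> Units (group_algebra G)" "star G x = inv\<^bsub>group_algebra G\<^esub> x"
      by (auto simp: V_star_def V_def)
    then show "x \<in> unitaries G"
      using M.Units_r_inv[of x] by (simp add: unitaries_def galg_one) }
  { assume x: "x \<in> unitaries G"
    then have "x \<in> FG" "x \<diamondop> star G x = single \<one> 1" by (auto simp: unitaries_def)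
    note x' = this
    have r: "star G x \<diamondop> x = single \<one> 1"
      by (rule galg_right_inverse_left[OF x'(1) star_closed x'(2)])
    have "star G x = inv\<^bsub>group_algebra G\<^esub> x"
      by (rule M.inv_unique') (use x' r in \<open>simp_all add: galg_one\<close>)
    moreover have "x \<in> Units (group_algebra G)"
      unfolding Units_def galg_one using x' r star_closed[of x] by blast
    ultimately show "x \<in> V_star G"
      using sum_unitary[OF assms x] x'(1) by (simp add: V_star_def V_def) }
qed

lemma unitaries_mult:
  assumes "x \<in> unitaries G" "y \<in> unitaries G"
  shows "x \<diamondop> y \<in> unitaries G"
proof -
  have "(x \<diamondop> y) \<diamondop> star G (x \<diamondop> y) = x \<diamondop> (y \<diamondop> star G y) \<diamondop> star G x"
    by (simp add: star_mult galg_assoc)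
  then show ?thesis using assms by (simp add: unitaries_def)
qed

lemma single_unitary: "g \<in> carrier G \<Longrightarrow> single g 1 \<in> unitaries G"
  by (simp add: unitaries_def star_single single_mult_single)

end

subsection \<open>Central extensions by a group of order two\<close>

text \<open>Substituting \<open>inv h \<otimes> g\<close> for \<open>h\<close> swaps the two factors
  of each product.\<close>

lemma (in finite_group) galg_comm:
  assumes comm: "\<And>g h. g \<in> carrier G \<Longrightarrow> h \<in> carrier G \<Longrightarrow> g \<otimes> h = h \<otimes> g"
  shows "x \<diamondop> y = y \<diamondop> x"
proof (rule galg_eqI)
  fix g assume g: "g \<in> carrier G"
  have *: "inv (inv h \<otimes> g) \<otimes> g = h" if h: "h \<in> carrier G" for h
  proof -
    have "inv (inv h \<otimes> g) \<otimes> g = (h \<otimes> inv g) \<otimes> g"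
      using h g comm[of "inv g" h] by (simp add: inv_mult_group)
    then show ?thesis using h g by (simp add: m_assoc)
  qed
  have "(\<Sum>h\<in>carrier G. x h * y (inv h \<otimes> g)) = (\<Sum>h\<in>carrier G. y h * x (inv h \<otimes> g))"
    by (rule sum.reindex_bij_witness[where i = "\<lambda>h. inv h \<otimes> g" and j = "\<lambda>h. inv h \<otimes> g"])
      (use g * in \<open>auto simp: mult.commute\<close>)
  then show "(x \<diamondop> y) g = (y \<diamondop> x) g"
    using g by (simp add: galg_mult_apply)
qed auto

definition unitary_exponent :: "('a, 'b) monoid_scheme \<Rightarrow> nat" where
  "unitary_exponent G = (order G + card (Omega1 G)) div 2 - 1"

lemma (in group) Omega1_eq: "Omega1 G = {g \<in> carrier G. g \<otimes> g = \<one>}"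
  by (auto simp: Omega1_def numeral_2_eq_2)

text \<open>The quotient is an arbitrary group \<open>A\<close> with a surjection instead of a group
  of cosets, so that it can live on another type. Centrality of \<open>c\<close> is a consequence,
  see \<open>c_central\<close>.\<close>

locale double_cover = finite_group G + A: finite_group A for G (structure) and A +
  fixes \<pi> and c
  assumes pi_hom: "\<pi> \<in> hom G A"
    and pi_surj: "\<pi> ` carrier G = carrier A"
    and pi_ker: "g \<in> carrier G \<Longrightarrow> \<pi> g = \<one>\<^bsub>A\<^esub> \<longleftrightarrow> g = \<one> \<or> g = c"
    and c_closed [simp, intro]: "c \<in> carrier G"
    and c_ne: "c \<noteq> \<one>"
    and A_comm: "a \<in> carrier A \<Longrightarrow> b \<in> carrier A \<Longrightarrow> a \<otimes>\<^bsub>A\<^esub> b = b \<otimes>\<^bsub>A\<^esub> a"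
begin

sublocale pi: group_hom G A \<pi>
  by unfold_locales (rule pi_hom)

lemma pi_c [simp]: "\<pi> c = \<one>\<^bsub>A\<^esub>"
  using pi_ker[of c] by simp

lemma pi_kerD: "g \<in> carrier G \<Longrightarrow> \<pi> g = \<one>\<^bsub>A\<^esub> \<Longrightarrow> g = \<one> \<or> g = c"
  using pi_ker by blast

lemma cc [simp]: "c \<otimes> c = \<one>"
proof -
  have "c \<otimes> c = \<one> \<or> c \<otimes> c = c" by (rule pi_kerD) auto
  then show ?thesis using c_ne r_cancel_one'[of c c] by auto
qed

lemma inv_c [simp]: "inv c = c"
  by (rule inv_equality) auto

text \<open>Conjugates of \<open>c\<close> stay in the kernel \<open>{\<one>, c}\<close>, and a
  conjugate equal to \<open>\<one>\<close> would force \<open>c = \<one>\<close>.\<close>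

lemma c_central: "g \<in> carrier G \<Longrightarrow> c \<otimes> g = g \<otimes> c"
proof -
  assume g: "g \<in> carrier G"
  have "g \<otimes> c \<otimes> inv g = \<one> \<or> g \<otimes> c \<otimes> inv g = c"
    by (rule pi_kerD) (use g in auto)
  moreover have "g \<otimes> c \<otimes> inv g \<otimes> g = g \<otimes> c" using g by (simp add: m_assoc)
  ultimately have "g = g \<otimes> c \<or> c \<otimes> g = g \<otimes> c" using g by auto
  then show ?thesis using g c_ne r_cancel_one'[of g c] by auto
qed

lemma mult_c_ne: "g \<in> carrier G \<Longrightarrow> g \<noteq> g \<otimes> c"
  using c_ne r_cancel_one'[of g c] by auto

lemma pi_eq_iff:
  assumes "g \<in> carrier G" "h \<in> carrier G"
  shows "\<pi> h = \<pi> g \<longleftrightarrow> h = g \<or> h = g \<otimes> c"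
proof
  assume eq: "\<pi> h = \<pi> g"
  have "inv g \<otimes> h = \<one> \<or> inv g \<otimes> h = c"
    by (rule pi_kerD) (use assms eq in auto)
  then have "g \<otimes> (inv g \<otimes> h) = g \<otimes> \<one> \<or> g \<otimes> (inv g \<otimes> h) = g \<otimes> c" by auto
  then show "h = g \<or> h = g \<otimes> c" using assms by simp
qed (use assms in auto)

lemma fibre: "g \<in> carrier G \<Longrightarrow> {h \<in> carrier G. \<pi> h = \<pi> g} = {g, g \<otimes> c}"
  using pi_eq_iff[of g] by auto

lemma pi_surjE:
  assumes "a \<in> carrier A"
  obtains g where "g \<in> carrier G" "a = \<pi> g"
  using assms pi_surj by blast

lemma card_preimage:
  assumes "S \<subseteq> carrier A"
  shows "card {g \<in> carrier G. \<pi> g \<in> S} = 2 * card S"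
proof (rule card_fibres[where f = \<pi>])
  show "card {g \<in> {g \<in> carrier G. \<pi> g \<in> S}. \<pi> g = a} = 2" if a: "a \<in> S" for a
  proof -
    obtain g where g: "g \<in> carrier G" "a = \<pi> g" using pi_surjE a assms by blast
    have "{g \<in> {g \<in> carrier G. \<pi> g \<in> S}. \<pi> g = a} = {h \<in> carrier G. \<pi> h = \<pi> g}"
      using a g by auto
    then show ?thesis using fibre[OF g(1)] mult_c_ne[OF g(1)] by simp
  qed
  show "finite S" using assms A.fin finite_subset by blast
qed (use fin in auto)

text \<open>The algebra homomorphism from FG to FA induced by \<open>\<pi>\<close>, written on
  coefficients.\<close>

definition push :: "('a \<Rightarrow> 'f::field) \<Rightarrow> 'c \<Rightarrow> 'f" where
  "push x = (\<lambda>a. \<Sum>g\<in>{g \<in> carrier G. \<pi> g = a}. x g)"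

text \<open>The product of \<open>1 + c\<close> with any element over \<open>f\<close>. So
  \<open>lift\<close> identifies FA with the ideal generated by \<open>1 + c\<close>, which in
  characteristic two is the kernel of \<open>push\<close>.\<close>

definition lift :: "('c \<Rightarrow> 'f::field) \<Rightarrow> 'a \<Rightarrow> 'f" where
  "lift f = (\<lambda>g. if g \<in> carrier G then f (\<pi> g) else 0)"

lemma push_apply: "g \<in> carrier G \<Longrightarrow> push x (\<pi> g) = x g + x (g \<otimes> c)"
  using mult_c_ne by (simp add: push_def fibre)

lemma push_closed [simp, intro]: "push x \<in> A.FG"
proof -
  have "push x a = 0" if "a \<notin> carrier A" for a
    unfolding push_def by (rule sum.neutral) (use that in auto)
  then show ?thesis by (simp add: mem_group_algebra_iff)
qed

lemma lift_apply: "g \<in> carrier G \<Longrightarrow> lift f g = f (\<pi> g)"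
  by (simp add: lift_def)

lemma lift_closed [simp, intro]: "lift f \<in> FG"
  by (simp add: mem_group_algebra_iff lift_def)

lemma push_eqI:
  assumes "u \<in> A.FG" "v \<in> A.FG" "\<And>g. g \<in> carrier G \<Longrightarrow> u (\<pi> g) = v (\<pi> g)"
  shows "u = v"
  by (rule A.galg_eqI[OF assms(1,2)]) (metis assms(3) pi_surjE)

lemma push_add: "push (x + y) = push x + push y"
  by (simp add: push_def fun_eq_iff sum.distrib)

lemma lift_add: "lift (f + f') = lift f + lift f'"
  by (simp add: lift_def fun_eq_iff)

lemma fibre_sum: "(\<Sum>h\<in>carrier G. x h * F (\<pi> h)) = (\<Sum>a\<in>carrier A. push x a * F a)"
proof -
  have "(\<Sum>a\<in>carrier A. push x a * F a)
      = (\<Sum>a\<in>carrier A. \<Sum>h\<in>{h \<in> carrier G. \<pi> h = a}. x h * F (\<pi> h))"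
    by (simp add: push_def sum_distrib_right)
  also have "\<dots> = (\<Sum>h\<in>carrier G. x h * F (\<pi> h))"
    by (rule sum.group) (use fin A.fin in auto)
  finally show ?thesis ..
qed

lemma push_mult: "push (x \<diamondop> y) = push x \<diamondop>\<^bsub>A\<^esub> push y"
proof (rule push_eqI)
  fix g assume g: "g \<in> carrier G"
  have "push (x \<diamondop> y) (\<pi> g) = (\<Sum>h\<in>carrier G. x h * push y (inv\<^bsub>A\<^esub> \<pi> h \<otimes>\<^bsub>A\<^esub> \<pi> g))"
    unfolding push_apply[OF g] galg_mult_apply[OF g] galg_mult_apply[OF m_closed[OF g c_closed]]
      sum.distrib[symmetric]
  proof (rule sum.cong[OF refl])
    fix h assume h: "h \<in> carrier G"
    have "push y (inv\<^bsub>A\<^esub> \<pi> h \<otimes>\<^bsub>A\<^esub> \<pi> g) = y (inv h \<otimes> g) + y (inv h \<otimes> (g \<otimes> c))"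
      using push_apply[of "inv h \<otimes> g" y] g h by (simp add: m_assoc)
    then show "x h * y (inv h \<otimes> g) + x h * y (inv h \<otimes> (g \<otimes> c))
        = x h * push y (inv\<^bsub>A\<^esub> \<pi> h \<otimes>\<^bsub>A\<^esub> \<pi> g)"
      by (simp add: distrib_left)
  qed
  also have "\<dots> = (push x \<diamondop>\<^bsub>A\<^esub> push y) (\<pi> g)"
    unfolding fibre_sum[of x "\<lambda>a. push y (inv\<^bsub>A\<^esub> a \<otimes>\<^bsub>A\<^esub> \<pi> g)"]
    using g by (simp add: A.galg_mult_apply)
  finally show "push (x \<diamondop> y) (\<pi> g) = (push x \<diamondop>\<^bsub>A\<^esub> push y) (\<pi> g)" .
qed auto

text \<open>On the ideal generated by \<open>1 + c\<close> the factor \<open>c\<close> acts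
  trivially, so an element of FG acts through its image in FA.\<close>

lemma mult_lift: "x \<diamondop> lift f = lift (push x \<diamondop>\<^bsub>A\<^esub> f)"
proof (rule galg_eqI)
  fix g assume g: "g \<in> carrier G"
  have "(x \<diamondop> lift f) g = (\<Sum>h\<in>carrier G. x h * f (inv\<^bsub>A\<^esub> \<pi> h \<otimes>\<^bsub>A\<^esub> \<pi> g))"
    using g by (simp add: galg_mult_apply lift_apply)
  also have "\<dots> = lift (push x \<diamondop>\<^bsub>A\<^esub> f) g"
    unfolding fibre_sum[of x "\<lambda>a. f (inv\<^bsub>A\<^esub> a \<otimes>\<^bsub>A\<^esub> \<pi> g)"]
    using g by (simp add: A.galg_mult_apply lift_apply)
  finally show "(x \<diamondop> lift f) g = lift (push x \<diamondop>\<^bsub>A\<^esub> f) g" .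
qed auto

lemma push_star: "push (star G x) = star A (push x)"
proof (rule push_eqI)
  fix g assume g: "g \<in> carrier G"
  then have "push x (inv\<^bsub>A\<^esub> \<pi> g) = x (inv g) + x (inv g \<otimes> c)"
    using push_apply[of "inv g" x] by simp
  moreover have "inv (g \<otimes> c) = inv g \<otimes> c"
    using g by (simp add: inv_mult_group c_central)
  ultimately show "push (star G x) (\<pi> g) = star A (push x) (\<pi> g)"
    using g by (simp add: push_apply star_apply A.star_apply)
qed auto

lemma lift_star: "lift (star A f) = star G (lift f)"
  by (rule galg_eqI) (auto simp: lift_apply star_apply A.star_apply)

text \<open>The mirror image of \<open>mult_lift\<close>, obtained by applying the
  involution.\<close>

lemma lift_mult:
  assumes "f \<in> A.FG" "x \<in> FG"
  shows "lift f \<diamondop> x = lift (f \<diamondop>\<^bsub>A\<^esub> push x)"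
proof -
  have "lift f \<diamondop> x = star G (star G x \<diamondop> star G (lift f))"
    using assms by (simp add: star_mult)
  also have "\<dots> = star G (lift (push (star G x) \<diamondop>\<^bsub>A\<^esub> star A f))"
    by (simp add: lift_star[symmetric] mult_lift)
  also have "\<dots> = lift (f \<diamondop>\<^bsub>A\<^esub> push x)"
    using assms by (simp add: lift_star[symmetric] A.star_mult push_star)
  finally show ?thesis .
qed

lemma push_single: "g \<in> carrier G \<Longrightarrow> push (single g \<alpha>) = single (\<pi> g) \<alpha>"
proof (rule push_eqI)
  fix h assume *: "g \<in> carrier G" "h \<in> carrier G"
  then show "push (single g \<alpha>) (\<pi> h) = single (\<pi> g) \<alpha> (\<pi> h)"
    using pi_eq_iff[of h g] mult_c_ne[of h] unfolding push_apply[OF *(2)] single_def by auto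
qed auto

lemma push_one: "push (single \<one> \<alpha>) = single \<one>\<^bsub>A\<^esub> \<alpha>"
  by (simp add: push_single)

lemma lift_single: "g \<in> carrier G \<Longrightarrow> lift (single (\<pi> g) \<alpha>) = single g \<alpha> + single (g \<otimes> c) \<alpha>"
proof (rule galg_eqI)
  fix h assume *: "g \<in> carrier G" "h \<in> carrier G"
  then show "lift (single (\<pi> g) \<alpha>) h = (single g \<alpha> + single (g \<otimes> c) \<alpha>) h"
    using pi_eq_iff[of g h] mult_c_ne[of g]
    unfolding lift_apply[OF *(2)] plus_fun_apply single_def by auto
qed auto

lemma push_lift:
  fixes f :: "'c \<Rightarrow> 'f::field"
  assumes "CHAR('f) = 2"
  shows "push (lift f) = 0"
proof (rule push_eqI)
  show "push (lift f) (\<pi> g) = 0 (\<pi> g)" if "g \<in> carrier G" for g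
  proof -
    have "push (lift f) (\<pi> g) = f (\<pi> g) + f (\<pi> g)"
      using that by (simp add: push_apply lift_apply)
    then show ?thesis by (simp only: char2_add_self[OF assms] zero_fun_apply)
  qed
next
  show "push (lift f) \<in> A.FG" by (rule push_closed)
qed (simp add: mem_group_algebra_iff)

lemma lift_inj: "inj_on lift A.FG"
proof (rule inj_onI)
  fix f f' :: "'c \<Rightarrow> 'f::field"
  assume *: "f \<in> A.FG" "f' \<in> A.FG" "lift f = lift f'"
  show "f = f'"
    by (rule push_eqI[OF *(1,2)]) (metis *(3) lift_apply)
qed

text \<open>A vanishing fibre sum means \<open>x g = x (g \<otimes> c)\<close> in characteristic
  two, so \<open>x\<close> is constant on fibres and can be read off at representatives.\<close>

lemma push_eq_0:
  fixes x :: "'a \<Rightarrow> 'f::field"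
  assumes "CHAR('f) = 2" "x \<in> FG" "push x = 0"
  obtains f where "f \<in> A.FG" "x = lift f"
proof -
  define r where "r = (\<lambda>a. SOME g. g \<in> carrier G \<and> a = \<pi> g)"
  have r: "r a \<in> carrier G" "\<pi> (r a) = a" if "a \<in> carrier A" for a
    using someI_ex[of "\<lambda>g. g \<in> carrier G \<and> a = \<pi> g"] pi_surjE[OF that] unfolding r_def by metis+
  define f where "f = (\<lambda>a. if a \<in> carrier A then x (r a) else 0)"
  have "x = lift f"
  proof (rule galg_eqI)
    fix g assume g: "g \<in> carrier G"
    then have "r (\<pi> g) = g \<or> r (\<pi> g) = g \<otimes> c"
      using pi_eq_iff[of g "r (\<pi> g)"] r[of "\<pi> g"] by simp
    moreover have "x g + x (g \<otimes> c) = 0"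
      using push_apply[OF g, of x] assms(3) by simp
    ultimately show "x g = lift f g"
      using g char2_add_eq_0_iff[OF assms(1)] by (auto simp: lift_apply f_def)
  qed (use assms in auto)
  moreover have "f \<in> A.FG" by (simp add: mem_group_algebra_iff f_def)
  ultimately show thesis using that by blast
qed

lemma push_onto:
  assumes "u \<in> A.FG"
  obtains x where "x \<in> FG" "push x = u"
proof -
  define r where "r = (\<lambda>a. SOME g. g \<in> carrier G \<and> a = \<pi> g)"
  have r: "r a \<in> carrier G" "\<pi> (r a) = a" if "a \<in> carrier A" for a
    using someI_ex[of "\<lambda>g. g \<in> carrier G \<and> a = \<pi> g"] pi_surjE[OF that] unfolding r_def by metis+
  \<comment> \<open>The whole value of \<open>u\<close> is placed on one representative of each
    fibre.\<close>
  define x where "x = (\<lambda>g. if g \<in> carrier G \<and> r (\<pi> g) = g then u (\<pi> g) else 0)"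
  have "push x = u"
  proof (rule push_eqI)
    fix g assume g: "g \<in> carrier G"
    then have "r (\<pi> g) = g \<or> r (\<pi> g) = g \<otimes> c"
      using pi_eq_iff[of g "r (\<pi> g)"] r[of "\<pi> g"] by simp
    then show "push x (\<pi> g) = u (\<pi> g)"
      using g mult_c_ne[OF g] by (auto simp: push_apply x_def)
  qed (use assms in auto)
  moreover have "x \<in> FG" by (simp add: mem_group_algebra_iff x_def)
  ultimately show thesis using that by blast
qed

end

lemma (in finite_group) zero_mult [simp]: "0 \<diamondop> x = 0"
  by (rule galg_eqI) (auto simp: galg_mult_apply galg_mult_outside mem_group_algebra_iff)

section \<open>Defects of elements over unitary elements of FA\<close>

context double_cover
begin

definition c_roots :: "'c set" where
  "c_roots = \<pi> ` {g \<in> carrier G. g \<otimes> g = c}"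

definition defects :: "('c \<Rightarrow> 'f::field) set" where
  "defects = {w \<in> A.FG. \<exists>x \<in> FG. x \<diamondop> star G x = single \<one> 1 + lift w}"

definition cover_unitaries :: "('a \<Rightarrow> 'f::field) set" where
  "cover_unitaries = {x \<in> FG. push x \<in> unitaries A}"

lemma lift_zero: "lift 0 = 0"
  by (simp add: lift_def fun_eq_iff)

lemma push_norm: "push (x \<diamondop> star G x) = push x \<diamondop>\<^bsub>A\<^esub> star A (push x)"
  by (simp add: push_mult push_star)

lemma defect_cover:
  fixes x :: "'a \<Rightarrow> 'f::field"
  assumes "CHAR('f) = 2" "x \<in> FG" "x \<diamondop> star G x = single \<one> 1 + lift w"
  shows "x \<in> cover_unitaries"
  using push_norm[of x] assms
  by (simp add: cover_unitaries_def unitaries_def push_add push_one push_lift)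

text \<open>The sum of 1 and the norm of \<open>x\<close> is killed by \<open>push\<close>, so
  \<open>push_eq_0\<close> reads it as a \<open>lift\<close>.\<close>

lemma cover_defect:
  fixes x :: "'a \<Rightarrow> 'f::field"
  assumes "CHAR('f) = 2" "x \<in> cover_unitaries"
  obtains w where "w \<in> A.FG" "x \<diamondop> star G x = single \<one> 1 + lift w"
proof -
  have "push (single \<one> 1 + x \<diamondop> star G x) = 0"
    using assms(2)
    by (simp add: push_add push_one push_norm cover_unitaries_def unitaries_def
        fun_add_self_char2[OF assms(1)])
  then obtain w where "w \<in> A.FG" "single \<one> 1 + x \<diamondop> star G x = lift w"
    using push_eq_0[OF assms(1)] by (metis galg_add_closed galg_mult_closed one_closed single_closed)
  then show thesis
    using that fun_add_cancel_char2[OF assms(1)] by metis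
qed

text \<open>The norm of \<open>x \<diamondop> y\<close> is the norm of \<open>y\<close> between
  \<open>x\<close> and \<open>star G x\<close>; the defect \<open>w'\<close> inside it is multiplied
  by \<open>push x\<close> and its star, whose product is 1.\<close>

lemma defects_add:
  fixes w w' :: "'c \<Rightarrow> 'f::field"
  assumes "CHAR('f) = 2" "w \<in> defects" "w' \<in> defects"
  shows "w + w' \<in> defects"
proof -
  obtain x where x: "x \<in> FG" "x \<diamondop> star G x = single \<one> 1 + lift w" and w: "w \<in> A.FG"
    using assms(2) by (auto simp: defects_def)
  obtain y where y: "y \<in> FG" "y \<diamondop> star G y = single \<one> 1 + lift w'" and w': "w' \<in> A.FG"
    using assms(3) by (auto simp: defects_def)
  let ?u = "push x"
  have "?u \<in> unitaries A" using defect_cover[OF assms(1) x] by (simp add: cover_unitaries_def)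
  then have u: "?u \<diamondop>\<^bsub>A\<^esub> star A ?u = single \<one>\<^bsub>A\<^esub> 1" by (simp add: unitaries_def)
  have "(x \<diamondop> y) \<diamondop> star G (x \<diamondop> y) = x \<diamondop> (y \<diamondop> star G y) \<diamondop> star G x"
    by (simp add: star_mult galg_assoc)
  also have "\<dots> = x \<diamondop> star G x + lift (?u \<diamondop>\<^bsub>A\<^esub> w') \<diamondop> star G x"
    using x(1) by (simp add: y galg_distribs mult_lift)
  also have "lift (?u \<diamondop>\<^bsub>A\<^esub> w') \<diamondop> star G x = lift (?u \<diamondop>\<^bsub>A\<^esub> w' \<diamondop>\<^bsub>A\<^esub> star A ?u)"
    by (simp add: lift_mult push_star)
  \<comment> \<open>Commutativity of FA brings the two unitary factors together.\<close>
  also have "?u \<diamondop>\<^bsub>A\<^esub> w' \<diamondop>\<^bsub>A\<^esub> star A ?u = w' \<diamondop>\<^bsub>A\<^esub> (?u \<diamondop>\<^bsub>A\<^esub> star A ?u)"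
    by (simp only: A.galg_comm[OF A_comm, of ?u w'] A.galg_assoc)
  also have "\<dots> = w'" using w' by (simp add: u)
  finally have "(x \<diamondop> y) \<diamondop> star G (x \<diamondop> y) = single \<one> 1 + lift (w + w')"
    by (simp only: x(2) lift_add add.assoc)
  then show ?thesis using w w' unfolding defects_def by blast
qed

text \<open>The element \<open>1 + lift z\<close> has this defect: a product of two lifts vanishes
  because \<open>push\<close> kills the first.\<close>

lemma defects_trace:
  fixes z :: "'c \<Rightarrow> 'f::field"
  assumes "CHAR('f) = 2" "z \<in> A.FG"
  shows "z + star A z \<in> defects"
proof -
  have "(single \<one> 1 + lift z) \<diamondop> star G (single \<one> 1 + lift z)
      = single \<one> 1 + lift (z + star A z)"
    by (simp add: star_add galg_distribs mult_lift push_lift[OF assms(1)] lift_star[symmetric]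
        lift_add lift_zero push_add push_one add.assoc)
  moreover have "single \<one> 1 + lift z \<in> FG" by simp
  ultimately show ?thesis using assms(2) unfolding defects_def by blast
qed

lemma square_c_inv:
  assumes "g \<in> carrier G" "g \<otimes> g = c"
  shows "inv g = g \<otimes> c"
proof -
  have "(g \<otimes> c) \<otimes> g = (g \<otimes> g) \<otimes> c"
    using assms(1) c_central[of g] by (simp add: m_assoc)
  then have "(g \<otimes> c) \<otimes> g = \<one>" using assms(2) by simp
  then show ?thesis using assms by (intro inv_equality) auto
qed

lemma c_roots_closed: "c_roots \<subseteq> carrier A"
  by (auto simp: c_roots_def)

text \<open>Both \<open>h\<close> and \<open>g \<otimes> h\<close> have square 1, which says that
  \<open>h\<close> inverts \<open>g\<close>. The square of their sum is \<open>g + g c\<close>: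
  their own squares cancel, and the mixed products are \<open>g\<close> and
  \<open>g c\<close>.\<close>

lemma single_defect_inverted:
  fixes \<alpha> :: "'f::{field,finite}"
  assumes F: "CHAR('f) = 2"
    and g: "g \<in> carrier G" "g \<otimes> g = c"
    and h: "h \<in> carrier G" "h \<otimes> h = \<one>" "(g \<otimes> h) \<otimes> (g \<otimes> h) = \<one>"
  shows "single (\<pi> g) \<alpha> \<in> defects"
proof -
  obtain \<beta> where \<beta>: "\<beta>\<^sup>2 = \<alpha>" using square_surj_char2[OF F] .
  \<comment> \<open>\<open>x\<close> is symmetric, so its norm is its square, and the coefficient of
    the defect is the square of \<open>\<beta>\<close>.\<close>
  define x where "x = single \<one> 1 + (single h \<beta> + single (g \<otimes> h) \<beta>)"
  have inv: "inv h = h" "inv (g \<otimes> h) = g \<otimes> h" using g h by (auto intro!: inv_equality)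
  have hg: "h \<otimes> (g \<otimes> h) = g \<otimes> c"
  proof -
    have "g \<otimes> (h \<otimes> (g \<otimes> h)) = \<one>" using g h by (simp add: m_assoc)
    then have "(h \<otimes> (g \<otimes> h)) \<otimes> g = \<one>" by (rule inv_comm) (use g h in auto)
    then have "inv g = h \<otimes> (g \<otimes> h)" by (rule inv_equality) (use g h in auto)
    then show ?thesis using square_c_inv[OF g] by simp
  qed
  have gh: "g \<otimes> h \<otimes> h = g" using g h by (simp add: m_assoc)
  have st: "star G x = x" using g h by (simp add: x_def star_add star_single inv)
  have "x \<diamondop> star G x = single \<one> 1 + (single g \<alpha> + single (g \<otimes> c) \<alpha>)"
    unfolding st using g h \<beta>
    by (simp add: x_def galg_distribs single_mult_single hg gh power2_eq_square
        ac_simps fun_add_self_char2[OF F] fun_add_cancel_char2[OF F] fun_two_eq_0_char2[OF F])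
  moreover have "x \<in> FG" using g h by (simp add: x_def)
  ultimately show ?thesis
    using A.single_closed[OF pi.hom_closed[OF g(1)]]
    unfolding defects_def lift_single[OF g(1), symmetric] by blast
qed

text \<open>As \<open>inv p\<close> has square \<open>inv g = g c\<close>, the square of
  \<open>p + inv p\<close> is \<open>g + g c\<close>; the mixed products are both 1 and
  cancel.\<close>

lemma single_defect_square:
  fixes \<alpha> :: "'f::{field,finite}"
  assumes F: "CHAR('f) = 2"
    and p: "p \<in> carrier G" "p \<otimes> p = g" and g: "g \<otimes> g = c"
  shows "single (\<pi> g) \<alpha> \<in> defects"
proof -
  obtain \<beta> where \<beta>: "\<beta>\<^sup>2 = \<alpha>" using square_surj_char2[OF F] .
  define x where "x = single \<one> 1 + (single p \<beta> + single (inv p) \<beta>)"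
  have g': "g \<in> carrier G" using p by auto
  have pp: "inv p \<otimes> inv p = g \<otimes> c"
    using p square_c_inv[OF g' g] inv_mult_group[of p p] by simp
  have st: "star G x = x" using p by (simp add: x_def star_add star_single add.commute)
  have "x \<diamondop> star G x = single \<one> 1 + (single g \<alpha> + single (g \<otimes> c) \<alpha>)"
    unfolding st using p \<beta>
    by (simp add: x_def galg_distribs single_mult_single pp power2_eq_square
        ac_simps fun_add_self_char2[OF F] fun_add_cancel_char2[OF F] fun_two_eq_0_char2[OF F])
  moreover have "x \<in> FG" using p by (simp add: x_def)
  ultimately show ?thesis
    using A.single_closed[OF pi.hom_closed[OF g']]
    unfolding defects_def lift_single[OF g', symmetric] by blast
qed

text \<open>With \<open>y = \<alpha> (g + g s)\<close> one has \<open>star G y = y c\<close> and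
  \<open>y y = 0\<close>, so the norm of \<open>1 + y\<close> is \<open>1 + (1 + c) y\<close>. This
  defect is linear in \<open>\<alpha>\<close>, in contrast to the two above.\<close>

lemma single_defect_pair:
  fixes \<alpha> :: "'f::{field,finite}"
  assumes F: "CHAR('f) = 2"
    and g: "g \<in> carrier G" "g \<otimes> g = c" and s: "s \<in> carrier G" "s \<otimes> s = \<one>" "g \<otimes> s = s \<otimes> g"
  shows "single (\<pi> g) \<alpha> + single (\<pi> (g \<otimes> s)) \<alpha> \<in> defects"
proof -
  define x where "x = single \<one> 1 + (single g \<alpha> + single (g \<otimes> s) \<alpha>)"
  have inv: "inv s = s" using s by (auto intro!: inv_equality)
  have sc: "s \<otimes> c = c \<otimes> s" using s c_central by simp
  have igs: "inv (g \<otimes> s) = g \<otimes> s \<otimes> c"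
  proof -
    have "inv (g \<otimes> s) = s \<otimes> (g \<otimes> c)" by (simp only: inv_mult_group[OF g(1) s(1)] inv square_c_inv[OF g])
    also have "\<dots> = (s \<otimes> g) \<otimes> c" using g s by (simp only: m_assoc c_closed)
    also have "\<dots> = g \<otimes> s \<otimes> c" by (simp only: s(3))
    finally show ?thesis .
  qed
  have 1: "g \<otimes> (g \<otimes> c) = \<one>" using g by (simp add: m_assoc[symmetric])
  have 2: "g \<otimes> (g \<otimes> s \<otimes> c) = s"
  proof -
    have "g \<otimes> (g \<otimes> s \<otimes> c) = (g \<otimes> g) \<otimes> (s \<otimes> c)" using g(1) s(1) by (simp add: m_assoc)
    also have "\<dots> = c \<otimes> c \<otimes> s" using s(1) by (simp only: g(2) sc m_assoc c_closed)
    finally show ?thesis using s(1) by simp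
  qed
  have 3: "g \<otimes> s \<otimes> (g \<otimes> c) = s"
  proof -
    have "g \<otimes> s \<otimes> (g \<otimes> c) = s \<otimes> (g \<otimes> (g \<otimes> c))" using g(1) s(1) by (simp only: s(3) m_assoc c_closed m_closed)
    then show ?thesis using s(1) by (simp add: 1)
  qed
  have 4: "g \<otimes> s \<otimes> (g \<otimes> s \<otimes> c) = \<one>"
    unfolding igs[symmetric] using g(1) s(1) by simp
  have "x \<diamondop> star G x = single \<one> 1 + ((single g \<alpha> + single (g \<otimes> c) \<alpha>)
      + (single (g \<otimes> s) \<alpha> + single (g \<otimes> s \<otimes> c) \<alpha>))"
    using g(1) s(1)
    by (simp add: x_def star_add star_single galg_distribs single_mult_single igs
        square_c_inv[OF g] 1 2 3 4
        ac_simps fun_add_self_char2[OF F] fun_add_cancel_char2[OF F] fun_two_eq_0_char2[OF F])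
  also have "\<dots> = single \<one> 1 + lift (single (\<pi> g) \<alpha> + single (\<pi> (g \<otimes> s)) \<alpha>)"
    using g s by (simp only: lift_add lift_single m_closed)
  finally have "x \<diamondop> star G x = single \<one> 1 + lift (single (\<pi> g) \<alpha> + single (\<pi> (g \<otimes> s)) \<alpha>)" .
  moreover have "x \<in> FG" using g s by (simp add: x_def)
  ultimately show ?thesis
    using A.single_closed[OF pi.hom_closed[OF g(1)]] A.single_closed[OF pi.hom_closed, of "g \<otimes> s"]
      g s unfolding defects_def by blast
qed

text \<open>Each fibre of \<open>push\<close> is a coset of the image of \<open>lift\<close>, a copy
  of FA.\<close>

lemma card_cover_unitaries:
  assumes F: "CHAR('f::{field,finite}) = 2"
  shows "card (cover_unitaries :: ('a \<Rightarrow> 'f) set)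
    = CARD('f) ^ order A * card (unitaries A :: ('c \<Rightarrow> 'f) set)"
proof (rule card_fibres[where f = push])
  show "finite (cover_unitaries :: ('a \<Rightarrow> 'f) set)"
    using finite_galg finite_subset unfolding cover_unitaries_def by fastforce
  show "finite (unitaries A :: ('c \<Rightarrow> 'f) set)"
    using A.finite_galg finite_subset unfolding unitaries_def by fastforce
  fix u :: "'c \<Rightarrow> 'f" assume u: "u \<in> unitaries A"
  then obtain x where x: "x \<in> FG" "push x = u"
    using push_onto[of u] by (auto simp: unitaries_def)
  have "{y \<in> cover_unitaries. push y = u} = (\<lambda>f. x + lift f) ` A.FG"
  proof (intro equalityI subsetI)
    fix y assume "y \<in> {y \<in> cover_unitaries. push y = u}"
    then have y: "y \<in> FG" "push y = u" by (auto simp: cover_unitaries_def)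
    have "push (x + y) = 0" using x y by (simp add: push_add fun_add_self_char2[OF F])
    then obtain f where "f \<in> A.FG" "x + y = lift f"
      using push_eq_0[OF F, of "x + y"] x y by auto
    then show "y \<in> (\<lambda>f. x + lift f) ` A.FG"
      using fun_add_cancel_char2[OF F, of x y] by (intro image_eqI[where x = f]) auto
  qed (use x u in \<open>auto simp: cover_unitaries_def push_add push_lift[OF F]\<close>)
  moreover have "inj_on (\<lambda>f :: 'c \<Rightarrow> 'f. x + lift f) A.FG"
    using lift_inj by (auto simp: inj_on_def)
  ultimately show "card {y \<in> cover_unitaries. push y = u} = CARD('f) ^ order A"
    by (simp add: card_image A.card_galg)
qed (auto simp: cover_unitaries_def)

text \<open>Right multiplication by a unitary element keeps the norm, and two elements with the same
  invertible norm differ by such a factor. So a nonempty fibre is one coset of the unitary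
  group.\<close>

lemma card_norm_fibre:
  fixes w :: "'c \<Rightarrow> 'f::{field,finite}"
  assumes F: "CHAR('f) = 2" and w: "w \<in> defects"
  shows "card {x \<in> cover_unitaries. x \<diamondop> star G x = single \<one> 1 + lift w}
    = card (unitaries G :: ('a \<Rightarrow> 'f) set)"
proof -
  obtain x where x: "x \<in> FG" "x \<diamondop> star G x = single \<one> 1 + lift w" and wA: "w \<in> A.FG"
    using w by (auto simp: defects_def)
  let ?N = "single \<one> 1 + lift w"
  \<comment> \<open>The inverse of \<open>x\<close>: its norm \<open>?N\<close> has square 1 because
    \<open>lift w\<close> squares to zero.\<close>
  define y where "y = star G x \<diamondop> ?N"
  have "?N \<diamondop> ?N = single \<one> 1"
    using wA by (simp add: galg_distribs mult_lift push_lift[OF F] lift_zero push_add push_one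
        add.assoc fun_add_self_char2[OF F] fun_two_eq_0_char2[OF F])
  then have xy: "x \<diamondop> y = single \<one> 1"
    by (simp add: y_def galg_assoc[symmetric] x)
  have y: "y \<in> FG" by (simp add: y_def)
  have yx: "y \<diamondop> x = single \<one> 1" by (rule galg_right_inverse_left[OF x(1) y xy])
  have y_x: "y \<diamondop> (x \<diamondop> z) = z" "x \<diamondop> (y \<diamondop> z) = z" if "z \<in> FG" for z
    using that by (simp_all add: galg_assoc[symmetric] xy yx)
  have "{z \<in> cover_unitaries. z \<diamondop> star G z = ?N} = (\<lambda>z. x \<diamondop> z) ` unitaries G"
  proof (intro equalityI subsetI)
    fix z assume z: "z \<in> {z \<in> cover_unitaries. z \<diamondop> star G z = ?N}"
    then have zG: "z \<in> FG" and zN: "z \<diamondop> star G z = x \<diamondop> star G x"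
      by (auto simp: cover_unitaries_def x)
    have "(y \<diamondop> z) \<diamondop> star G (y \<diamondop> z) = y \<diamondop> (z \<diamondop> star G z) \<diamondop> star G y"
      by (simp add: star_mult galg_assoc)
    also have "\<dots> = y \<diamondop> x \<diamondop> star G (y \<diamondop> x)"
      by (simp only: zN star_mult galg_assoc)
    also have "\<dots> = single \<one> 1" by (simp add: yx)
    finally have "y \<diamondop> z \<in> unitaries G" by (simp add: unitaries_def)
    then show "z \<in> (\<lambda>z. x \<diamondop> z) ` unitaries G"
      using y_x(2)[OF zG] by (metis imageI)
  next
    fix z assume "z \<in> (\<lambda>z. x \<diamondop> z) ` unitaries G"
    then obtain v where v: "v \<in> unitaries G" "z = x \<diamondop> v" by auto
    have "z \<diamondop> star G z = x \<diamondop> (v \<diamondop> star G v) \<diamondop> star G x"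
      by (simp add: v(2) star_mult galg_assoc)
    also have "\<dots> = ?N" using v(1) x by (simp add: unitaries_def)
    finally have "z \<diamondop> star G z = ?N" .
    moreover from this have "z \<in> cover_unitaries"
      by (intro defect_cover[OF F]) (auto simp: v(2))
    ultimately show "z \<in> {z \<in> cover_unitaries. z \<diamondop> star G z = ?N}" by simp
  qed
  moreover have "inj_on (\<lambda>z. x \<diamondop> z) (unitaries G)"
    by (rule inj_on_inverseI[where g = "\<lambda>z. y \<diamondop> z"]) (auto simp: y_x unitaries_def)
  ultimately show ?thesis by (simp add: card_image)
qed

end

section \<open>Admissible defects and the passage from A to G\<close>

context double_cover
begin

text \<open>The necessary conditions on a defect, see \<open>defects_allowed\<close>. The count
  succeeds once they are also sufficient.\<close>

definition allowed :: "('c \<Rightarrow> 'f::field) set" where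
  "allowed = {w. (\<forall>a. a \<notin> carrier A \<longrightarrow> w a = 0) \<and> (\<forall>a\<in>carrier A. w (inv\<^bsub>A\<^esub> a) = w a) \<and>
     (\<forall>a\<in>{a \<in> carrier A. inv\<^bsub>A\<^esub> a = a} - c_roots. w a = 0)}"

definition selfinverse :: "'c set" where
  "selfinverse = {a \<in> carrier A. inv\<^bsub>A\<^esub> a = a}"

lemma selfinverse_iff: "a \<in> carrier A \<Longrightarrow> inv\<^bsub>A\<^esub> a = a \<longleftrightarrow> a \<otimes>\<^bsub>A\<^esub> a = \<one>\<^bsub>A\<^esub>"
proof
  assume a: "a \<in> carrier A" and eq: "inv\<^bsub>A\<^esub> a = a"
  show "a \<otimes>\<^bsub>A\<^esub> a = \<one>\<^bsub>A\<^esub>" using A.r_inv[OF a] unfolding eq .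
qed (rule A.inv_equality)

lemma Omega1_A: "Omega1 A = selfinverse"
  unfolding A.Omega1_eq selfinverse_def using selfinverse_iff by auto

lemma c_roots_selfinverse: "c_roots \<subseteq> selfinverse"
proof
  fix a assume "a \<in> c_roots"
  then obtain g where g: "g \<in> carrier G" "g \<otimes> g = c" "a = \<pi> g" by (auto simp: c_roots_def)
  then have "\<pi> g \<otimes>\<^bsub>A\<^esub> \<pi> g = \<one>\<^bsub>A\<^esub>" by (metis pi.hom_mult pi_c)
  then show "a \<in> selfinverse" using g selfinverse_iff[of a] by (simp add: selfinverse_def)
qed

lemma pi_selfinverse:
  assumes "g \<in> carrier G"
  shows "\<pi> g \<in> selfinverse \<longleftrightarrow> g \<otimes> g = \<one> \<or> g \<otimes> g = c"
proof -
  have "\<pi> g \<in> selfinverse \<longleftrightarrow> \<pi> (g \<otimes> g) = \<one>\<^bsub>A\<^esub>"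
    using assms selfinverse_iff[of "\<pi> g"] by (simp add: selfinverse_def)
  also have "\<dots> \<longleftrightarrow> g \<otimes> g = \<one> \<or> g \<otimes> g = c" using assms by (intro pi_ker) auto
  finally show ?thesis .
qed

lemma square_mult_c: "g \<in> carrier G \<Longrightarrow> (g \<otimes> c) \<otimes> (g \<otimes> c) = g \<otimes> g"
proof -
  assume g: "g \<in> carrier G"
  have "(g \<otimes> c) \<otimes> (g \<otimes> c) = g \<otimes> (c \<otimes> g) \<otimes> c" using g by (simp add: m_assoc)
  also have "\<dots> = g \<otimes> (g \<otimes> c) \<otimes> c" by (simp only: c_central[OF g])
  finally show ?thesis using g by (simp add: m_assoc)
qed

lemma pi_c_roots: "g \<in> carrier G \<Longrightarrow> \<pi> g \<in> c_roots \<longleftrightarrow> g \<otimes> g = c"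
  using pi_eq_iff square_mult_c by (auto simp: c_roots_def)

text \<open>Norms are symmetric, which gives the symmetry of \<open>w\<close>, and they vanish at
  involutions by \<open>norm_involution\<close>.\<close>

lemma defects_allowed:
  assumes F: "CHAR('f) = 2" and w: "(w :: 'c \<Rightarrow> 'f::field) \<in> defects"
  shows "w \<in> allowed"
proof -
  obtain x where x: "x \<in> FG" "x \<diamondop> star G x = single \<one> 1 + lift w" and wA: "w \<in> A.FG"
    using w by (auto simp: defects_def)
  have "lift (star A w) = lift w"
    using norm_star[OF x(1)] unfolding x(2) by (simp add: star_add lift_star)
  then have sw: "star A w = w" using lift_inj wA by (auto dest: inj_onD)
  have "w (inv\<^bsub>A\<^esub> a) = w a" if "a \<in> carrier A" for a
    using A.star_apply[OF that, of w] sw by simp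
  moreover have "w a = 0" if a: "a \<in> selfinverse" "a \<notin> c_roots" for a
  proof -
    obtain g where g: "g \<in> carrier G" "a = \<pi> g" using a pi_surjE by (auto simp: selfinverse_def)
    have w0: "w a = 0" if h: "h \<in> carrier G" "a = \<pi> h" "h \<noteq> \<one>" for h
    proof -
      have "h \<otimes> h = \<one>" using a h pi_selfinverse pi_c_roots by auto
      then have "(single \<one> 1 + lift w) h = 0"
        using norm_involution[OF F h(1) _ h(3)] x(2) by metis
      then show ?thesis using h by (simp add: single_def lift_apply)
    qed
    \<comment> \<open>Over the identity class \<open>norm_involution\<close> does not apply to
      \<open>\<one>\<close>; the other element \<open>c\<close> of that fibre takes its
      place.\<close>
    show ?thesis using w0[of g] w0[of "g \<otimes> c"] g c_ne by (cases "g = \<one>") auto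
  qed
  ultimately show ?thesis
    using wA by (auto simp: allowed_def mem_group_algebra_iff selfinverse_def)
qed

text \<open>One free value per pair of distinct mutually inverse classes and one per class in
  \<open>c_roots\<close>.\<close>

lemma card_allowed:
  "card (allowed :: ('c \<Rightarrow> 'f::{field,finite}) set)
    = CARD('f) ^ ((order A - card selfinverse) div 2 + card c_roots)"
proof -
  have "selfinverse - (selfinverse - c_roots) = c_roots" using c_roots_selfinverse by auto
  moreover have fin': "finite selfinverse" using A.fin by (simp add: selfinverse_def)
  then have "card (selfinverse - (selfinverse - c_roots)) = card selfinverse - card (selfinverse - c_roots)"
    by (intro card_Diff_subset) auto
  ultimately have "card selfinverse - card (selfinverse - c_roots) = card c_roots" by simp
  moreover have "card (allowed :: ('c \<Rightarrow> 'f) set)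
    = CARD('f) ^ ((card (carrier A) - card selfinverse) div 2 + (card selfinverse - card (selfinverse - c_roots)))"
    unfolding allowed_def selfinverse_def
    by (rule card_invariant_functions) (use A.fin in auto)
  ultimately show ?thesis by (simp add: order_def)
qed

text \<open>Choosing one class from each pair of mutually inverse ones splits \<open>w\<close> into
  a function \<open>z + star A z\<close> and a rest supported on \<open>c_roots\<close>, which is a
  sum of concentrated defects.\<close>

lemma allowed_defects:
  fixes w :: "'c \<Rightarrow> 'f::field"
  assumes F: "CHAR('f) = 2"
    and single: "\<And>a \<alpha>. a \<in> c_roots \<Longrightarrow> single a \<alpha> \<in> (defects :: ('c \<Rightarrow> 'f) set)"
    and w: "w \<in> allowed"
  shows "w \<in> defects"
proof -
  obtain R where R: "R \<subseteq> carrier A" "R \<inter> m_inv A ` R = {}"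
    "R \<union> m_inv A ` R = {a \<in> carrier A. inv\<^bsub>A\<^esub> a \<noteq> a}"
    by (rule involution_transversal[OF A.fin, of "m_inv A"]) auto
  define z where "z = (\<lambda>a. if a \<in> R then w a else 0)"
  define v where "v = (\<lambda>a. if a \<in> c_roots then w a else 0)"
  have zA: "z \<in> A.FG" using R(1) by (auto simp: z_def mem_group_algebra_iff)
  have wv: "w = v + (z + star A z)"
  proof
    fix a
    show "w a = (v + (z + star A z)) a"
    proof (cases "a \<in> carrier A")
      case False
      then show ?thesis using w R(1) c_roots_closed
        by (auto simp: allowed_def v_def z_def star_def)
    next
      case True
      have inv: "a \<in> m_inv A ` R \<longleftrightarrow> inv\<^bsub>A\<^esub> a \<in> R" using True R(1) by force
      have wi: "w (inv\<^bsub>A\<^esub> a) = w a" using w True by (auto simp: allowed_def)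
      consider "a \<in> R" "inv\<^bsub>A\<^esub> a \<notin> R" "a \<notin> selfinverse" | "inv\<^bsub>A\<^esub> a \<in> R" "a \<notin> R" "a \<notin> selfinverse"
        | "a \<in> selfinverse" "a \<notin> R" "inv\<^bsub>A\<^esub> a \<notin> R"
      proof -
        have "\<not> (a \<in> R \<and> inv\<^bsub>A\<^esub> a \<in> R)" using R(2) inv by blast
        moreover have "a \<in> R \<union> m_inv A ` R \<longleftrightarrow> a \<notin> selfinverse"
          unfolding R(3) using True by (simp add: selfinverse_def)
        ultimately show thesis using that inv by blast
      qed
      then show ?thesis
      proof cases
        case 3
        then show ?thesis using w True
          by (auto simp: allowed_def v_def z_def A.star_apply selfinverse_def)
      qed (use True wi c_roots_selfinverse in \<open>auto simp: v_def z_def A.star_apply\<close>)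
    qed
  qed
  have "v \<in> defects"
  proof -
    have "finite S \<Longrightarrow> S \<subseteq> c_roots \<Longrightarrow> (\<lambda>a. if a \<in> S then w a else 0) \<in> defects" for S
    proof (induction S rule: finite_induct)
      case empty
      have "(0 :: 'c \<Rightarrow> 'f) + star A 0 \<in> defects"
        by (rule defects_trace[OF F]) (simp add: mem_group_algebra_iff)
      moreover have "(0 :: 'c \<Rightarrow> 'f) + star A 0 = (\<lambda>a. if a \<in> {} then w a else 0)"
        by (auto simp: star_def)
      ultimately show ?case by simp
    next
      case (insert b S)
      have "(\<lambda>a. if a \<in> insert b S then w a else 0)
          = single b (w b) + (\<lambda>a. if a \<in> S then w a else 0)"
        using insert.hyps by (auto simp: single_def)
      then show ?case using insert single[of b "w b"] by (simp add: defects_add[OF F])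
    qed
    moreover have "finite c_roots" using c_roots_closed A.fin finite_subset by blast
    ultimately show ?thesis by (simp add: v_def)
  qed
  then show ?thesis unfolding wv by (rule defects_add[OF F _ defects_trace[OF F zA]])
qed

text \<open>Elements over self-inverse classes have square 1 or \<open>c\<close>: the former make up
  \<open>Omega1 G\<close>, the latter fill the fibres over \<open>c_roots\<close>.\<close>

lemma card_Omega1: "2 * card selfinverse = card (Omega1 G) + 2 * card c_roots"
proof -
  have "{g \<in> carrier G. \<pi> g \<in> selfinverse} = Omega1 G \<union> {g \<in> carrier G. \<pi> g \<in> c_roots}"
    using pi_selfinverse pi_c_roots by (auto simp: Omega1_eq)
  moreover have "Omega1 G \<inter> {g \<in> carrier G. \<pi> g \<in> c_roots} = {}"
    using pi_c_roots c_ne by (auto simp: Omega1_eq)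
  moreover have "finite (Omega1 G)" "finite {g \<in> carrier G. \<pi> g \<in> c_roots}"
    using fin by (auto simp: Omega1_eq)
  ultimately have "card {g \<in> carrier G. \<pi> g \<in> selfinverse}
      = card (Omega1 G) + card {g \<in> carrier G. \<pi> g \<in> c_roots}"
    by (simp add: card_Un_disjoint)
  moreover have "selfinverse \<subseteq> carrier A" by (auto simp: selfinverse_def)
  ultimately show ?thesis using card_preimage[of selfinverse] card_preimage[of c_roots] c_roots_closed by simp
qed

lemma order_double: "order G = 2 * order A"
proof -
  have "{g \<in> carrier G. \<pi> g \<in> carrier A} = carrier G" by auto
  then show ?thesis using card_preimage[of "carrier A"] by (simp add: order_def)
qed

text \<open>The elements over unitary elements of FA are counted twice, along \<open>push\<close>
  and along the norm. The hypothesis \<open>lifts\<close> makes every admissible function a defect,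
  so the norm takes all admissible values equally often; dividing leaves the factor
  \<open>\<theta>\<close>.\<close>

lemma card_unitaries_cover:
  fixes \<theta> :: nat
  assumes F: "CHAR('f::{field,finite}) = 2"
    and lifts: "\<And>g. g \<in> carrier G \<Longrightarrow> g \<otimes> g = c \<Longrightarrow>
      (\<exists>h\<in>carrier G. h \<otimes> h = \<one> \<and> (g \<otimes> h) \<otimes> (g \<otimes> h) = \<one>) \<or>
      (\<exists>s\<in>carrier G. \<exists>p\<in>carrier G. s \<otimes> s = \<one> \<and> g \<otimes> s = s \<otimes> g \<and> g \<otimes> s = p \<otimes> p)"
    and card_A: "card (unitaries A :: ('c \<Rightarrow> 'f) set) = \<theta> * CARD('f) ^ unitary_exponent A"
  shows "card (unitaries G :: ('a \<Rightarrow> 'f) set) = \<theta> * CARD('f) ^ unitary_exponent G"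
proof -
  have single: "single a \<alpha> \<in> defects" if a: "a \<in> c_roots" for a and \<alpha> :: 'f
  proof -
    obtain g where g: "g \<in> carrier G" "g \<otimes> g = c" "a = \<pi> g" using a by (auto simp: c_roots_def)
    from lifts[OF g(1,2)] show ?thesis
    proof (elim disjE bexE conjE)
      fix h assume "h \<in> carrier G" "h \<otimes> h = \<one>" "g \<otimes> h \<otimes> (g \<otimes> h) = \<one>"
      then show ?thesis unfolding g(3) by (intro single_defect_inverted[OF F g(1,2)])
    next
      fix s p assume s: "s \<in> carrier G" "p \<in> carrier G" "s \<otimes> s = \<one>" "g \<otimes> s = s \<otimes> g" "g \<otimes> s = p \<otimes> p"
      have "(g \<otimes> s) \<otimes> (g \<otimes> s) = g \<otimes> (s \<otimes> g) \<otimes> s" using g(1) s(1) by (simp add: m_assoc)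
      also have "\<dots> = (g \<otimes> g) \<otimes> (s \<otimes> s)" unfolding s(4)[symmetric] using g(1) s(1) by (simp add: m_assoc)
      finally have sq: "(g \<otimes> s) \<otimes> (g \<otimes> s) = c" using g(2) s(3) by simp
      \<comment> \<open>The defect is first placed at \<open>g \<otimes> s\<close>, which is the
        square of \<open>p\<close>, and then moved to \<open>g\<close> by adding the pair.\<close>
      have 1: "single (\<pi> (g \<otimes> s)) \<alpha> \<in> defects"
        by (rule single_defect_square[OF F s(2) s(5)[symmetric] sq])
      have "single (\<pi> (g \<otimes> s)) \<alpha> + (single (\<pi> g) \<alpha> + single (\<pi> (g \<otimes> s)) \<alpha>) \<in> defects"
        by (rule defects_add[OF F 1 single_defect_pair[OF F g(1,2) s(1,3,4)]])
      then show ?thesis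
        unfolding g(3) add.commute[of "single (\<pi> g) \<alpha>"] fun_add_cancel_char2[OF F] .
    qed
  qed
  define N where "N = (\<lambda>x :: 'a \<Rightarrow> 'f. x \<diamondop> star G x)"
  define L where "L = (\<lambda>w :: 'c \<Rightarrow> 'f. single \<one> 1 + lift w)"
  have all: "(defects :: ('c \<Rightarrow> 'f) set) = allowed"
    using defects_allowed[OF F] allowed_defects[OF F single] by blast
  have inj: "inj_on L allowed"
    using lift_inj unfolding L_def all[symmetric] by (auto simp: inj_on_def defects_def)
  have pos: "CARD('f) > 0" by simp
  have "card (cover_unitaries :: ('a \<Rightarrow> 'f) set)
      = card (unitaries G :: ('a \<Rightarrow> 'f) set) * card (L ` allowed)"
  proof (rule card_fibres[where f = N])
    show "finite (cover_unitaries :: ('a \<Rightarrow> 'f) set)"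
      using finite_galg finite_subset unfolding cover_unitaries_def by fastforce
    show "finite (L ` allowed)"
      by (rule finite_imageI, rule card_ge_0_finite)
        (simp only: card_allowed zero_less_power zero_less_card_finite)
    show "N ` cover_unitaries \<subseteq> L ` allowed"
    proof (rule image_subsetI)
      fix x :: "'a \<Rightarrow> 'f" assume x: "x \<in> cover_unitaries"
      obtain w where w: "w \<in> A.FG" "N x = L w" using cover_defect[OF F x] unfolding N_def L_def .
      then have "w \<in> defects" using x unfolding defects_def N_def L_def cover_unitaries_def by blast
      then show "N x \<in> L ` allowed" using w(2) all by blast
    qed
    show "card {x \<in> cover_unitaries. N x = y} = card (unitaries G :: ('a \<Rightarrow> 'f) set)"
      if "y \<in> L ` allowed" for y
      using that card_norm_fibre[OF F] unfolding all N_def L_def by auto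
  qed
  then have eq: "CARD('f) ^ order A * (\<theta> * CARD('f) ^ unitary_exponent A)
      = card (unitaries G :: ('a \<Rightarrow> 'f) set) * CARD('f) ^ ((order A - card selfinverse) div 2 + card c_roots)"
    unfolding card_image[OF inj] card_allowed card_cover_unitaries[OF F] card_A .
  obtain R where "R \<union> m_inv A ` R = {a \<in> carrier A. inv\<^bsub>A\<^esub> a \<noteq> a}"
    "card (R \<union> m_inv A ` R) = 2 * card R"
    by (rule involution_transversal[OF A.fin, of "m_inv A"]) auto
  moreover have "{a \<in> carrier A. inv\<^bsub>A\<^esub> a \<noteq> a} = carrier A - selfinverse" by (auto simp: selfinverse_def)
  moreover have "card (carrier A - selfinverse) = card (carrier A) - card selfinverse"
    and le: "card selfinverse \<le> order A"
    using A.fin by (auto simp: selfinverse_def order_def intro!: card_Diff_subset card_mono)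
  \<comment> \<open>With \<open>d\<close> pairs of mutually inverse classes all exponents become
    linear in \<open>d\<close>, \<open>card selfinverse\<close> and
    \<open>card c_roots\<close>.\<close>
  ultimately obtain d where d: "order A = 2 * d + card selfinverse"
    by (metis add.commute le_add_diff_inverse2 order_def)
  have "\<one>\<^bsub>A\<^esub> \<in> selfinverse" "\<one>\<^bsub>A\<^esub> \<notin> c_roots"
    using pi_c_roots[of \<one>] c_ne by (auto simp: selfinverse_def)
  then have "c_roots \<subset> selfinverse" using c_roots_selfinverse by auto
  \<comment> \<open>Strict because the identity class lies outside \<open>c_roots\<close>; this
    keeps the truncated subtractions below exact.\<close>
  then have t: "card c_roots < card selfinverse"
    using A.fin by (intro psubset_card_mono) (auto simp: selfinverse_def)
  have eA: "unitary_exponent A = d + card selfinverse - 1"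
    by (simp add: unitary_exponent_def Omega1_A d)
  have "order G + card (Omega1 G) = 2 * (2 * d + 2 * card selfinverse - card c_roots)"
    using card_Omega1 t by (simp add: order_double d)
  then have eG: "unitary_exponent G = 2 * d + 2 * card selfinverse - card c_roots - 1"
    by (simp add: unitary_exponent_def)
  have "order A + unitary_exponent A
      = unitary_exponent G + ((order A - card selfinverse) div 2 + card c_roots)"
    using t by (simp add: eA eG d)
  then have "CARD('f) ^ order A * (\<theta> * CARD('f) ^ unitary_exponent A)
      = \<theta> * CARD('f) ^ unitary_exponent G * CARD('f) ^ ((order A - card selfinverse) div 2 + card c_roots)"
    by (metis mult.assoc mult.left_commute power_add)
  then show ?thesis using eq pos by simp
qed

end

subsection \<open>Abelian groups of exponent four\<close>

definition group_squares :: "('a, 'b) monoid_scheme \<Rightarrow> 'a set" where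
  "group_squares G = (\<lambda>g. g \<otimes>\<^bsub>G\<^esub> g) ` carrier G"

text \<open>Adding two of the quadratic equations gives products such as
  \<open>(a + d) * (b + c)\<close>; as they vanish, at least three of the four values coincide. For
  values \<open>x, x, x, y\<close> this leaves \<open>x + y = 1\<close> and
  \<open>x * (x + y) = 0\<close>.\<close>

lemma char2_four_cases:
  fixes a b c d :: "'f::field"
  assumes F: "CHAR('f) = 2"
    and s: "a + b + c + d = 1" and e: "a * b + c * d = 0" "a * c + b * d = 0" "a * d + b * c = 0"
  shows "(a, b, c, d) \<in> {(1, 0, 0, 0), (0, 1, 0, 0), (0, 0, 1, 0), (0, 0, 0, 1)}"
proof -
  have "(a + d) * (b + c) = (a * b + c * d) + (a * c + b * d)"
    "(a + c) * (b + d) = (a * b + c * d) + (a * d + b * c)"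
    "(a + b) * (c + d) = (a * c + b * d) + (a * d + b * c)" by (simp_all add: algebra_simps)
  then have or: "a = d \<or> b = c" "a = c \<or> b = d" "a = b \<or> c = d"
    unfolding e by (simp_all add: char2_add_eq_0_iff[OF F])
  have three: "x = 0 \<and> y = 1" if "x + x + x + y = 1" "x * x + x * y = 0" for x y :: 'f
  proof -
    have xy: "x + y = 1" using that(1) by (simp only: char2_add_self[OF F] add_0_left)
    have "x * (x + y) = 0" using that(2) by (simp only: distrib_left)
    then show ?thesis using xy by simp
  qed
  have four: False if "x + x + x + x = (1 :: 'f)" for x
    using that by (simp only: char2_add_self[OF F] add_0_left) simp
  show ?thesis
  proof (cases "a = d")
    case ad: True
    show ?thesis
    proof (cases "a = c")
      case ac: True
      show ?thesis
      proof (cases "a = b")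
        case True
        then show ?thesis using s ad ac four[of a] by simp
      next
        case False
        then show ?thesis using s e ad ac three[of a b] by (simp add: add_ac mult_ac)
      qed
    next
      case False
      then have bd: "b = d" using or(2) by simp
      then show ?thesis using s e ad three[of a c] by (simp add: add_ac mult_ac)
    qed
  next
    case False
    then have bc: "b = c" using or(1) by simp
    show ?thesis
    proof (cases "a = c")
      case True
      then show ?thesis using s e bc three[of a d] by (simp add: add_ac mult_ac)
    next
      case False
      then have "b = d" using or(2) by simp
      then show ?thesis using s e bc three[of b a] by (simp add: add_ac mult_ac)
    qed
  qed
qed

section \<open>Half sums of the norm equations\<close>

context finite_group
begin

text \<open>Summed over all \<open>h\<close> in \<open>G\<close>, the equations for \<open>g\<close>
  and \<open>inv g\<close> coincide and add up to nothing in characteristic two. Restricting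
  \<open>h\<close> to a half \<open>M\<close> that translation by elements of \<open>S\<close>
  exchanges with its complement retains one equation for each pair \<open>g\<close>,
  \<open>inv g\<close>.\<close>

lemma half_sum:
  fixes x :: "'a \<Rightarrow> 'f::field"
  assumes S: "S \<subseteq> carrier G" "\<And>g. g \<in> S \<Longrightarrow> inv g \<in> S" "\<And>g. g \<in> S \<Longrightarrow> inv g \<noteq> g"
    and M: "M \<subseteq> carrier G" "\<And>g h. g \<in> S \<Longrightarrow> h \<in> carrier G \<Longrightarrow> g \<otimes> h \<in> M \<longleftrightarrow> h \<notin> M"
    and norm: "\<And>g. g \<in> S \<Longrightarrow> (x \<diamondop> star G x) g = 0"
  shows "(\<Sum>h\<in>M. x h * (\<Sum>g\<in>S. x (g \<otimes> h))) = 0"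
proof -
  have finS: "finite S" "finite M" using S(1) M(1) fin finite_subset by blast+
  have ii: "\<And>g. g \<in> S \<Longrightarrow> inv (inv g) = g" using S(1) by auto
  obtain R where R: "R \<subseteq> S" "R \<inter> m_inv G ` R = {}" "R \<union> m_inv G ` R = {g \<in> S. inv g \<noteq> g}"
    "card (R \<union> m_inv G ` R) = 2 * card R" "inj_on (m_inv G) R"
    by (rule involution_transversal[OF finS(1) S(2) ii])
  have SR: "S = R \<union> m_inv G ` R" unfolding R(3) using S(3) by auto
  have finR: "finite R" using R(1) finS finite_subset by blast
  have "(\<Sum>h\<in>M. x h * x (inv g \<otimes> h)) + (\<Sum>h\<in>M. x h * x (g \<otimes> h)) = 0" if g: "g \<in> R" for g
  proof -
    have gS: "g \<in> S" "inv g \<in> S" "g \<in> carrier G" using g R(1) S by auto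
    \<comment> \<open>The substitution \<open>h = g \<otimes> k\<close> carries the complement of
      \<open>M\<close> to \<open>M\<close>, so the norm at \<open>g\<close> is the sum of the half
      sums for \<open>g\<close> and \<open>inv g\<close>.\<close>
    have "(\<Sum>h\<in>carrier G - M. x h * x (inv g \<otimes> h)) = (\<Sum>k\<in>M. x k * x (g \<otimes> k))"
      by (rule sum.reindex_bij_witness[where i = "\<lambda>k. g \<otimes> k" and j = "\<lambda>h. inv g \<otimes> h"])
        (use gS M in \<open>auto simp: mult.commute\<close>)
    moreover have "(\<Sum>h\<in>carrier G. x h * x (inv g \<otimes> h))
        = (\<Sum>h\<in>carrier G - M. x h * x (inv g \<otimes> h)) + (\<Sum>h\<in>M. x h * x (inv g \<otimes> h))"
      by (rule sum.subset_diff[OF M(1) fin])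
    ultimately show ?thesis
      using norm[OF gS(1)] gS(3) by (simp add: norm_apply add.commute)
  qed
  then have "0 = (\<Sum>g\<in>R. (\<Sum>h\<in>M. x h * x (inv g \<otimes> h)) + (\<Sum>h\<in>M. x h * x (g \<otimes> h)))" by simp
  also have "\<dots> = (\<Sum>g\<in>m_inv G ` R. \<Sum>h\<in>M. x h * x (g \<otimes> h)) + (\<Sum>g\<in>R. \<Sum>h\<in>M. x h * x (g \<otimes> h))"
    by (simp add: sum.distrib sum.reindex[OF R(5)])
  also have "\<dots> = (\<Sum>g\<in>S. \<Sum>h\<in>M. x h * x (g \<otimes> h))"
    unfolding SR using finR R(2) by (subst sum.union_disjoint) (auto simp: add.commute)
  also have "\<dots> = (\<Sum>h\<in>M. x h * (\<Sum>g\<in>S. x (g \<otimes> h)))"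
    by (subst sum.swap) (simp add: sum_distrib_left)
  finally show ?thesis ..
qed

text \<open>In an abelian group the square roots of a square form a coset of
  \<open>Omega1 G\<close>, so these are the coset sums of \<open>x\<close>.\<close>

definition square_sum :: "('a \<Rightarrow> 'f::field) \<Rightarrow> 'a \<Rightarrow> 'f" where
  "square_sum x b = (\<Sum>h\<in>{h \<in> carrier G. h \<otimes> h = b}. x h)"

definition symmetric_units :: "('a \<Rightarrow> 'f::field) set" where
  "symmetric_units = {x \<in> FG. star G x = x \<and> (\<Sum>g\<in>carrier G. x g) = 1}"

end

locale abelian_exponent4 = finite_group +
  assumes comm: "g \<in> carrier G \<Longrightarrow> h \<in> carrier G \<Longrightarrow> g \<otimes> h = h \<otimes> g"
    and exp4: "g \<in> carrier G \<Longrightarrow> (g \<otimes> g) \<otimes> (g \<otimes> g) = \<one>"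
begin

lemma square_mult:
  assumes "g \<in> carrier G" "h \<in> carrier G"
  shows "(g \<otimes> h) \<otimes> (g \<otimes> h) = (g \<otimes> g) \<otimes> (h \<otimes> h)"
proof -
  have "(g \<otimes> h) \<otimes> (g \<otimes> h) = g \<otimes> (h \<otimes> g) \<otimes> h" using assms by (simp add: m_assoc)
  also have "\<dots> = g \<otimes> (g \<otimes> h) \<otimes> h" using assms comm by simp
  finally show ?thesis using assms by (simp add: m_assoc)
qed

lemma inv_inv_mult:
  assumes "g \<in> carrier G" "h \<in> carrier G"
  shows "inv (inv h \<otimes> g) = inv g \<otimes> h" "inv (inv h \<otimes> g) \<otimes> g = h" "inv h \<otimes> g = h \<longleftrightarrow> h \<otimes> h = g"
proof -
  show 1: "inv (inv h \<otimes> g) = inv g \<otimes> h" using assms by (simp add: inv_mult_group)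
  have "inv g \<otimes> h \<otimes> g = h \<otimes> inv g \<otimes> g" using assms comm[of "inv g" h] by simp
  then show "inv (inv h \<otimes> g) \<otimes> g = h" unfolding 1 using assms by (simp add: m_assoc)
  show "inv h \<otimes> g = h \<longleftrightarrow> h \<otimes> h = g" using assms by (metis inv_mult_cancel)
qed

text \<open>The substitution of \<open>inv h \<otimes> g\<close> for \<open>h\<close> pairs equal
  terms; its fixed points are the square roots of \<open>g\<close>.\<close>

lemma square_apply:
  fixes x :: "'a \<Rightarrow> 'f::field"
  assumes F: "CHAR('f) = 2" and g: "g \<in> carrier G"
  shows "(x \<diamondop> x) g = (square_sum x g)\<^sup>2"
proof -
  have "(x \<diamondop> x) g = (\<Sum>h\<in>{h \<in> carrier G. inv h \<otimes> g = h}. x h * x (inv h \<otimes> g))"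
    unfolding galg_mult_apply[OF g]
    by (rule sum_involution[OF F fin]) (use g in \<open>auto simp: inv_inv_mult(2) mult.commute\<close>)
  also have "{h \<in> carrier G. inv h \<otimes> g = h} = {h \<in> carrier G. h \<otimes> h = g}"
    using g inv_inv_mult(3) by auto
  also have "(\<Sum>h\<in>{h \<in> carrier G. h \<otimes> h = g}. x h * x (inv h \<otimes> g))
      = (\<Sum>h\<in>{h \<in> carrier G. h \<otimes> h = g}. (x h)\<^sup>2)"
    using g inv_inv_mult(3) by (intro sum.cong) (auto simp: power2_eq_square)
  finally show ?thesis by (simp add: square_sum_def sum_square_char2[OF F])
qed

text \<open>The norm of a symmetric element is its square. It vanishes at elements of order four,
  which are not squares in exponent four, and at involutions; at \<open>\<one>\<close> it is the
  squared coefficient sum.\<close>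

lemma symmetric_unit_unitary:
  fixes x :: "'a \<Rightarrow> 'f::field"
  assumes F: "CHAR('f) = 2" and x: "x \<in> symmetric_units"
  shows "x \<in> unitaries G" and "x \<diamondop> x = single \<one> 1"
proof -
  have sx: "star G x = x" "x \<in> FG" "(\<Sum>g\<in>carrier G. x g) = 1" using x by (auto simp: symmetric_units_def)
  have "(x \<diamondop> star G x) g = single \<one> 1 g" if g: "g \<in> carrier G" for g
  proof (cases "g \<otimes> g = \<one>")
    case True
    then show ?thesis
      using norm_involution[OF F g True, of x] norm_at_one[OF F, of x] sx(3)
      by (auto simp: single_def)
  next
    case False
    have empty: "{h \<in> carrier G. h \<otimes> h = g} = {}" using False exp4 by auto
    have "(x \<diamondop> x) g = 0" unfolding square_apply[OF F g] square_sum_def empty by simp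
    then show ?thesis using False by (auto simp: sx(1) single_def)
  qed
  then have "x \<diamondop> star G x = single \<one> 1" by (intro galg_eqI) auto
  then show "x \<in> unitaries G" "x \<diamondop> x = single \<one> 1" using sx by (auto simp: unitaries_def)
qed

text \<open>This is \<open>half_sum\<close> for the square roots of \<open>t\<close>, which are not
  self-inverse as \<open>t \<noteq> \<one>\<close>, and for the elements with square in
  \<open>M\<close>. For fixed \<open>h\<close>, multiplication by \<open>h\<close> turns the roots
  of \<open>t\<close> into the roots of \<open>t \<otimes> (h \<otimes> h)\<close>.\<close>

lemma square_sum_pairs:
  fixes x :: "'a \<Rightarrow> 'f::field"
  assumes x: "x \<in> unitaries G" and t: "t \<in> group_squares G" "t \<noteq> \<one>"
    and M: "M \<subseteq> group_squares G" "\<And>b. b \<in> group_squares G \<Longrightarrow> t \<otimes> b \<in> M \<longleftrightarrow> b \<notin> M"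
  shows "(\<Sum>b\<in>M. square_sum x b * square_sum x (t \<otimes> b)) = 0"
proof -
  define S where "S = {g \<in> carrier G. g \<otimes> g = t}"
  define N where "N = {h \<in> carrier G. h \<otimes> h \<in> M}"
  have tG: "t \<in> carrier G" "t \<otimes> t = \<one>" using t exp4 by (auto simp: group_squares_def)
  have inv_t: "inv t = t" using tG by (intro inv_equality) auto
  have "(\<Sum>h\<in>N. x h * (\<Sum>g\<in>S. x (g \<otimes> h))) = 0"
  proof (rule half_sum)
    fix g assume g: "g \<in> S"
    then have gG: "g \<in> carrier G" "g \<otimes> g = t" by (auto simp: S_def)
    have "inv g \<otimes> inv g = inv (g \<otimes> g)" using gG(1) by (simp add: inv_mult_group)
    then show "inv g \<in> S" using gG inv_t by (simp add: S_def)
    show "inv g \<noteq> g" using gG t(2) by (metis r_inv)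
    have "g \<noteq> \<one>" using gG t(2) by auto
    then show "(x \<diamondop> star G x) g = 0" using x by (simp add: unitaries_def single_def)
    fix h assume h: "h \<in> carrier G"
    then have "h \<otimes> h \<in> group_squares G" by (auto simp: group_squares_def)
    then show "g \<otimes> h \<in> N \<longleftrightarrow> h \<notin> N"
      using M(2)[of "h \<otimes> h"] h gG by (simp add: N_def square_mult)
  qed (auto simp: S_def N_def)
  moreover have "(\<Sum>g\<in>S. x (g \<otimes> h)) = square_sum x (t \<otimes> (h \<otimes> h))" if h: "h \<in> carrier G" for h
    unfolding square_sum_def
  proof (rule sum.reindex_bij_witness[where i = "\<lambda>k. k \<otimes> inv h" and j = "\<lambda>g. g \<otimes> h"])
    fix k assume k: "k \<in> {k \<in> carrier G. k \<otimes> k = t \<otimes> (h \<otimes> h)}"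
    have kk: "k \<in> carrier G" "k \<otimes> k = t \<otimes> (h \<otimes> h)" using k by auto
    have hh: "inv h \<otimes> inv h = inv (h \<otimes> h)" using h by (simp add: inv_mult_group)
    have "(k \<otimes> inv h) \<otimes> (k \<otimes> inv h) = (t \<otimes> (h \<otimes> h)) \<otimes> inv (h \<otimes> h)"
      unfolding square_mult[OF kk(1) inv_closed[OF h]] kk(2) hh ..
    then have "(k \<otimes> inv h) \<otimes> (k \<otimes> inv h) = t"
      using m_assoc[OF tG(1) m_closed[OF h h]] h tG(1) by simp
    then show "k \<otimes> inv h \<in> S" using k h by (simp add: S_def)
  qed (use h in \<open>auto simp: S_def square_mult mult_inv_cancel\<close>)
  ultimately have 0: "(\<Sum>h\<in>N. x h * square_sum x (t \<otimes> (h \<otimes> h))) = 0"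
    by (simp add: N_def)
  have "(\<Sum>b\<in>M. square_sum x b * square_sum x (t \<otimes> b))
      = (\<Sum>b\<in>M. \<Sum>h\<in>{h \<in> N. h \<otimes> h = b}. x h * square_sum x (t \<otimes> (h \<otimes> h)))"
  proof (rule sum.cong[OF refl])
    fix b assume "b \<in> M"
    then have "{h \<in> N. h \<otimes> h = b} = {h \<in> carrier G. h \<otimes> h = b}" by (auto simp: N_def)
    then show "square_sum x b * square_sum x (t \<otimes> b)
        = (\<Sum>h\<in>{h \<in> N. h \<otimes> h = b}. x h * square_sum x (t \<otimes> (h \<otimes> h)))"
      by (simp add: square_sum_def[of x b] sum_distrib_right)
  qed
  also have "\<dots> = (\<Sum>h\<in>N. x h * square_sum x (t \<otimes> (h \<otimes> h)))"
  proof (rule sum.group)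
    show "finite N" using fin by (simp add: N_def)
    have "finite (group_squares G)" using fin by (simp add: group_squares_def)
    then show "finite M" using M(1) finite_subset by blast
  qed (auto simp: N_def)
  finally show ?thesis using 0 by simp
qed

lemma sum_square_sum:
  fixes x :: "'a \<Rightarrow> 'f::field"
  shows "(\<Sum>b\<in>group_squares G. square_sum x b) = (\<Sum>h\<in>carrier G. x h)"
  unfolding square_sum_def by (rule sum.group) (use fin in \<open>auto simp: group_squares_def\<close>)

lemma group_squares_closed:
  assumes "s \<in> group_squares G" "t \<in> group_squares G"
  shows "s \<otimes> t \<in> group_squares G"
proof -
  obtain g h where g: "g \<in> carrier G" "s = g \<otimes> g" "h \<in> carrier G" "t = h \<otimes> h"
    using assms by (auto simp: group_squares_def)
  then have "s \<otimes> t = (g \<otimes> h) \<otimes> (g \<otimes> h)" by (simp add: square_mult)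
  then show ?thesis using g by (auto simp: group_squares_def)
qed

text \<open>The squares form an elementary abelian group of order 1, 2 or 4. The sums have total 1,
  and for each square \<open>t \<noteq> \<one>\<close> the products over pairs \<open>b\<close>,
  \<open>t \<otimes> b\<close> add up to zero; these equations leave one nonzero value.\<close>

lemma unitary_square_sum:
  fixes x :: "'a \<Rightarrow> 'f::field"
  assumes F: "CHAR('f) = 2" and x: "x \<in> unitaries G" and card: "card (group_squares G) \<le> 4"
  obtains b where "b \<in> group_squares G" "\<And>b'. b' \<in> group_squares G \<Longrightarrow> square_sum x b' = (if b' = b then 1 else 0)"
proof -
  let ?B = "group_squares G" and ?s = "square_sum x"
  have finB: "finite ?B" using fin by (simp add: group_squares_def)
  have one: "\<one> \<in> ?B" by (auto simp: group_squares_def intro!: image_eqI[where x = \<one>])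
  have sum1: "(\<Sum>b\<in>?B. ?s b) = 1" using sum_square_sum[of x] sum_unitary[OF F x] by simp
  have BG: "b \<in> carrier G" "b \<otimes> b = \<one>" if "b \<in> ?B" for b
    using that exp4 by (auto simp: group_squares_def)
  show thesis
  proof (cases "?B = {\<one>}")
    case True
    then show ?thesis using that[of \<one>] sum1 by auto
  next
    case False
    then obtain t where t: "t \<in> ?B" "t \<noteq> \<one>" using one by auto
    note tG = BG[OF t(1)]
    show ?thesis
    proof (cases "?B = {\<one>, t}")
      case True
      have "(\<Sum>b\<in>{\<one>}. ?s b * ?s (t \<otimes> b)) = 0"
        by (rule square_sum_pairs[OF x t]) (use True t tG in auto)
      then have "?s \<one> * ?s t = 0" using tG by simp
      moreover have "?s \<one> + ?s t = 1" using sum1 t unfolding True by simp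
      ultimately consider "?s \<one> = 1" "?s t = 0" | "?s \<one> = 0" "?s t = 1"
        by auto
      then show ?thesis
      proof cases
        case 1
        then show ?thesis by (intro that[of \<one>]) (use True t in auto)
      next
        case 2
        then show ?thesis by (intro that[of t]) (use True t in auto)
      qed
    next
      case False
      then obtain u where u: "u \<in> ?B" "u \<noteq> \<one>" "u \<noteq> t" using one t by auto
      note uG = BG[OF u(1)]
      define v where "v = t \<otimes> u"
      have vB: "v \<in> ?B" using group_squares_closed t u by (simp add: v_def)
      have tt: "t \<otimes> (t \<otimes> b) = b" "u \<otimes> (u \<otimes> b) = b" if "b \<in> carrier G" for b
        using that tG uG by (simp_all add: m_assoc[symmetric])
      have vne: "v \<noteq> \<one>" "v \<noteq> t" "v \<noteq> u"
      proof -
        show "v \<noteq> \<one>" using tt(1)[of u] tG uG u(3) by (auto simp: v_def)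
        show "v \<noteq> t" using tt(1)[of u] tG uG u(2) by (auto simp: v_def)
        show "v \<noteq> u" using tG uG t(2) by (auto simp: v_def)
      qed
      have ut: "u \<otimes> t = v" using comm tG uG by (simp add: v_def)
      have tv: "t \<otimes> v = u" using tt(1) uG by (simp add: v_def)
      have uv: "u \<otimes> v = t" using tt(2) tG by (simp add: ut[symmetric])
      have vt: "v \<otimes> t = u" "v \<otimes> u = t" "v \<otimes> v = \<one>"
        using comm BG[OF vB] tG uG tv uv by simp_all
      have sub: "{\<one>, t, u, v} \<subseteq> ?B" using one t u vB by auto
      have c4: "card {\<one>, t, u, v} = 4" using t u vne by simp
      then have B: "?B = {\<one>, t, u, v}"
        using card_seteq[OF finB sub] card by simp
      \<comment> \<open>\<open>{\<one>, u}\<close> has one element of each pair \<open>b\<close>,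
        \<open>t \<otimes> b\<close>; for \<open>u\<close> and \<open>v\<close> the set
        \<open>{\<one>, t}\<close> does the same.\<close>
      have "(\<Sum>b\<in>{\<one>, u}. ?s b * ?s (t \<otimes> b)) = 0"
        by (rule square_sum_pairs[OF x t]) (unfold B, use t u vne tG uG tv v_def in auto)
      then have e1: "?s \<one> * ?s t + ?s u * ?s v = 0" using u tG by (simp add: v_def)
      have "(\<Sum>b\<in>{\<one>, t}. ?s b * ?s (u \<otimes> b)) = 0"
        by (rule square_sum_pairs[OF x u(1,2)]) (unfold B, use t u vne tG uG uv ut in auto)
      then have e2: "?s \<one> * ?s u + ?s t * ?s v = 0" using t uG by (simp add: ut)
      have "(\<Sum>b\<in>{\<one>, t}. ?s b * ?s (v \<otimes> b)) = 0"
        by (rule square_sum_pairs[OF x vB vne(1)]) (unfold B, use t u vne BG[OF vB] vt in auto)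
      then have e3: "?s \<one> * ?s v + ?s t * ?s u = 0" using t BG[OF vB] by (simp add: vt)
      have "?s \<one> + ?s t + ?s u + ?s v = 1" using sum1 t u vne unfolding B by (simp add: add.assoc)
      from char2_four_cases[OF F this e1 e2 e3]
      have vals: "(?s \<one>, ?s t, ?s u, ?s v) \<in> {(1, 0, 0, 0), (0, 1, 0, 0), (0, 0, 1, 0), (0, 0, 0, 1)}" .
      have "\<exists>b\<in>{\<one>, t, u, v}. \<forall>b'\<in>{\<one>, t, u, v}. ?s b' = (if b' = b then 1 else 0)"
        using vals t(2) u(2,3) vne by auto
      then show ?thesis using that unfolding B by blast
    qed
  qed
qed

end

section \<open>Unitary elements as group elements times symmetric ones\<close>

context abelian_exponent4
begin

text \<open>Symmetric functions form a space of dimension \<open>unitary_exponent G + 1\<close>, and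
  all values of the coefficient sum occur equally often in it. Fixing the sum accounts for the
  \<open>- 1\<close> in the exponent.\<close>

lemma card_symmetric_units:
  assumes F: "CHAR('f::{field,finite}) = 2"
  shows "card (symmetric_units :: ('a \<Rightarrow> 'f) set) = CARD('f) ^ unitary_exponent G"
proof -
  let ?sym = "{x :: 'a \<Rightarrow> 'f. (\<forall>g. g \<notin> carrier G \<longrightarrow> x g = 0) \<and>
      (\<forall>g\<in>carrier G. x (inv g) = x g) \<and> (\<forall>g\<in>{}. x g = 0)}"
  have sym: "?sym = {x \<in> FG. star G x = x}"
    by (auto simp: mem_group_algebra_iff star_def fun_eq_iff)
  have fin_sym: "finite ?sym"
    unfolding sym using finite_galg[where 'f = 'f] by simp
  have fix_Omega: "{g \<in> carrier G. inv g = g} = Omega1 G"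
  proof -
    have "inv g = g \<longleftrightarrow> g \<otimes> g = \<one>" if "g \<in> carrier G" for g
    proof
      assume eq: "inv g = g"
      show "g \<otimes> g = \<one>" using r_inv[OF that] unfolding eq .
    qed (use that in \<open>simp add: inv_equality\<close>)
    then show ?thesis unfolding Omega1_eq by auto
  qed
  have "card ?sym = CARD('f) ^ ((card (carrier G) - card (Omega1 G)) div 2 + (card (Omega1 G) - card ({} :: 'a set)))"
    unfolding fix_Omega[symmetric] by (rule card_invariant_functions) (use fin in auto)
  moreover have "card ?sym = card (symmetric_units :: ('a \<Rightarrow> 'f) set) * card (UNIV :: 'f set)"
  proof (rule card_fibres[where f = "\<lambda>x. \<Sum>g\<in>carrier G. x g"])
    fix \<alpha> :: 'f
    \<comment> \<open>The multiple of \<open>\<one>\<close> that exchanges the coefficient sums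
      \<open>\<alpha>\<close> and 1.\<close>
    let ?e = "single \<one> (1 + \<alpha>) :: 'a \<Rightarrow> 'f"
    have sum_e: "(\<Sum>g\<in>carrier G. ?e g) = 1 + \<alpha>" using fin by (simp add: single_def)
    have "{x \<in> ?sym. (\<Sum>g\<in>carrier G. x g) = \<alpha>} = (\<lambda>x. ?e + x) ` symmetric_units"
    proof (intro equalityI subsetI)
      fix x assume x: "x \<in> {x \<in> ?sym. (\<Sum>g\<in>carrier G. x g) = \<alpha>}"
      have "(\<Sum>g\<in>carrier G. (?e + x) g) = (1 + \<alpha>) + \<alpha>"
        using x sum_e by (simp add: sum.distrib)
      also have "\<dots> = 1" by (simp only: add.assoc char2_add_self[OF F] add_0_right)
      finally have "?e + x \<in> symmetric_units"
        using x unfolding sym by (simp add: symmetric_units_def star_add)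
      then show "x \<in> (\<lambda>x. ?e + x) ` symmetric_units"
        using fun_add_cancel_char2[OF F, of ?e x] by (metis imageI)
    next
      fix x assume "x \<in> (\<lambda>x. ?e + x) ` symmetric_units"
      then obtain y where y: "y \<in> symmetric_units" "x = ?e + y" by auto
      have "(\<Sum>g\<in>carrier G. x g) = (1 + \<alpha>) + 1"
        using y sum_e by (simp add: sum.distrib symmetric_units_def)
      also have "\<dots> = \<alpha>" using char2_add_assoc_cancel[OF F, of 1 \<alpha>] by (simp only: add.commute)
      finally show "x \<in> {x \<in> ?sym. (\<Sum>g\<in>carrier G. x g) = \<alpha>}"
        using y unfolding sym by (simp add: symmetric_units_def star_add)
    qed
    then show "card {x \<in> ?sym. (\<Sum>g\<in>carrier G. x g) = \<alpha>} = card (symmetric_units :: ('a \<Rightarrow> 'f) set)"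
      by (simp add: card_image inj_on_def)
  qed (use fin_sym in auto)
  moreover have "card (Omega1 G) \<ge> 1"
  proof -
    have "\<one> \<in> Omega1 G" "finite (Omega1 G)" using fin by (auto simp: Omega1_eq)
    then have "card (Omega1 G) > 0" by (auto simp: card_gt_0_iff)
    then show ?thesis by simp
  qed
  moreover have "card (Omega1 G) \<le> order G"
    using fin by (auto simp: Omega1_eq order_def intro!: card_mono)
  moreover have "(order G - card (Omega1 G)) div 2 + card (Omega1 G) = (order G + card (Omega1 G)) div 2"
    using calculation(4) by linarith
  ultimately have "card (symmetric_units :: ('a \<Rightarrow> 'f) set) * CARD('f)
      = CARD('f) ^ Suc (unitary_exponent G)"
    by (simp add: unitary_exponent_def order_def) 
  then show ?thesis by simp
qed

text \<open>A unitary element has some \<open>g \<otimes> g\<close> as its square. Divided by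
  \<open>g\<close> it has square 1, so it is its own inverse and therefore symmetric; the fibres of
  squaring are translates of \<open>symmetric_units\<close>.\<close>

theorem card_unitaries_exponent4:
  assumes F: "CHAR('f::{field,finite}) = 2" and card: "card (group_squares G) \<le> 4"
  shows "card (unitaries G :: ('a \<Rightarrow> 'f) set)
    = card (group_squares G) * CARD('f) ^ unitary_exponent G"
proof -
  let ?d = "\<lambda>b. single b 1 :: 'a \<Rightarrow> 'f"
  have sq_closed: "group_squares G \<subseteq> carrier G" by (auto simp: group_squares_def)
  have mult_comm: "x \<diamondop> y = y \<diamondop> x" for x y :: "'a \<Rightarrow> 'f" by (rule galg_comm) (rule comm)
  have sq_mult: "(x \<diamondop> y) \<diamondop> (x \<diamondop> y) = (x \<diamondop> x) \<diamondop> (y \<diamondop> y)" for x y :: "'a \<Rightarrow> 'f"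
  proof -
    have "(x \<diamondop> y) \<diamondop> (x \<diamondop> y) = x \<diamondop> (y \<diamondop> x) \<diamondop> y" by (simp only: galg_assoc)
    also have "\<dots> = x \<diamondop> (x \<diamondop> y) \<diamondop> y" by (simp only: mult_comm[of y x])
    finally show ?thesis by (simp only: galg_assoc)
  qed
  have "card (unitaries G :: ('a \<Rightarrow> 'f) set)
      = card (symmetric_units :: ('a \<Rightarrow> 'f) set) * card (?d ` group_squares G)"
  proof (rule card_fibres[where f = "\<lambda>x. x \<diamondop> x"])
    show "finite (unitaries G :: ('a \<Rightarrow> 'f) set)"
      using finite_galg finite_subset unfolding unitaries_def by fastforce
    show "finite (?d ` group_squares G)"
      using fin by (simp add: group_squares_def)
    show "(\<lambda>x. x \<diamondop> x) ` unitaries G \<subseteq> ?d ` group_squares G"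
    proof (rule image_subsetI)
      fix x :: "'a \<Rightarrow> 'f" assume x: "x \<in> unitaries G"
      obtain b where b: "b \<in> group_squares G"
        "\<And>b'. b' \<in> group_squares G \<Longrightarrow> square_sum x b' = (if b' = b then 1 else 0)"
        using unitary_square_sum[OF F x card] by blast
      have "(x \<diamondop> x) g = ?d b g" if g: "g \<in> carrier G" for g
      proof (cases "g \<in> group_squares G")
        case True
        then show ?thesis unfolding square_apply[OF F g] b(2)[OF True] by (simp add: single_def)
      next
        case False
        then have "{h \<in> carrier G. h \<otimes> h = g} = {}" by (auto simp: group_squares_def)
        then have "square_sum x g = 0" unfolding square_sum_def by (simp only: sum.empty)
        then show ?thesis using False b(1) unfolding square_apply[OF F g] by (auto simp: single_def)
      qed
      then have "x \<diamondop> x = ?d b" using b(1) sq_closed by (intro galg_eqI) auto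
      then show "x \<diamondop> x \<in> ?d ` group_squares G" using b(1) by blast
    qed
    show "card {x \<in> unitaries G. x \<diamondop> x = y} = card (symmetric_units :: ('a \<Rightarrow> 'f) set)"
      if y: "y \<in> ?d ` group_squares G" for y
    proof -
      obtain g where g: "g \<in> carrier G" "y = ?d (g \<otimes> g)" using y by (auto simp: group_squares_def)
      have cancel: "?d (inv g) \<diamondop> (?d g \<diamondop> x) = x" "?d g \<diamondop> (?d (inv g) \<diamondop> x) = x"
        if "x \<in> FG" for x
        using that g by (simp_all add: galg_assoc[symmetric] single_mult_single)
      have "{x \<in> unitaries G. x \<diamondop> x = y} = (\<lambda>x. ?d g \<diamondop> x) ` symmetric_units"
      proof (intro equalityI subsetI)
        fix x assume "x \<in> {x \<in> unitaries G. x \<diamondop> x = y}"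
        then have x: "x \<in> unitaries G" "x \<diamondop> x = ?d (g \<otimes> g)" "x \<in> FG"
          by (auto simp: g(2) unitaries_def)
        define z where "z = ?d (inv g) \<diamondop> x"
        have zU: "z \<in> unitaries G"
          unfolding z_def using x g by (intro unitaries_mult single_unitary) auto
        have "z \<diamondop> z = ?d (inv g \<otimes> inv g \<otimes> (g \<otimes> g))"
          unfolding z_def sq_mult[of "?d (inv g)" x] x(2) using g by (simp add: single_mult_single)
        also have "inv g \<otimes> inv g \<otimes> (g \<otimes> g) = \<one>" using g by (simp add: m_assoc)
        finally have zz: "z \<diamondop> z = single \<one> 1" .
        have "star G z = (z \<diamondop> z) \<diamondop> star G z" by (simp add: zz)
        also have "\<dots> = z" using zU by (simp add: galg_assoc unitaries_def)
        finally have "z \<in> symmetric_units"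
          using sum_unitary[OF F zU] zU by (simp add: symmetric_units_def unitaries_def)
        moreover have "x = ?d g \<diamondop> z" unfolding z_def using cancel(2)[OF x(3)] ..
        ultimately show "x \<in> (\<lambda>x. ?d g \<diamondop> x) ` symmetric_units" by blast
      next
        fix x assume "x \<in> (\<lambda>x. ?d g \<diamondop> x) ` symmetric_units"
        then obtain z :: "'a \<Rightarrow> 'f" where z: "z \<in> symmetric_units" "x = ?d g \<diamondop> z" by auto
        note zU = symmetric_unit_unitary[OF F z(1)]
        have "x \<diamondop> x = ?d (g \<otimes> g)"
          unfolding z(2) sq_mult[of "?d g" z] zU(2) using g by (simp add: single_mult_single)
        moreover have "x \<in> unitaries G"
          unfolding z(2) using g zU(1) by (intro unitaries_mult single_unitary)
        ultimately show "x \<in> {x \<in> unitaries G. x \<diamondop> x = y}" by (simp add: g(2))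
      qed
      moreover have "inj_on (\<lambda>x. ?d g \<diamondop> x) symmetric_units"
        by (rule inj_on_inverseI[where g = "\<lambda>x. ?d (inv g) \<diamondop> x"])
          (simp add: cancel symmetric_units_def)
      ultimately show ?thesis by (simp add: card_image)
    qed
  qed
  moreover have "inj_on ?d (group_squares G)"
  proof (rule inj_onI)
    fix b b' assume "?d b = ?d b'"
    then have "?d b b = ?d b' b" by simp
    then show "b = b'" by (simp add: single_def split: if_splits)
  qed
  ultimately show ?thesis by (simp add: card_symmetric_units[OF F] card_image)
qed

end

subsection \<open>Abelian groups of two-power exponent\<close>

text \<open>The identity is included: for an abelian group this is \<open>Omega1\<close> of the
  subgroup of squares.\<close>

definition square_involutions :: "('a, 'b) monoid_scheme \<Rightarrow> 'a set" where
  "square_involutions G = {b \<in> group_squares G. b \<otimes>\<^bsub>G\<^esub> b = \<one>\<^bsub>G\<^esub>}"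

text \<open>The quotient by \<open>{\<one>, c}\<close> is abelian because commutators lie there. Its
  cosets are numbered, so that repeated quotients keep the type \<open>nat monoid\<close> and an
  induction can run over them.\<close>

lemma (in finite_group) central_quotient:
  assumes c: "c \<in> carrier G" "c \<otimes> c = \<one>" "c \<noteq> \<one>"
    and comm: "\<And>g h. g \<in> carrier G \<Longrightarrow> h \<in> carrier G \<Longrightarrow> g \<otimes> h = h \<otimes> g \<or> g \<otimes> h = h \<otimes> g \<otimes> c"
    and central: "\<And>g. g \<in> carrier G \<Longrightarrow> c \<otimes> g = g \<otimes> c"
  obtains A :: "nat monoid" and \<pi> where "double_cover G A \<pi> c"
proof -
  have inv_c: "inv c = c" using c by (intro inv_equality)
  have sub: "subgroup {\<one>, c} G"
    by (rule subgroupI) (use c inv_c in auto)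
  have normal: "{\<one>, c} \<lhd> G"
  proof (rule normal_invI[OF sub])
    fix g h assume g: "g \<in> carrier G" "h \<in> {\<one>, c}"
    have "g \<otimes> c \<otimes> inv g = c" unfolding central[OF g(1), symmetric] using g(1) c by (simp add: mult_inv_cancel)
    then show "g \<otimes> h \<otimes> inv g \<in> {\<one>, c}" using g by auto
  qed
  have finC: "finite ((\<lambda>g. {g, g \<otimes> c}) ` carrier G)" using fin by simp
  obtain e :: "'a set \<Rightarrow> nat" where e: "inj_on e ((\<lambda>g. {g, g \<otimes> c}) ` carrier G)"
    using finite_imp_inj_to_nat_seg[OF finC] by blast
  define \<pi> where "\<pi> g = e {g, g \<otimes> c}" for g
  have pi_eq: "\<pi> g = \<pi> h \<longleftrightarrow> g \<otimes> inv h \<in> {\<one>, c}" if "g \<in> carrier G" "h \<in> carrier G" for g h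
  proof -
    have "\<pi> g = \<pi> h \<longleftrightarrow> {g, g \<otimes> c} = {h, h \<otimes> c}"
      unfolding \<pi>_def by (rule inj_on_eq_iff[OF e]) (use that in auto)
    also have "\<dots> \<longleftrightarrow> g = h \<or> g = h \<otimes> c"
    proof -
      have "h \<otimes> c \<otimes> c = h" using that c by (simp add: m_assoc)
      then show ?thesis by (auto simp: doubleton_eq_iff)
    qed
    also have "g = h \<longleftrightarrow> g \<otimes> inv h = \<one>"
      using that inv_solve_right'[of "\<one>" g h] by simp
    also have "g = h \<otimes> c \<longleftrightarrow> g \<otimes> inv h = c"
      using that c inv_solve_right'[of c g h] central[of h] by simp
    finally show ?thesis by simp
  qed
  have weak: "weak_group_morphism \<pi> {\<one>, c} G"
    by (rule weak_group_morphismsI[OF normal]) (rule pi_eq)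
  let ?A = "image_group \<pi> G"
  have A: "group ?A" by (rule image_group_is_group[OF weak])
  have hom: "\<pi> \<in> hom G ?A" by (rule weak_group_morphism_is_hom[OF weak])
  have surj: "\<pi> ` carrier G = carrier ?A" by (simp add: image_group_carrier)
  have "double_cover G ?A \<pi> c"
  proof (intro double_cover.intro double_cover_axioms.intro finite_group.intro finite_group_axioms.intro)
    show "finite (carrier ?A)" using fin by (simp add: image_group_carrier)
    show "\<pi> g = \<one>\<^bsub>?A\<^esub> \<longleftrightarrow> g = \<one> \<or> g = c" if "g \<in> carrier G" for g
      using pi_eq[OF that one_closed] that by (simp add: image_group_one)
    fix a b assume "a \<in> carrier ?A" "b \<in> carrier ?A"
    then obtain g h where g: "g \<in> carrier G" "a = \<pi> g" and h: "h \<in> carrier G" "b = \<pi> h"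
      unfolding surj[symmetric] by auto
    have "\<pi> (h \<otimes> g \<otimes> c) = \<pi> (h \<otimes> g)"
    proof -
      have "h \<otimes> g \<otimes> c \<otimes> inv (h \<otimes> g) = c"
        unfolding central[OF m_closed[OF h(1) g(1)], symmetric]
        using g h c by (simp add: mult_inv_cancel del: inv_mult_group)
      then show ?thesis using pi_eq[of "h \<otimes> g \<otimes> c" "h \<otimes> g"] g h c by simp
    qed
    then have "\<pi> (g \<otimes> h) = \<pi> (h \<otimes> g)" using comm[OF g(1) h(1)] by auto
    then show "a \<otimes>\<^bsub>?A\<^esub> b = b \<otimes>\<^bsub>?A\<^esub> a"
      using hom_mult[OF hom g(1) h(1)] hom_mult[OF hom h(1) g(1)] by (simp add: g h)
  qed (use A fin c hom surj is_group in auto)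
  then show thesis by (rule that)
qed

section \<open>Dividing a 2-group by a fourth power\<close>

definition group_square :: "('a, 'b) monoid_scheme \<Rightarrow> 'a \<Rightarrow> 'a" where
  "group_square G g = g \<otimes>\<^bsub>G\<^esub> g"

text \<open>Elements have 2-power order. Iterated squaring is the form that passes to quotients and
  from which a fourth power of order two is extracted.\<close>

definition two_primary :: "('a, 'b) monoid_scheme \<Rightarrow> bool" where
  "two_primary G \<longleftrightarrow> (\<forall>g\<in>carrier G. \<exists>j. (group_square G ^^ j) g = \<one>\<^bsub>G\<^esub>)"

context double_cover
begin

lemma two_primary_quotient:
  assumes "two_primary G"
  shows "two_primary A"
  unfolding two_primary_def
proof
  fix a assume "a \<in> carrier A"
  then obtain g where g: "g \<in> carrier G" "a = \<pi> g" using pi_surjE by blast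
  have "(group_square G ^^ j) g \<in> carrier G \<and> (group_square A ^^ j) a = \<pi> ((group_square G ^^ j) g)" for j
    by (induction j) (auto simp: g group_square_def)
  moreover obtain j where "(group_square G ^^ j) g = \<one>" using assms g(1) by (auto simp: two_primary_def)
  ultimately have "(group_square A ^^ j) a = \<one>\<^bsub>A\<^esub>" by (metis pi.hom_one)
  then show "\<exists>j. (group_square A ^^ j) a = \<one>\<^bsub>A\<^esub>" ..
qed

text \<open>Both \<open>g\<close> and the central element \<open>r \<otimes> r\<close> are square
  roots of \<open>c\<close>, so \<open>s = inv g \<otimes> (r \<otimes> r)\<close> squares to 1 and
  commutes with \<open>g\<close>; then \<open>p = r\<close> works.\<close>

lemma fourth_root_lifts:
  assumes r: "r \<in> carrier G" "(r \<otimes> r) \<otimes> (r \<otimes> r) = c"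
    and central: "\<And>g. g \<in> carrier G \<Longrightarrow> (r \<otimes> r) \<otimes> g = g \<otimes> (r \<otimes> r)"
    and g: "g \<in> carrier G" "g \<otimes> g = c"
  shows "\<exists>s\<in>carrier G. \<exists>p\<in>carrier G. s \<otimes> s = \<one> \<and> g \<otimes> s = s \<otimes> g \<and> g \<otimes> s = p \<otimes> p"
proof (intro bexI conjI)
  let ?r = "r \<otimes> r" and ?s = "inv g \<otimes> (r \<otimes> r)"
  show "g \<otimes> ?s = r \<otimes> r" using g r by simp
  have "?s \<otimes> g = inv g \<otimes> (?r \<otimes> g)" using g r by (simp add: m_assoc)
  also have "\<dots> = inv g \<otimes> (g \<otimes> ?r)" by (simp only: central[OF g(1)])
  finally show "g \<otimes> ?s = ?s \<otimes> g" using g r by simp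
  have "?s \<otimes> ?s = inv g \<otimes> (?r \<otimes> inv g) \<otimes> ?r" using g r(1) by (simp add: m_assoc)
  also have "\<dots> = inv g \<otimes> (inv g \<otimes> ?r) \<otimes> ?r" using g by (simp only: central inv_closed)
  also have "\<dots> = (inv g \<otimes> inv g) \<otimes> (?r \<otimes> ?r)" using g r(1) by (simp add: m_assoc)
  also have "inv g \<otimes> inv g = inv (g \<otimes> g)" using g(1) by (simp add: inv_mult_group)
  finally show "?s \<otimes> ?s = \<one>" by (simp add: g(2) r(2))
qed (use g r in auto)

text \<open>The preimage in \<open>G\<close> is the union of \<open>square_involutions G\<close> and
  its translate by \<open>r \<otimes> r\<close>, whose elements have square \<open>c\<close>. The
  doubling is offset by \<open>\<pi>\<close> being two to one.\<close>

lemma card_square_involutions: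
  assumes comm: "\<And>g h. g \<in> carrier G \<Longrightarrow> h \<in> carrier G \<Longrightarrow> g \<otimes> h = h \<otimes> g"
    and r: "r \<in> carrier G" "(r \<otimes> r) \<otimes> (r \<otimes> r) = c"
  shows "card (square_involutions A) = card (square_involutions G)"
proof -
  let ?r = "r \<otimes> r" and ?I = "square_involutions G"
  have sq: "(g \<otimes> h) \<otimes> (g \<otimes> h) = (g \<otimes> g) \<otimes> (h \<otimes> h)" if "g \<in> carrier G" "h \<in> carrier G" for g h
  proof -
    have "(g \<otimes> h) \<otimes> (g \<otimes> h) = g \<otimes> (h \<otimes> g) \<otimes> h" using that by (simp add: m_assoc)
    also have "\<dots> = g \<otimes> (g \<otimes> h) \<otimes> h" using that comm by simp
    finally show ?thesis using that by (simp add: m_assoc)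
  qed
  have IG: "?I \<subseteq> carrier G" "finite ?I"
    using fin by (auto simp: square_involutions_def group_squares_def)
  have pre: "{g \<in> carrier G. \<pi> g \<in> square_involutions A} = ?I \<union> (\<lambda>b. ?r \<otimes> b) ` ?I"
  proof (intro equalityI subsetI)
    fix g assume "g \<in> {g \<in> carrier G. \<pi> g \<in> square_involutions A}"
    then have g: "g \<in> carrier G" "\<pi> g \<otimes>\<^bsub>A\<^esub> \<pi> g = \<one>\<^bsub>A\<^esub>" "\<pi> g \<in> group_squares A"
      by (auto simp: square_involutions_def)
    from g(3) obtain a where "a \<in> carrier A" "\<pi> g = a \<otimes>\<^bsub>A\<^esub> a" by (auto simp: group_squares_def)
    then obtain h where h: "h \<in> carrier G" "\<pi> g = \<pi> h \<otimes>\<^bsub>A\<^esub> \<pi> h" using pi_surjE by metis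
    then have "\<pi> g = \<pi> (h \<otimes> h)" by simp
    then have "g = h \<otimes> h \<or> g = h \<otimes> h \<otimes> c" using g(1) h(1) pi_eq_iff by blast
    \<comment> \<open>The factor \<open>c\<close>, being the square of \<open>r \<otimes> r\<close>,
      is absorbed into the square.\<close>
    moreover have "h \<otimes> h \<otimes> c = (h \<otimes> ?r) \<otimes> (h \<otimes> ?r)" using sq[of h ?r] h(1) r by simp
    ultimately have gsq: "g \<in> group_squares G" using h(1) r(1) by (auto simp: group_squares_def)
    have "\<pi> (g \<otimes> g) = \<one>\<^bsub>A\<^esub>" using g by simp
    then have "g \<otimes> g = \<one> \<or> g \<otimes> g = c" using g(1) by (intro pi_kerD) auto
    then show "g \<in> ?I \<union> (\<lambda>b. ?r \<otimes> b) ` ?I"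
    proof
      assume "g \<otimes> g = c"
      let ?b = "inv ?r \<otimes> g"
      obtain k where k: "k \<in> carrier G" "g = k \<otimes> k" using gsq by (auto simp: group_squares_def)
      have "?b = (inv r \<otimes> k) \<otimes> (inv r \<otimes> k)"
        using sq[of "inv r" k] k r(1) by (simp add: inv_mult_group)
      then have "?b \<in> group_squares G" using k r(1) by (auto simp: group_squares_def)
      moreover have "?b \<otimes> ?b = inv (?r \<otimes> ?r) \<otimes> (g \<otimes> g)"
        using sq[of "inv ?r" g] g r(1) inv_mult_group[of ?r ?r] by simp
      then have "?b \<otimes> ?b = \<one>" by (simp add: \<open>g \<otimes> g = c\<close> r(2))
      ultimately have "?b \<in> ?I" by (simp add: square_involutions_def)
      moreover have "g = ?r \<otimes> ?b" using g(1) r(1) by simp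
      ultimately show ?thesis by blast
    qed (use gsq in \<open>simp add: square_involutions_def\<close>)
  next
    fix g assume "g \<in> ?I \<union> (\<lambda>b. ?r \<otimes> b) ` ?I"
    then obtain b where b: "b \<in> ?I" "g = b \<or> g = ?r \<otimes> b" by blast
    then obtain k where k: "k \<in> carrier G" "b = k \<otimes> k" "b \<otimes> b = \<one>"
      by (auto simp: square_involutions_def group_squares_def)
    have "\<exists>k\<in>carrier G. g = k \<otimes> k"
      using b(2) k sq[of r k] r(1) by (metis m_closed)
    moreover have "g \<otimes> g = \<one> \<or> g \<otimes> g = c"
      using b(2) k sq[of ?r b] r by auto
    ultimately obtain k where k: "k \<in> carrier G" "g = k \<otimes> k" "g \<otimes> g = \<one> \<or> g \<otimes> g = c" by blast
    then have gG: "g \<in> carrier G" by simp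
    have "\<pi> g \<otimes>\<^bsub>A\<^esub> \<pi> g = \<pi> (g \<otimes> g)" by (rule pi.hom_mult[OF gG gG, symmetric])
    also have "\<dots> = \<one>\<^bsub>A\<^esub>" using k(3) by (elim disjE) (simp_all only: pi.hom_one pi_c)
    finally have "\<pi> g \<otimes>\<^bsub>A\<^esub> \<pi> g = \<one>\<^bsub>A\<^esub>" .
    moreover have "\<pi> g \<in> group_squares A"
      unfolding group_squares_def using k(1) by (intro image_eqI[of _ _ "\<pi> k"]) (simp_all add: k(2))
    ultimately show "g \<in> {g \<in> carrier G. \<pi> g \<in> square_involutions A}"
      using gG by (simp add: square_involutions_def)
  qed
  have "?I \<inter> (\<lambda>b. ?r \<otimes> b) ` ?I = {}"
  proof -
    have "(?r \<otimes> b) \<otimes> (?r \<otimes> b) = c" if "b \<in> ?I" for b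
      using that sq[of ?r b] r IG(1) by (auto simp: square_involutions_def)
    then show ?thesis using c_ne by (auto simp: square_involutions_def)
  qed
  moreover have "inj_on (\<lambda>b. ?r \<otimes> b) ?I"
    by (rule inj_on_inverseI[where g = "\<lambda>b. inv ?r \<otimes> b"]) (use IG r(1) in auto)
  ultimately have "card (?I \<union> (\<lambda>b. ?r \<otimes> b) ` ?I) = 2 * card ?I"
    using IG(2) by (simp add: card_Un_disjoint card_image)
  moreover have "square_involutions A \<subseteq> carrier A"
    by (auto simp: square_involutions_def group_squares_def)
  ultimately show ?thesis using card_preimage[of "square_involutions A"] pre by simp
qed

end

text \<open>The bound four on \<open>square_involutions A\<close> only serves to solve the quadratic equations for the
  coset sums by hand, in \<open>char2_four_cases\<close>.\<close>

theorem card_unitaries_abelian: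
  fixes A :: "nat monoid"
  assumes F: "CHAR('f::{field,finite}) = 2"
    and "finite_group A" and "\<And>a b. a \<in> carrier A \<Longrightarrow> b \<in> carrier A \<Longrightarrow> a \<otimes>\<^bsub>A\<^esub> b = b \<otimes>\<^bsub>A\<^esub> a"
    and "two_primary A" and "card (square_involutions A) \<le> 4"
  shows "card (unitaries A :: (nat \<Rightarrow> 'f) set)
    = card (square_involutions A) * CARD('f) ^ unitary_exponent A"
  using assms(2-)
proof (induction "order A" arbitrary: A rule: less_induct)
  case less
  interpret A: finite_group A by (rule less.prems)
  note comm = less.prems(2)
  show ?case
  proof (cases "\<forall>a\<in>carrier A. (a \<otimes>\<^bsub>A\<^esub> a) \<otimes>\<^bsub>A\<^esub> (a \<otimes>\<^bsub>A\<^esub> a) = \<one>\<^bsub>A\<^esub>")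
    case True
    interpret abelian_exponent4 A by unfold_locales (use comm True in auto)
    have "square_involutions A = group_squares A"
      using True by (auto simp: square_involutions_def group_squares_def)
    then show ?thesis using card_unitaries_exponent4[OF F] less.prems(4) by simp
  next
    case False
    let ?q = "group_square A"
    obtain a where a: "a \<in> carrier A" "?q (?q a) \<noteq> \<one>\<^bsub>A\<^esub>" using False by (auto simp: group_square_def)
    have closed: "(?q ^^ j) a \<in> carrier A" for j
      by (induction j) (use a in \<open>auto simp: group_square_def\<close>)
    \<comment> \<open>\<open>j\<close> squarings are the first to kill \<open>a\<close>, and
      \<open>j\<close> is at least 3 by the choice of \<open>a\<close>. Three squarings earlier
      stands \<open>r\<close>, whose fourth power \<open>c\<close> is thus an involution.\<close>
    define j where "j = (LEAST j. (?q ^^ j) a = \<one>\<^bsub>A\<^esub>)"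
    have ex: "\<exists>j. (?q ^^ j) a = \<one>\<^bsub>A\<^esub>" using less.prems(3) a(1) by (auto simp: two_primary_def)
    have j: "(?q ^^ j) a = \<one>\<^bsub>A\<^esub>" unfolding j_def using ex by (rule LeastI_ex)
    have q1: "?q \<one>\<^bsub>A\<^esub> = \<one>\<^bsub>A\<^esub>" by (simp add: group_square_def)
    have "j \<noteq> 0" "j \<noteq> 1" "j \<noteq> 2"
    proof -
      show "j \<noteq> 0"
      proof
        assume "j = 0"
        then have "a = \<one>\<^bsub>A\<^esub>" using j by simp
        then show False using a(2) q1 by simp
      qed
    qed (use j a(2) q1 in \<open>auto simp: numeral_2_eq_2\<close>)
    then have "j = Suc (Suc (Suc (j - 3)))" by simp
    then obtain i where i: "j = Suc (Suc (Suc i))" by blast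
    define r where "r = (?q ^^ i) a"
    define c where "c = ?q (?q r)"
    have r: "r \<in> carrier A" using closed by (simp add: r_def)
    have "(?q ^^ Suc (Suc i)) a \<noteq> \<one>\<^bsub>A\<^esub>"
      using not_less_Least[of "Suc (Suc i)" "\<lambda>j. (?q ^^ j) a = \<one>\<^bsub>A\<^esub>"] i unfolding j_def[symmetric] by simp
    then have c: "c \<noteq> \<one>\<^bsub>A\<^esub>" "c \<otimes>\<^bsub>A\<^esub> c = \<one>\<^bsub>A\<^esub>" "c \<in> carrier A"
      using j r unfolding i by (simp_all add: c_def r_def group_square_def)
    obtain Q :: "nat monoid" and \<pi> where dc: "double_cover A Q \<pi> c"
      by (rule A.central_quotient[OF c(3,2,1)]) (use comm c in auto)
    interpret D: double_cover A Q \<pi> c by (rule dc)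
    have rr: "(r \<otimes>\<^bsub>A\<^esub> r) \<otimes>\<^bsub>A\<^esub> (r \<otimes>\<^bsub>A\<^esub> r) = c" by (simp add: c_def group_square_def)
    have cardQ: "card (square_involutions Q) = card (square_involutions A)"
      by (rule D.card_square_involutions[OF comm r rr])
    have "order Q < order A"
    proof -
      have "card (carrier Q) > 0" using D.A.fin D.A.one_closed by (auto simp: card_gt_0_iff)
      then show ?thesis using D.order_double by (simp add: order_def)
    qed
    then have "card (unitaries Q :: (nat \<Rightarrow> 'f) set)
        = card (square_involutions Q) * CARD('f) ^ unitary_exponent Q"
      by (rule less.hyps)
        (use D.A.finite_group_axioms D.A_comm D.two_primary_quotient[OF less.prems(3)] cardQ less.prems(4) in auto)
    then show ?thesis
      unfolding cardQ
      by (rule D.card_unitaries_cover[OF F, rotated])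
        (use D.fourth_root_lifts[OF r rr] comm r in auto)
  qed
qed

subsection \<open>Presented groups with a Heisenberg normal form\<close>

text \<open>The word \<open>a\<^sup>x b\<^sup>y d\<^sup>z\<close> with \<open>d\<close> central and \<open>b a = a b d\<close> is recorded as \<open>(x, y, z)\<close>.\<close>

fun heis_mult :: "int \<times> int \<times> int \<Rightarrow> int \<times> int \<times> int \<Rightarrow> int \<times> int \<times> int" where
  "heis_mult (x, y, z) (x', y', z') = (x + x', y + y', z + z' + y * x')"

fun letter_val :: "gen \<times> bool \<Rightarrow> int \<times> int \<times> int" where
  "letter_val (GA, s) = (if s then 1 else - 1, 0, 0)"
| "letter_val (GB, s) = (0, if s then 1 else - 1, 0)"
| "letter_val (GD, s) = (0, 0, if s then 1 else - 1)"

definition word_val :: "gen word \<Rightarrow> int \<times> int \<times> int" where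
  "word_val w = foldr (\<lambda>l. heis_mult (letter_val l)) w (0, 0, 0)"

text \<open>Equality modulo the relations \<open>a ^ 2 ^ N = d ^ \<alpha>\<close>, \<open>b\<^sup>2 = d ^ \<beta>\<close> and \<open>d\<^sup>2 = 1\<close>.\<close>

fun heis_eq :: "nat \<Rightarrow> int \<Rightarrow> int \<Rightarrow> int \<times> int \<times> int \<Rightarrow> int \<times> int \<times> int \<Rightarrow> bool" where
  "heis_eq N \<alpha> \<beta> (x, y, z) (x', y', z') \<longleftrightarrow>
     (\<exists>p q. x' = x + 2 ^ N * p \<and> y' = y + 2 * q \<and> even (z' - z - \<alpha> * p - \<beta> * q))"

lemma heis_assoc: "heis_mult (heis_mult u v) w = heis_mult u (heis_mult v w)"
  by (cases u; cases v; cases w) (simp add: algebra_simps)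

lemma heis_zero [simp]: "heis_mult (0, 0, 0) v = v" "heis_mult v (0, 0, 0) = v"
  by (cases v; simp)+

lemma word_val_Nil [simp]: "word_val [] = (0, 0, 0)"
  by (simp add: word_val_def)

lemma word_val_Cons [simp]: "word_val (l # w) = heis_mult (letter_val l) (word_val w)"
  by (simp add: word_val_def)

lemma word_val_append [simp]: "word_val (u @ v) = heis_mult (word_val u) (word_val v)"
  by (induction u) (simp_all add: heis_assoc)

lemma heis_eq_refl: "heis_eq N \<alpha> \<beta> u u"
  by (cases u) (auto intro!: exI[of _ 0])

lemma heis_eq_sym: "heis_eq N \<alpha> \<beta> u v \<Longrightarrow> heis_eq N \<alpha> \<beta> v u"
proof (cases u; cases v)
  fix x y z x' y' z' assume uv: "u = (x, y, z)" "v = (x', y', z')" and "heis_eq N \<alpha> \<beta> u v"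
  then obtain p q where "x' = x + 2 ^ N * p" "y' = y + 2 * q" "even (z' - z - \<alpha> * p - \<beta> * q)" by auto
  then have "x = x' + 2 ^ N * (- p) \<and> y = y' + 2 * (- q) \<and> even (z - z' - \<alpha> * (- p) - \<beta> * (- q))"
    by auto
  then show ?thesis unfolding uv heis_eq.simps by blast
qed

lemma heis_eq_trans:
  assumes "heis_eq N \<alpha> \<beta> u v" "heis_eq N \<alpha> \<beta> v w"
  shows "heis_eq N \<alpha> \<beta> u w"
proof -
  obtain x y z x' y' z' x'' y'' z'' where e: "u = (x, y, z)" "v = (x', y', z')" "w = (x'', y'', z'')"
    by (metis surj_pair)
  obtain p q where 1: "x' = x + 2 ^ N * p" "y' = y + 2 * q" "even (z' - z - \<alpha> * p - \<beta> * q)"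
    using assms(1) e by auto
  obtain p' q' where 2: "x'' = x' + 2 ^ N * p'" "y'' = y' + 2 * q'" "even (z'' - z' - \<alpha> * p' - \<beta> * q')"
    using assms(2) e by auto
  have "x'' = x + 2 ^ N * (p + p')" "y'' = y + 2 * (q + q')"
    using 1 2 by (simp_all add: algebra_simps)
  moreover have "z'' - z - \<alpha> * (p + p') - \<beta> * (q + q')
      = (z' - z - \<alpha> * p - \<beta> * q) + (z'' - z' - \<alpha> * p' - \<beta> * q')" by (simp add: algebra_simps)
  then have "even (z'' - z - \<alpha> * (p + p') - \<beta> * (q + q'))" using 1(3) 2(3) by (simp only: dvd_add)
  ultimately show ?thesis unfolding e heis_eq.simps by blast
qed

text \<open>This expresses that \<open>a ^ 2 ^ N\<close> and \<open>b ^ 2\<close> are central: by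
  \<open>N \<ge> 1\<close> the term \<open>y * x'\<close> of the product changes by an even amount
  only.\<close>

lemma heis_eq_mult:
  assumes N: "N \<ge> 1" and "heis_eq N \<alpha> \<beta> u v" "heis_eq N \<alpha> \<beta> u' v'"
  shows "heis_eq N \<alpha> \<beta> (heis_mult u u') (heis_mult v v')"
proof -
  obtain x y z x' y' z' where e: "u = (x, y, z)" "v = (x', y', z')" by (metis surj_pair)
  obtain r s t r' s' t' where e': "u' = (r, s, t)" "v' = (r', s', t')" by (metis surj_pair)
  obtain p q where 1: "x' = x + 2 ^ N * p" "y' = y + 2 * q" "even (z' - z - \<alpha> * p - \<beta> * q)"
    using assms(2) e by auto
  obtain p' q' where 2: "r' = r + 2 ^ N * p'" "s' = s + 2 * q'" "even (t' - t - \<alpha> * p' - \<beta> * q')"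
    using assms(3) e' by auto
  obtain n where n: "N = Suc n" using N by (cases N) auto
  have "x' + r' = x + r + 2 ^ N * (p + p')" "y' + s' = y + s + 2 * (q + q')"
    using 1 2 by (simp_all add: algebra_simps)
  moreover have "z' + t' + y' * r' - (z + t + y * r) - \<alpha> * (p + p') - \<beta> * (q + q')
      = (z' - z - \<alpha> * p - \<beta> * q) + (t' - t - \<alpha> * p' - \<beta> * q') + 2 * (y * 2 ^ n * p' + q * r')"
    using 1 2 by (simp add: algebra_simps n)
  then have "even (z' + t' + y' * r' - (z + t + y * r) - \<alpha> * (p + p') - \<beta> * (q + q'))"
    using 1(3) 2(3) by (simp only: dvd_add dvd_triv_left)
  ultimately show ?thesis unfolding e e' heis_mult.simps heis_eq.simps by blast
qed

text \<open>Word values are invariants of the presented group up to \<open>heis_eq\<close>. They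
  show that it does not collapse: inequivalent normal forms give different elements.\<close>

lemma presentation_cong_sound:
  assumes N: "N \<ge> 1" and R: "\<And>u v. (u, v) \<in> R \<Longrightarrow> heis_eq N \<alpha> \<beta> (word_val u) (word_val v)"
    and "(u, v) \<in> presentation_cong S R"
  shows "heis_eq N \<alpha> \<beta> (word_val u) (word_val v)"
  using assms(3)
proof induction
  case (cong_refl w)
  then show ?case by (simp add: heis_eq_refl)
next
  case (cong_sym u v)
  then show ?case by (simp add: heis_eq_sym)
next
  case (cong_trans u v w)
  then show ?case using heis_eq_trans by blast
next
  case (cong_append u v u' v')
  then show ?case using heis_eq_mult[OF N] by simp
next
  case (cong_cancel x s)
  then show ?case by (cases x; cases s) (auto intro!: exI[of _ 0])
qed (use R in auto)

section \<open>The group of words modulo a presentation\<close>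

locale presentation =
  fixes S :: "'x set" and R :: "('x word \<times> 'x word) set"
begin

abbreviation "P \<equiv> presented_group S R"

definition cls :: "'x word \<Rightarrow> 'x word set" where
  "cls w = presentation_cong S R `` {w}"

lemma cong_words: "(u, v) \<in> presentation_cong S R \<Longrightarrow> u \<in> words S \<and> v \<in> words S"
  by (induction rule: presentation_cong.induct) auto

lemma equiv_cong: "equiv (words S) (presentation_cong S R)"
  unfolding equiv_def refl_on_def sym_def trans_def
  using cong_words by (auto intro: cong_refl cong_sym cong_trans)

lemma cls_eq_iff: "u \<in> words S \<Longrightarrow> v \<in> words S \<Longrightarrow> cls u = cls v \<longleftrightarrow> (u, v) \<in> presentation_cong S R"
  unfolding cls_def using eq_equiv_class_iff[OF equiv_cong] by blast

lemma carrier_P: "carrier P = cls ` words S"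
  by (auto simp: presented_group_def quotient_def cls_def)

lemma one_P: "\<one>\<^bsub>P\<^esub> = cls []"
  by (simp add: presented_group_def cls_def)

lemma mult_P:
  assumes "u \<in> words S" "v \<in> words S"
  shows "cls u \<otimes>\<^bsub>P\<^esub> cls v = cls (u @ v)"
proof -
  have eq: "cls (u' @ v') = cls (u @ v)" if "u' \<in> cls u" "v' \<in> cls v" for u' v'
  proof -
    have *: "(u, u') \<in> presentation_cong S R" "(v, v') \<in> presentation_cong S R"
      using that by (auto simp: cls_def)
    then have "(u @ v, u' @ v') \<in> presentation_cong S R" by (rule cong_append)
    then show ?thesis
      using cls_eq_iff[of "u @ v" "u' @ v'"] cong_words by blast
  qed
  have "cls u \<otimes>\<^bsub>P\<^esub> cls v = (\<Union>u'\<in>cls u. \<Union>v'\<in>cls v. cls (u' @ v'))"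
    by (simp add: presented_group_def cls_def)
  also have "\<dots> = (\<Union>u'\<in>cls u. \<Union>v'\<in>cls v. cls (u @ v))"
    using eq by simp
  also have "\<dots> = cls (u @ v)"
  proof -
    have "u \<in> cls u" "v \<in> cls v" using assms by (auto simp: cls_def intro: cong_refl)
    then show ?thesis by auto
  qed
  finally show ?thesis .
qed

lemma word_inv_words: "w \<in> words S \<Longrightarrow> word_inv w \<in> words S"
  by (auto simp: word_inv_def)

lemma word_inv_cancel: "w \<in> words S \<Longrightarrow> (word_inv w @ w, []) \<in> presentation_cong S R"
proof (induction w)
  case (Cons l w)
  obtain x s where l: "l = (x, s)" by (cases l)
  have x: "x \<in> S" and w: "w \<in> words S" using Cons.prems l by auto
  have "([(x, \<not> s), (x, \<not> \<not> s)], []) \<in> presentation_cong S R" using x by (rule cong_cancel)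
  then have "([(x, \<not> s), (x, s)], []) \<in> presentation_cong S R" by simp
  then have "([(x, \<not> s), (x, s)] @ w, [] @ w) \<in> presentation_cong S R"
    by (rule cong_append) (rule cong_refl[OF w])
  then have "(word_inv w @ [(x, \<not> s), (x, s)] @ w, word_inv w @ [] @ w) \<in> presentation_cong S R"
    by (rule cong_append[OF cong_refl[OF word_inv_words[OF w]]])
  then have "(word_inv (l # w) @ l # w, word_inv w @ w) \<in> presentation_cong S R"
    by (simp add: word_inv_def l)
  then show ?case using Cons.IH[OF w] by (rule cong_trans)
qed (auto simp: word_inv_def intro: cong_refl)

lemma group_P: "group P"
proof (rule groupI)
  fix a assume "a \<in> carrier P"
  then obtain w where w: "w \<in> words S" "a = cls w" by (auto simp: carrier_P)
  then have "cls (word_inv w) \<otimes>\<^bsub>P\<^esub> a = \<one>\<^bsub>P\<^esub>"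
    using word_inv_cancel cls_eq_iff[of "word_inv w @ w" "[]"] by (simp add: mult_P word_inv_words one_P)
  then show "\<exists>b\<in>carrier P. b \<otimes>\<^bsub>P\<^esub> a = \<one>\<^bsub>P\<^esub>" using w word_inv_words by (auto simp: carrier_P)
next
  fix a b assume "a \<in> carrier P" "b \<in> carrier P"
  then obtain u v where uv: "u \<in> words S" "a = cls u" "v \<in> words S" "b = cls v"
    by (auto simp only: carrier_P)
  then show "a \<otimes>\<^bsub>P\<^esub> b \<in> carrier P"
    unfolding carrier_P by (simp only: mult_P append_in_lists_conv imageI)
  fix c assume "c \<in> carrier P"
  then obtain w where "w \<in> words S" "c = cls w" by (auto simp only: carrier_P)
  with uv show "a \<otimes>\<^bsub>P\<^esub> b \<otimes>\<^bsub>P\<^esub> c = a \<otimes>\<^bsub>P\<^esub> (b \<otimes>\<^bsub>P\<^esub> c)"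
    by (simp only: mult_P append_in_lists_conv append_assoc)
next
  fix a assume "a \<in> carrier P"
  then obtain u where "u \<in> words S" "a = cls u" by (auto simp only: carrier_P)
  then show "\<one>\<^bsub>P\<^esub> \<otimes>\<^bsub>P\<^esub> a = a" by (simp only: one_P mult_P lists.Nil append_Nil)
qed (simp only: one_P carrier_P imageI lists.Nil)

lemma cls_closed [simp]: "w \<in> words S \<Longrightarrow> cls w \<in> carrier P"
  by (auto simp: carrier_P)

lemma cls_inv: "w \<in> words S \<Longrightarrow> cls (word_inv w) = inv\<^bsub>P\<^esub> cls w"
proof -
  interpret group P by (rule group_P)
  assume w: "w \<in> words S"
  then have "cls (word_inv w) \<otimes>\<^bsub>P\<^esub> cls w = \<one>\<^bsub>P\<^esub>"
    using word_inv_cancel cls_eq_iff[of "word_inv w @ w" "[]"] by (simp add: mult_P word_inv_words one_P)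
  then show ?thesis using w word_inv_words by (intro inv_equality[symmetric]) auto
qed

lemma gen_pow_words: "x \<in> S \<Longrightarrow> gen_pow x k \<in> words S"
  by (auto simp: gen_pow_def)

lemma cls_gen_pow: "x \<in> S \<Longrightarrow> cls (gen_pow x k) = cls [(x, True)] [^]\<^bsub>P\<^esub> k"
proof (induction k)
  case (Suc k)
  interpret group P by (rule group_P)
  have "gen_pow x (Suc k) = gen_pow x k @ [(x, True)]"
    by (simp add: gen_pow_def replicate_append_same)
  then show ?case using Suc gen_pow_words[of x k] by (simp add: mult_P[symmetric])
qed (simp add: gen_pow_def one_P[symmetric])

lemma cls_append: "u \<in> words S \<Longrightarrow> v \<in> words S \<Longrightarrow> cls (u @ v) = cls u \<otimes>\<^bsub>P\<^esub> cls v"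
  by (simp add: mult_P)

lemma cls_relation: "(u, v) \<in> R \<Longrightarrow> u \<in> words S \<Longrightarrow> v \<in> words S \<Longrightarrow> cls u = cls v"
  by (simp add: cls_eq_iff cong_relation)

end

text \<open>The integer Heisenberg group maps onto \<open>G\<close>, with \<open>heis_eq\<close> as
  the kernel relation. Integers in place of residues keep the multiplication polynomial; reduction
  is needed only to compare elements.\<close>

definition heis_param :: "('x, 'b) monoid_scheme \<Rightarrow> nat \<Rightarrow> int \<Rightarrow> int \<Rightarrow> (int \<Rightarrow> int \<Rightarrow> int \<Rightarrow> 'x) \<Rightarrow> bool" where
  "heis_param G N \<alpha> \<beta> \<theta> \<longleftrightarrow> group G \<and> N \<ge> 1 \<and> (\<forall>x y z. \<theta> x y z \<in> carrier G) \<and>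
     (\<forall>g\<in>carrier G. \<exists>x y z. g = \<theta> x y z) \<and>
     (\<forall>x y z x' y' z'. \<theta> x y z \<otimes>\<^bsub>G\<^esub> \<theta> x' y' z' = \<theta> (x + x') (y + y') (z + z' + y * x')) \<and>
     (\<forall>x y z x' y' z'. \<theta> x y z = \<theta> x' y' z' \<longleftrightarrow> heis_eq N \<alpha> \<beta> (x, y, z) (x', y', z'))"

section \<open>Collecting powers of two elements and their central commutator\<close>

context group
begin

lemma conj_int_pow:
  assumes "g \<in> carrier G" "h \<in> carrier G"
  shows "g \<otimes> h [^] (n::int) \<otimes> inv g = (g \<otimes> h \<otimes> inv g) [^] n"
proof -
  have "(\<lambda>x. g \<otimes> x \<otimes> inv g) \<in> hom G G"
    using assms by (auto simp: hom_def m_assoc[symmetric]) (simp add: m_assoc)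
  then show ?thesis
    using hom_int_pow[OF _ assms(2) is_group is_group] by blast
qed

lemma commute_int_pow:
  assumes "g \<in> carrier G" "h \<in> carrier G" "g \<otimes> h = h \<otimes> g"
  shows "g \<otimes> h [^] (n::int) = h [^] n \<otimes> g"
proof -
  have "g \<otimes> h \<otimes> inv g = h" using assms by (simp add: m_assoc)
  then have "g \<otimes> h [^] n \<otimes> inv g = h [^] n" using conj_int_pow[OF assms(1,2)] by simp
  then show ?thesis using assms inv_solve_right'[of "h [^] n" "g \<otimes> h [^] n" g] by simp
qed

text \<open>Conjugation by \<open>b\<close> sends \<open>a\<close> to \<open>a c\<close>, hence
  \<open>a ^ x\<close> to \<open>a ^ x c ^ x\<close>. So conjugation by the inverse of
  \<open>a ^ x\<close> sends \<open>b\<close> to \<open>b c ^ x\<close>, and the \<open>y\<close>-th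
  power gives the rule.\<close>

lemma heis_commute:
  assumes abc: "a \<in> carrier G" "b \<in> carrier G" "c \<in> carrier G"
    and ac: "a \<otimes> c = c \<otimes> a" and bc: "b \<otimes> c = c \<otimes> b" and ba: "b \<otimes> a = a \<otimes> b \<otimes> c"
  shows "b [^] (y::int) \<otimes> a [^] (x::int) = a [^] x \<otimes> b [^] y \<otimes> c [^] (y * x)"
proof -
  have cb: "c [^] x \<otimes> b = b \<otimes> c [^] x" "c [^] x \<otimes> a = a \<otimes> c [^] x" for x :: int
    using commute_int_pow[OF abc(2,3) bc] commute_int_pow[OF abc(1,3) ac] by simp_all
  have "b \<otimes> a \<otimes> inv b = a \<otimes> c" using abc by (simp add: ba bc m_assoc)
  then have "b \<otimes> a [^] x \<otimes> inv b = a [^] x \<otimes> c [^] x"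
    using conj_int_pow[OF abc(2,1)] int_pow_mult_distrib[OF ac abc(1,3)] by simp
  then have "b \<otimes> a [^] x = a [^] x \<otimes> c [^] x \<otimes> b"
    using abc inv_solve_right'[of "a [^] x \<otimes> c [^] x" "b \<otimes> a [^] x" b] by simp
  then have 1: "b \<otimes> a [^] x = a [^] x \<otimes> (b \<otimes> c [^] x)"
    using abc by (simp add: m_assoc cb)
  let ?u = "inv (a [^] x)"
  have "?u \<otimes> b \<otimes> inv ?u = ?u \<otimes> (b \<otimes> a [^] x)" using abc by (simp add: m_assoc)
  also have "\<dots> = b \<otimes> c [^] x" using abc by (simp add: 1 m_assoc[symmetric])
  finally have "?u \<otimes> b [^] y \<otimes> inv ?u = (b \<otimes> c [^] x) [^] y"
    using conj_int_pow[of ?u b y] abc by simp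
  also have "\<dots> = b [^] y \<otimes> c [^] (y * x)"
    using int_pow_mult_distrib[of b "c [^] x" y] abc cb(1)[of x]
    by (simp add: int_pow_pow mult.commute)
  finally have "?u \<otimes> (b [^] y \<otimes> a [^] x) = b [^] y \<otimes> c [^] (y * x)" using abc by (simp add: m_assoc)
  then show ?thesis
    using abc inv_solve_left'[of "b [^] y \<otimes> c [^] (y * x)" "a [^] x" "b [^] y \<otimes> a [^] x"]
    by (simp add: m_assoc)
qed

lemma commute_int_pows:
  assumes "g \<in> carrier G" "h \<in> carrier G" "g \<otimes> h = h \<otimes> g"
  shows "g [^] (m::int) \<otimes> h [^] (n::int) = h [^] n \<otimes> g [^] m"
  using commute_int_pow[of "h [^] n" g m] commute_int_pow[OF assms, of n] assms by simp

end

text \<open>These relations yield normal forms and their equality under \<open>heis_eq\<close>;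
  whether other normal forms stay distinct is left open here.\<close>

locale heis_relations = group G for G (structure) +
  fixes N :: nat and \<alpha> \<beta> :: int and a b c
  assumes N: "N \<ge> 1"
    and abc [simp]: "a \<in> carrier G" "b \<in> carrier G" "c \<in> carrier G"
    and ac: "a \<otimes> c = c \<otimes> a" and bc: "b \<otimes> c = c \<otimes> b" and ba: "b \<otimes> a = a \<otimes> b \<otimes> c"
    and cc: "c \<otimes> c = \<one>" and aN: "a [^] (2 ^ N :: int) = c [^] \<alpha>" and b2: "b [^] (2 :: int) = c [^] \<beta>"
begin

definition \<theta> :: "int \<Rightarrow> int \<Rightarrow> int \<Rightarrow> 'a" where
  "\<theta> x y z = a [^] x \<otimes> b [^] y \<otimes> c [^] z"

lemma theta_closed [simp]: "\<theta> x y z \<in> carrier G"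
  by (simp add: \<theta>_def)

lemma c_comm:
  "c [^] (z::int) \<otimes> a [^] (x::int) = a [^] x \<otimes> c [^] z" "c [^] z \<otimes> b [^] (y::int) = b [^] y \<otimes> c [^] z"
  using commute_int_pows[OF _ _ ac] commute_int_pows[OF _ _ bc] by simp_all

lemma theta_mult: "\<theta> x y z \<otimes> \<theta> x' y' z' = \<theta> (x + x') (y + y') (z + z' + y * x')"
proof -
  have "\<theta> x y z \<otimes> \<theta> x' y' z' = a [^] x \<otimes> b [^] y \<otimes> (c [^] z \<otimes> a [^] x') \<otimes> b [^] y' \<otimes> c [^] z'"
    by (simp add: \<theta>_def m_assoc)
  also have "\<dots> = a [^] x \<otimes> b [^] y \<otimes> (a [^] x' \<otimes> c [^] z) \<otimes> b [^] y' \<otimes> c [^] z'"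
    by (simp only: c_comm)
  also have "\<dots> = a [^] x \<otimes> (b [^] y \<otimes> a [^] x') \<otimes> (c [^] z \<otimes> b [^] y') \<otimes> c [^] z'"
    by (simp add: m_assoc)
  also have "\<dots> = a [^] x \<otimes> (a [^] x' \<otimes> b [^] y \<otimes> c [^] (y * x')) \<otimes> (b [^] y' \<otimes> c [^] z) \<otimes> c [^] z'"
    by (simp only: c_comm heis_commute[OF abc ac bc ba])
  also have "\<dots> = a [^] x \<otimes> a [^] x' \<otimes> b [^] y \<otimes> (c [^] (y * x') \<otimes> b [^] y') \<otimes> (c [^] z \<otimes> c [^] z')"
    by (simp add: m_assoc)
  also have "\<dots> = (a [^] x \<otimes> a [^] x') \<otimes> (b [^] y \<otimes> b [^] y') \<otimes> (c [^] (y * x') \<otimes> (c [^] z \<otimes> c [^] z'))"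
    by (simp only: c_comm) (simp add: m_assoc)
  also have "\<dots> = \<theta> (x + x') (y + y') (z + z' + y * x')"
    by (simp add: \<theta>_def int_pow_mult[symmetric] add_ac)
  finally show ?thesis .
qed

lemma c_even: "even z \<Longrightarrow> c [^] (z::int) = \<one>"
proof -
  assume "even z"
  then obtain k where k: "z = 2 * k" by blast
  have "c [^] (2::int) = c \<otimes> c" using int_pow_mult[of c 1 1] by simp
  then show ?thesis unfolding k using cc int_pow_pow[of c 2 k] by simp
qed

lemma heis_eq_theta:
  assumes "heis_eq N \<alpha> \<beta> (x, y, z) (x', y', z')"
  shows "\<theta> x y z = \<theta> x' y' z'"
proof -
  obtain p q where pq: "x' = x + 2 ^ N * p" "y' = y + 2 * q" "even (z' - z - \<alpha> * p - \<beta> * q)"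
    using assms by auto
  have "even (\<alpha> * p + (\<beta> * q + z') - z)" using pq(3) by auto
  then have "c [^] (\<alpha> * p + (\<beta> * q + z') - z) \<otimes> c [^] z = c [^] z" by (simp add: c_even)
  then have c: "c [^] (\<alpha> * p + (\<beta> * q + z')) = c [^] z"
    by (simp add: int_pow_mult[symmetric])
  have "\<theta> x' y' z' = (a [^] x \<otimes> (a [^] (2 ^ N :: int)) [^] p) \<otimes> (b [^] y \<otimes> (b [^] (2 :: int)) [^] q) \<otimes> c [^] z'"
    unfolding \<theta>_def pq(1,2) int_pow_mult[OF abc(1)] int_pow_mult[OF abc(2)]
    by (simp add: int_pow_pow)
  also have "\<dots> = (a [^] x \<otimes> c [^] (\<alpha> * p)) \<otimes> (b [^] y \<otimes> c [^] (\<beta> * q)) \<otimes> c [^] z'"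
    by (simp add: aN b2 int_pow_pow)
  also have "\<dots> = a [^] x \<otimes> (c [^] (\<alpha> * p) \<otimes> b [^] y) \<otimes> (c [^] (\<beta> * q) \<otimes> c [^] z')"
    by (simp add: m_assoc)
  also have "\<dots> = a [^] x \<otimes> b [^] y \<otimes> (c [^] (\<alpha> * p) \<otimes> (c [^] (\<beta> * q) \<otimes> c [^] z'))"
    by (simp only: c_comm) (simp add: m_assoc)
  also have "\<dots> = \<theta> x y z" by (simp add: \<theta>_def int_pow_mult[symmetric] c)
  finally show ?thesis ..
qed

end

lemma word_val_replicate:
  "word_val (replicate n (GA, True)) = (int n, 0, 0)" "word_val (replicate n (GA, False)) = (- int n, 0, 0)"
  "word_val (replicate n (GB, True)) = (0, int n, 0)" "word_val (replicate n (GB, False)) = (0, - int n, 0)"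
  by (induction n) auto

lemma word_val_surj:
  assumes "{GA, GB} \<subseteq> S"
  shows "\<exists>w \<in> words S. word_val w = v"
proof -
  have A: "\<exists>w \<in> words S. word_val w = (x, 0, 0)" for x
  proof (cases "x \<ge> 0")
    case True
    then show ?thesis
      using assms by (intro bexI[of _ "replicate (nat x) (GA, True)"]) (auto simp: word_val_replicate)
  next
    case False
    then show ?thesis
      using assms by (intro bexI[of _ "replicate (nat (- x)) (GA, False)"]) (auto simp: word_val_replicate)
  qed
  have B: "\<exists>w \<in> words S. word_val w = (0, y, 0)" for y
  proof (cases "y \<ge> 0")
    case True
    then show ?thesis
      using assms by (intro bexI[of _ "replicate (nat y) (GB, True)"]) (auto simp: word_val_replicate)
  next
    case False
    then show ?thesis
      using assms by (intro bexI[of _ "replicate (nat (- y)) (GB, False)"]) (auto simp: word_val_replicate)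
  qed
  obtain x y z where v: "v = (x, y, z)" by (metis surj_pair)
  \<comment> \<open>The word is \<open>a ^ (x - 1) b ^ z a b ^ (y - z)\<close>: moving
    \<open>b ^ z\<close> past one \<open>a\<close> creates the central exponent \<open>z\<close>
    without the letter \<open>GD\<close>, which the two-generator presentations lack.\<close>
  obtain u1 where u1: "u1 \<in> words S" "word_val u1 = (0, z, 0)" using B by blast
  obtain u2 where u2: "u2 \<in> words S" "word_val u2 = (1, 0, 0)" using A by blast
  obtain u3 where u3: "u3 \<in> words S" "word_val u3 = (0, y - z, 0)" using B by blast
  obtain u4 where u4: "u4 \<in> words S" "word_val u4 = (x - 1, 0, 0)" using A by blast
  have "u4 @ u1 @ u2 @ u3 \<in> words S" using u1 u2 u3 u4 by simp
  moreover have "word_val (u4 @ u1 @ u2 @ u3) = v" using u1 u2 u3 u4 by (simp add: v)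
  ultimately show ?thesis by blast
qed

text \<open>The relations bring every word to normal form and identify \<open>heis_eq\<close>
  triples; invariance of word values gives the converse, that equal elements have
  \<open>heis_eq\<close> triples.\<close>

lemma presented_heis_param:
  fixes S :: "gen set" and R
  defines "P \<equiv> presented_group S R"
  assumes S: "{GA, GB} \<subseteq> S"
    and R: "\<And>u v. (u, v) \<in> R \<Longrightarrow> heis_eq N \<alpha> \<beta> (word_val u) (word_val v)"
    and rel: "heis_relations P N \<alpha> \<beta> (presentation.cls S R [(GA, True)]) (presentation.cls S R [(GB, True)]) c"
    and D: "GD \<in> S \<Longrightarrow> presentation.cls S R [(GD, True)] = c"
  shows "\<exists>\<theta>. heis_param P N \<alpha> \<beta> \<theta>"
proof -
  interpret pr: presentation S R .
  interpret heis_relations P N \<alpha> \<beta> "pr.cls [(GA, True)]" "pr.cls [(GB, True)]" c by (rule rel)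
  define V where "V v = (case v of (x, y, z) \<Rightarrow> \<theta> x y z)" for v
  have V_mult: "V u \<otimes>\<^bsub>P\<^esub> V v = V (heis_mult u v)" for u v
    by (cases u; cases v) (simp add: V_def theta_mult)
  have letter: "pr.cls [l] = V (letter_val l)" if "[l] \<in> words S" for l
  proof -
    obtain x s where l: "l = (x, s)" by (cases l)
    have x: "x \<in> S" using that l by simp
    have neg: "pr.cls [(x, False)] = inv\<^bsub>P\<^esub> pr.cls [(x, True)]"
      using pr.cls_inv[of "[(x, True)]"] x by (simp add: word_inv_def P_def)
    show ?thesis
    proof (cases x)
      case GA
      then show ?thesis using neg unfolding l by (cases s) (simp_all add: V_def \<theta>_def int_pow_neg)
    next
      case GB
      then show ?thesis using neg unfolding l by (cases s) (simp_all add: V_def \<theta>_def int_pow_neg)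
    next
      case GD
      then show ?thesis using neg D x unfolding l by (cases s) (simp_all add: V_def \<theta>_def int_pow_neg)
    qed
  qed
  have word: "pr.cls w = V (word_val w)" if "w \<in> words S" for w
    using that
  proof (induction w)
    case Nil
    then show ?case by (simp add: V_def \<theta>_def pr.one_P[symmetric] P_def[symmetric])
  next
    case (Cons l w)
    then have "pr.cls (l # w) = pr.cls [l] \<otimes>\<^bsub>P\<^esub> pr.cls w"
      using pr.cls_append[of "[l]" w] by (simp add: P_def)
    then show ?case using Cons letter[of l] by (simp add: V_mult)
  qed
  have "heis_param P N \<alpha> \<beta> \<theta>"
    unfolding heis_param_def
  proof (intro conjI allI ballI)
    fix g assume "g \<in> carrier P"
    then obtain w where "w \<in> words S" "g = pr.cls w" unfolding P_def pr.carrier_P by blast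
    then have "g = V (word_val w)" using word by simp
    then show "\<exists>x y z. g = \<theta> x y z" by (cases "word_val w") (auto simp: V_def)
  next
    fix x y z x' y' z'
    show "\<theta> x y z = \<theta> x' y' z' \<longleftrightarrow> heis_eq N \<alpha> \<beta> (x, y, z) (x', y', z')"
    proof
      assume eq: "\<theta> x y z = \<theta> x' y' z'"
      obtain w where w: "w \<in> words S" "word_val w = (x, y, z)" using word_val_surj[OF S] by blast
      obtain w' where w': "w' \<in> words S" "word_val w' = (x', y', z')" using word_val_surj[OF S] by blast
      have "pr.cls w = pr.cls w'" using word[OF w(1)] word[OF w'(1)] eq by (simp add: w w' V_def)
      then have "(w, w') \<in> presentation_cong S R" using w w' pr.cls_eq_iff by blast
      then have "heis_eq N \<alpha> \<beta> (word_val w) (word_val w')"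
        by (rule presentation_cong_sound[OF N, rotated]) (rule R)
      then show "heis_eq N \<alpha> \<beta> (x, y, z) (x', y', z')" by (simp only: w w')
    qed (rule heis_eq_theta)
  qed (use N is_group in \<open>auto simp: theta_mult\<close>)
  then show ?thesis by blast
qed

section \<open>Normal forms for the presented factors\<close>

lemma word_val_gen_pow [simp]:
  "word_val (gen_pow GA k) = (int k, 0, 0)" "word_val (gen_pow GB k) = (0, int k, 0)"
  "word_val (gen_pow GD 1) = (0, 0, 1)" "word_val (gen_pow GD (Suc 0)) = (0, 0, 1)" "word_val (gen_pow GD 2) = (0, 0, 2)"
  by (simp_all add: gen_pow_def word_val_replicate numeral_2_eq_2)

lemma gen_pow_one: "gen_pow x 1 = [(x, True)]" "gen_pow x (Suc 0) = [(x, True)]"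
  by (simp_all add: gen_pow_def)

lemma (in group) conj_relation:
  assumes "a \<in> carrier G" "b \<in> carrier G" "c \<in> carrier G"
    and "inv b \<otimes> a \<otimes> b = a \<otimes> c" "b \<otimes> c = c \<otimes> b" "c \<otimes> c = \<one>"
  shows "b \<otimes> a = a \<otimes> b \<otimes> c"
proof -
  have "b \<otimes> (inv b \<otimes> a \<otimes> b) = a \<otimes> b" using assms(1,2) by (simp add: m_assoc[symmetric])
  then have "a \<otimes> b = b \<otimes> (a \<otimes> c)" using assms(4) by simp
  then have "a \<otimes> b \<otimes> c = b \<otimes> (a \<otimes> c) \<otimes> c" by simp
  also have "\<dots> = b \<otimes> a \<otimes> (c \<otimes> c)" using assms(1-3) by (simp add: m_assoc)
  also have "\<dots> = b \<otimes> a" using assms by simp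
  finally show ?thesis ..
qed

text \<open>The commutator \<open>c\<close> is itself a power of \<open>a\<close>, whence
  \<open>\<alpha> = 1\<close>. Conjugation by \<open>b\<close> sends \<open>c\<close> to the
  \<open>2 ^ m\<close>-th power of \<open>a c\<close>, which is \<open>c\<close> again because
  \<open>m \<ge> 1\<close>; so \<open>c\<close> commutes with \<open>b\<close>.\<close>

lemma (in group) cyclic_heis_relations:
  assumes m: "m \<ge> 1" and ab: "a \<in> carrier G" "b \<in> carrier G"
    and a1: "a [^] (2 ^ (m + 1) :: nat) = \<one>" and c_def: "c = a [^] (2 ^ m :: nat)"
    and b2: "b [^] (2 :: nat) = c [^] \<beta>" and conj: "inv b \<otimes> a \<otimes> b = a \<otimes> c"
  shows "heis_relations G m 1 \<beta> a b c"
proof -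
  have c: "c \<in> carrier G" using ab by (simp add: c_def)
  have cc: "c \<otimes> c = \<one>"
    using a1 ab by (simp add: c_def nat_pow_mult mult_2)
  have c_int: "c = a [^] (2 ^ m :: int)" using int_pow_int[of G a "2 ^ m"] by (simp add: c_def)
  have ac: "a \<otimes> c = c \<otimes> a"
    unfolding c_int by (rule commute_int_pow) (use ab in auto)
  have "inv b \<otimes> c \<otimes> b = (inv b \<otimes> a \<otimes> inv (inv b)) [^] (2 ^ m :: int)"
    unfolding c_int using conj_int_pow[OF inv_closed[OF ab(2)] ab(1), of "2 ^ m"] ab by simp
  also have "\<dots> = (a \<otimes> c) [^] (2 ^ m :: int)" using ab conj by simp
  also have "\<dots> = a [^] (2 ^ m :: int) \<otimes> c [^] (2 ^ m :: int)"
    by (rule int_pow_mult_distrib[OF ac ab(1) c])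
  also have "c [^] (2 ^ m :: int) = \<one>"
  proof -
    obtain i where i: "m = Suc i" using m by (cases m) auto
    have "c [^] (2 :: int) = \<one>" using int_pow_mult[OF c, of 1 1] c cc by simp
    then show ?thesis using int_pow_pow[OF c, of 2 "2 ^ i"] by (simp add: i)
  qed
  also have "a [^] (2 ^ m :: int) \<otimes> \<one> = c" using c by (simp add: c_int[symmetric])
  finally have "inv b \<otimes> c \<otimes> b = c" .
  then have "b \<otimes> (inv b \<otimes> c \<otimes> b) = b \<otimes> c" by simp
  then have bc: "b \<otimes> c = c \<otimes> b" using ab(2) c by (simp add: m_assoc[symmetric])
  show ?thesis
  proof
    show "b \<otimes> a = a \<otimes> b \<otimes> c" by (rule conj_relation[OF ab c conj bc cc])
    show "a [^] (2 ^ m :: int) = c [^] (1 :: int)" using c by (simp add: c_int[symmetric])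
    show "b [^] (2 :: int) = c [^] \<beta>" using b2 int_pow_int[of G b 2] by simp
  qed (use m ab c ac bc cc in auto)
qed

lemma (in presentation) cls_conj:
  assumes "u \<in> words S" "v \<in> words S"
  shows "cls (word_conj u v) = inv\<^bsub>P\<^esub> cls v \<otimes>\<^bsub>P\<^esub> cls u \<otimes>\<^bsub>P\<^esub> cls v"
proof -
  interpret group P by (rule group_P)
  have "word_inv v \<in> words S" "u @ v \<in> words S" using assms word_inv_words by auto
  then show ?thesis
    unfolding word_conj_def using assms by (simp only: cls_append cls_inv m_assoc inv_closed cls_closed)
qed

lemma (in presentation) cls_comm:
  assumes "u \<in> words S" "v \<in> words S"
  shows "cls (word_comm u v) = inv\<^bsub>P\<^esub> cls u \<otimes>\<^bsub>P\<^esub> (inv\<^bsub>P\<^esub> cls v \<otimes>\<^bsub>P\<^esub> (cls u \<otimes>\<^bsub>P\<^esub> cls v))"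
proof -
  have "word_inv v \<in> words S" "word_inv u \<in> words S" "u @ v \<in> words S" "word_inv v @ (u @ v) \<in> words S"
    using assms word_inv_words by auto
  then show ?thesis
    unfolding word_comm_def using assms by (simp only: cls_append cls_inv)
qed

lemma word_closed_simps:
  "word_conj u v \<in> words S \<longleftrightarrow> u \<in> words S \<and> v \<in> words S"
  "word_comm u v \<in> words S \<longleftrightarrow> u \<in> words S \<and> v \<in> words S"
  "word_inv u \<in> words S \<longleftrightarrow> u \<in> words S"
  by (auto simp: word_conj_def word_comm_def word_inv_def)

text \<open>Covers \<open>M2 (m + 1) 1\<close>, \<open>D8\<close> and \<open>Q8\<close> at once. For
  \<open>m = 1\<close> inverting \<open>a\<close> is the same as raising it to
  \<open>1 + 2 ^ m = 3\<close>; \<open>\<beta>\<close> separates \<open>b ^ 2 = 1\<close> from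
  \<open>b ^ 2 = a ^ 2 ^ m\<close>.\<close>

lemma cyclic_presentation_param:
  assumes m: "m \<ge> 1" and \<beta>: "\<beta> = 0 \<or> \<beta> = 1"
    and R: "\<And>u v. (u, v) \<in> R \<Longrightarrow> heis_eq m 1 \<beta> (word_val u) (word_val v)"
    and R1: "(gen_pow GA (2 ^ (m + 1)), []) \<in> R"
    and R2: "(gen_pow GB 2, if \<beta> = 0 then [] else gen_pow GA (2 ^ m)) \<in> R"
    and R3: "(word_conj (gen_pow GA 1) (gen_pow GB 1), gen_pow GA (1 + 2 ^ m)) \<in> R \<or>
      m = 1 \<and> (word_conj (gen_pow GA 1) (gen_pow GB 1), word_inv (gen_pow GA 1)) \<in> R"
  shows "\<exists>\<theta>. heis_param (presented_group {GA, GB} R) m 1 \<beta> \<theta>"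
proof -
  interpret pr: presentation "{GA, GB}" R .
  interpret group pr.P by (rule pr.group_P)
  define a b where "a = pr.cls [(GA, True)]" and "b = pr.cls [(GB, True)]"
  define c where "c = a [^]\<^bsub>pr.P\<^esub> (2 ^ m :: nat)"
  have ab: "a \<in> carrier pr.P" "b \<in> carrier pr.P" by (simp_all add: a_def b_def)
  have gp: "gen_pow GA k \<in> words {GA, GB}" "gen_pow GB k \<in> words {GA, GB}" for k
    by (simp_all only: pr.gen_pow_words insertI1 insertI2)
  have pa: "pr.cls (gen_pow GA k) = a [^]\<^bsub>pr.P\<^esub> k" and pb: "pr.cls (gen_pow GB k) = b [^]\<^bsub>pr.P\<^esub> k" for k
    by (simp_all add: pr.cls_gen_pow a_def b_def)
  have a1: "a [^]\<^bsub>pr.P\<^esub> (2 ^ (m + 1) :: nat) = \<one>\<^bsub>pr.P\<^esub>"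
    unfolding pa[symmetric] pr.one_P by (rule pr.cls_relation[OF R1 gp(1)]) simp
  have c: "c \<in> carrier pr.P" using ab by (simp add: c_def)
  have b2: "b [^]\<^bsub>pr.P\<^esub> (2 :: nat) = c [^]\<^bsub>pr.P\<^esub> \<beta>"
  proof -
    have "pr.cls (gen_pow GB 2) = pr.cls (if \<beta> = 0 then [] else gen_pow GA (2 ^ m))"
      by (rule pr.cls_relation[OF R2 gp(2)]) (use gp in auto)
    then show ?thesis using \<beta> c by (auto simp: pa pb pr.one_P[symmetric] c_def)
  qed
  have cj: "pr.cls (word_conj (gen_pow GA 1) (gen_pow GB 1)) = inv\<^bsub>pr.P\<^esub> b \<otimes>\<^bsub>pr.P\<^esub> a \<otimes>\<^bsub>pr.P\<^esub> b"
    using ab unfolding pr.cls_conj[OF gp] pa pb by simp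
  have conj: "inv\<^bsub>pr.P\<^esub> b \<otimes>\<^bsub>pr.P\<^esub> a \<otimes>\<^bsub>pr.P\<^esub> b = a \<otimes>\<^bsub>pr.P\<^esub> c"
    using R3
  proof
    assume "(word_conj (gen_pow GA 1) (gen_pow GB 1), gen_pow GA (1 + 2 ^ m)) \<in> R"
    then have "pr.cls (word_conj (gen_pow GA 1) (gen_pow GB 1)) = pr.cls (gen_pow GA (1 + 2 ^ m))"
      by (rule pr.cls_relation) (use gp in \<open>auto simp only: word_closed_simps\<close>)
    also have "\<dots> = a \<otimes>\<^bsub>pr.P\<^esub> c"
      unfolding pa c_def using nat_pow_mult[OF ab(1), of 1 "2 ^ m"] ab by simp
    finally show ?thesis unfolding cj .
  next
    assume *: "m = 1 \<and> (word_conj (gen_pow GA 1) (gen_pow GB 1), word_inv (gen_pow GA 1)) \<in> R"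
    then have "pr.cls (word_conj (gen_pow GA 1) (gen_pow GB 1)) = pr.cls (word_inv (gen_pow GA 1))"
      by (intro pr.cls_relation) (use gp in \<open>auto simp only: word_closed_simps\<close>)
    also have "\<dots> = inv\<^bsub>pr.P\<^esub> a"
      unfolding pr.cls_inv[OF gp(1)] pa using ab by simp
    also have "\<dots> = a \<otimes>\<^bsub>pr.P\<^esub> c"
    proof (rule inv_equality)
      have "a \<otimes>\<^bsub>pr.P\<^esub> c \<otimes>\<^bsub>pr.P\<^esub> a = a [^]\<^bsub>pr.P\<^esub> (1 :: nat) \<otimes>\<^bsub>pr.P\<^esub> a [^]\<^bsub>pr.P\<^esub> (2 :: nat) \<otimes>\<^bsub>pr.P\<^esub> a [^]\<^bsub>pr.P\<^esub> (1 :: nat)"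
        using ab * by (simp add: c_def)
      also have "\<dots> = a [^]\<^bsub>pr.P\<^esub> (1 + 2 + 1 :: nat)" using ab by (simp only: nat_pow_mult)
      also have "(1 + 2 + 1 :: nat) = 2 ^ (m + 1)" using * by simp
      also note a1
      finally show "a \<otimes>\<^bsub>pr.P\<^esub> c \<otimes>\<^bsub>pr.P\<^esub> a = \<one>\<^bsub>pr.P\<^esub>" .
    qed (use ab c in auto)
    finally show ?thesis unfolding cj .
  qed
  have "heis_relations pr.P m 1 \<beta> (pr.cls [(GA, True)]) (pr.cls [(GB, True)]) c"
    using cyclic_heis_relations[OF m ab a1 c_def b2 conj] by (simp only: a_def b_def)
  then show ?thesis by (intro presented_heis_param[of _ R m 1 \<beta> c, OF _ R]) auto
qed

lemma heis_eqI:
  assumes "x' = x + 2 ^ N * p" "y' = y + 2 * q" "even (z' - z - \<alpha> * p - \<beta> * q)"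
  shows "heis_eq N \<alpha> \<beta> (x, y, z) (x', y', z')"
  using assms by auto

lemma M2_param:
  assumes m: "m \<ge> 1"
  shows "\<exists>\<theta>. heis_param (M2 (m + 1) 1) m 1 0 \<theta>"
  unfolding M2_def
proof (rule cyclic_presentation_param[OF m])
  fix u v
  assume "(u, v) \<in> {(gen_pow GA (2 ^ (m + 1)), []), (gen_pow GB (2 ^ 1), []),
    (word_conj (gen_pow GA 1) (gen_pow GB 1), gen_pow GA (1 + 2 ^ (m + 1 - 1)))}"
  \<comment> \<open>One pair \<open>p\<close>, \<open>q\<close> per relation: the numbers of factors
    \<open>a ^ 2 ^ m\<close> and \<open>b ^ 2\<close> by which its sides differ.\<close>
  then show "heis_eq m 1 0 (word_val u) (word_val v)"
    by (elim insertE emptyE)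
      (auto simp: word_conj_def word_inv_def gen_pow_one
        intro: heis_eqI[where p = "- 2" and q = 0] heis_eqI[where p = 0 and q = "- 1"] heis_eqI[where p = 1 and q = 0]
        simp del: heis_eq.simps)
qed auto

lemma D8_param: "\<exists>\<theta>. heis_param D8 1 1 0 \<theta>"
  unfolding D8_def
proof (rule cyclic_presentation_param)
  fix u v
  assume "(u, v) \<in> {(gen_pow GA 4, []), (gen_pow GB 2, []),
     (word_conj (gen_pow GA 1) (gen_pow GB 1), word_inv (gen_pow GA 1))}"
  then show "heis_eq 1 1 0 (word_val u) (word_val v)"
    by (elim insertE emptyE)
      (auto simp: word_conj_def word_inv_def gen_pow_one
        intro: heis_eqI[where p = "- 2" and q = 0] heis_eqI[where p = 0 and q = "- 1"] heis_eqI[where p = "- 1" and q = 0]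
        simp del: heis_eq.simps)
qed auto

lemma Q8_param: "\<exists>\<theta>. heis_param Q8 1 1 1 \<theta>"
  unfolding Q8_def
proof (rule cyclic_presentation_param)
  fix u v
  assume "(u, v) \<in> {(gen_pow GA 4, []), (gen_pow GB 2, gen_pow GA 2),
     (word_conj (gen_pow GA 1) (gen_pow GB 1), word_inv (gen_pow GA 1))}"
  then show "heis_eq 1 1 1 (word_val u) (word_val v)"
    by (elim insertE emptyE)
      (auto simp: word_conj_def word_inv_def gen_pow_one
        intro: heis_eqI[where p = "- 2" and q = 0] heis_eqI[where p = 1 and q = "- 1"] heis_eqI[where p = "- 1" and q = 0]
        simp del: heis_eq.simps)
qed auto

text \<open>The commutator is the separate generator \<open>GD\<close>, and \<open>a ^ 2 ^ w\<close>
  and \<open>b ^ 2\<close> are trivial, whence \<open>\<alpha> = \<beta> = 0\<close>. The commutator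
  word has central exponent -1, which is 1 modulo 2.\<close>

lemma M2_11_param:
  assumes w: "w \<ge> 1"
  shows "\<exists>\<theta>. heis_param (M2_11 w) w 0 0 \<theta>"
proof -
  define R :: "(gen word \<times> gen word) set" where "R = {(gen_pow GA (2 ^ w), []), (gen_pow GB 2, []), (gen_pow GD 2, []),
     (word_comm (gen_pow GA 1) (gen_pow GB 1), gen_pow GD 1),
     (word_comm (gen_pow GD 1) (gen_pow GA 1), []),
     (word_comm (gen_pow GD 1) (gen_pow GB 1), [])}"
  have R_heis: "heis_eq w 0 0 (word_val u) (word_val v)" if "(u, v) \<in> R" for u v
    using that unfolding R_def
    by (elim insertE emptyE)
      (auto simp: word_comm_def word_inv_def gen_pow_one
        intro: heis_eqI[where p = "- 1" and q = 0] heis_eqI[where p = 0 and q = "- 1"] heis_eqI[where p = 0 and q = 0]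
        simp del: heis_eq.simps)
  interpret pr: presentation "{GA, GB, GD}" R .
  interpret group pr.P by (rule pr.group_P)
  define a b c where "a = pr.cls [(GA, True)]" and "b = pr.cls [(GB, True)]" and "c = pr.cls [(GD, True)]"
  have abc: "a \<in> carrier pr.P" "b \<in> carrier pr.P" "c \<in> carrier pr.P" by (simp_all add: a_def b_def c_def)
  have gp: "gen_pow GA k \<in> words {GA, GB, GD}" "gen_pow GB k \<in> words {GA, GB, GD}"
      "gen_pow GD k \<in> words {GA, GB, GD}" for k
    by (simp_all only: pr.gen_pow_words insertI1 insertI2)
  have pw: "pr.cls (gen_pow GA k) = a [^]\<^bsub>pr.P\<^esub> k" "pr.cls (gen_pow GB k) = b [^]\<^bsub>pr.P\<^esub> k"
      "pr.cls (gen_pow GD k) = c [^]\<^bsub>pr.P\<^esub> k" for k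
    by (simp_all add: pr.cls_gen_pow a_def b_def c_def)
  have rel: "pr.cls u = pr.cls v" if uv: "(u, v) \<in> R" for u v
  proof -
    have "u \<in> words {GA, GB, GD} \<and> v \<in> words {GA, GB, GD}"
      using uv unfolding R_def insert_iff prod.inject empty_iff
      by (elim disjE conjE FalseE) (simp_all only: word_closed_simps gp lists.Nil simp_thms)
    then show ?thesis using pr.cls_relation[OF uv] by blast
  qed
  have comm: "g \<otimes>\<^bsub>pr.P\<^esub> h = h \<otimes>\<^bsub>pr.P\<^esub> (g \<otimes>\<^bsub>pr.P\<^esub> k)"
    if "inv\<^bsub>pr.P\<^esub> g \<otimes>\<^bsub>pr.P\<^esub> (inv\<^bsub>pr.P\<^esub> h \<otimes>\<^bsub>pr.P\<^esub> (g \<otimes>\<^bsub>pr.P\<^esub> h)) = k"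
      "g \<in> carrier pr.P" "h \<in> carrier pr.P" for g h k
    unfolding that(1)[symmetric] using that(2,3) by (simp add: m_assoc[symmetric])
  have a1: "a [^]\<^bsub>pr.P\<^esub> (2 ^ w :: nat) = \<one>\<^bsub>pr.P\<^esub>" and b2: "b [^]\<^bsub>pr.P\<^esub> (2 :: nat) = \<one>\<^bsub>pr.P\<^esub>"
    and c2: "c [^]\<^bsub>pr.P\<^esub> (2 :: nat) = \<one>\<^bsub>pr.P\<^esub>"
    unfolding pw[symmetric] pr.one_P by (rule rel, simp add: R_def)+
  have "pr.cls (word_comm (gen_pow GA 1) (gen_pow GB 1)) = pr.cls (gen_pow GD 1)"
    by (rule rel) (simp add: R_def)
  then have ab: "a \<otimes>\<^bsub>pr.P\<^esub> b = b \<otimes>\<^bsub>pr.P\<^esub> (a \<otimes>\<^bsub>pr.P\<^esub> c)"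
    unfolding pr.cls_comm[OF gp(1,2)] pw by (intro comm) (use abc in auto)
  have "pr.cls (word_comm (gen_pow GD 1) (gen_pow GA 1)) = pr.cls []"
    by (rule rel) (simp add: R_def)
  then have ca: "c \<otimes>\<^bsub>pr.P\<^esub> a = a \<otimes>\<^bsub>pr.P\<^esub> (c \<otimes>\<^bsub>pr.P\<^esub> \<one>\<^bsub>pr.P\<^esub>)"
    unfolding pr.cls_comm[OF gp(3,1)] pw pr.one_P by (intro comm) (use abc in auto)
  have "pr.cls (word_comm (gen_pow GD 1) (gen_pow GB 1)) = pr.cls []"
    by (rule rel) (simp add: R_def)
  then have cb: "c \<otimes>\<^bsub>pr.P\<^esub> b = b \<otimes>\<^bsub>pr.P\<^esub> (c \<otimes>\<^bsub>pr.P\<^esub> \<one>\<^bsub>pr.P\<^esub>)"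
    unfolding pr.cls_comm[OF gp(3,2)] pw pr.one_P by (intro comm) (use abc in auto)
  have cc: "c \<otimes>\<^bsub>pr.P\<^esub> c = \<one>\<^bsub>pr.P\<^esub>" using c2 abc by (simp add: numeral_2_eq_2)
  have "heis_relations pr.P w 0 0 a b c"
  proof
    have "a \<otimes>\<^bsub>pr.P\<^esub> b \<otimes>\<^bsub>pr.P\<^esub> c = b \<otimes>\<^bsub>pr.P\<^esub> a \<otimes>\<^bsub>pr.P\<^esub> (c \<otimes>\<^bsub>pr.P\<^esub> c)"
      unfolding ab using abc by (simp add: m_assoc)
    then show "b \<otimes>\<^bsub>pr.P\<^esub> a = a \<otimes>\<^bsub>pr.P\<^esub> b \<otimes>\<^bsub>pr.P\<^esub> c" using cc abc by simp
    show "a [^]\<^bsub>pr.P\<^esub> (2 ^ w :: int) = c [^]\<^bsub>pr.P\<^esub> (0 :: int)"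
      using a1 int_pow_int[of pr.P a "2 ^ w"] by simp
    show "b [^]\<^bsub>pr.P\<^esub> (2 :: int) = c [^]\<^bsub>pr.P\<^esub> (0 :: int)"
      using b2 int_pow_int[of pr.P b 2] by simp
  qed (use w abc ca cb cc in auto)
  then have rels: "heis_relations pr.P w 0 0 (pr.cls [(GA, True)]) (pr.cls [(GB, True)]) c"
    by (simp only: a_def b_def)
  have eq: "M2_11 w = pr.P" by (simp add: M2_11_def R_def)
  show ?thesis
    unfolding eq by (rule presented_heis_param[OF _ R_heis rels]) (simp_all add: c_def)
qed

subsection \<open>Central products\<close>

lemma heis_paramD:
  assumes "heis_param G N \<alpha> \<beta> \<theta>"
  shows "group G" "N \<ge> 1" "\<theta> x y z \<in> carrier G"
    "\<theta> x y z \<otimes>\<^bsub>G\<^esub> \<theta> x' y' z' = \<theta> (x + x') (y + y') (z + z' + y * x')"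
    "\<theta> x y z = \<theta> x' y' z' \<longleftrightarrow> heis_eq N \<alpha> \<beta> (x, y, z) (x', y', z')"
    "g \<in> carrier G \<Longrightarrow> \<exists>x y z. g = \<theta> x y z"
  using assms unfolding heis_param_def by blast+

lemma heis_param_one:
  assumes h: "heis_param G N \<alpha> \<beta> \<theta>"
  shows "\<one>\<^bsub>G\<^esub> = \<theta> 0 0 0"
proof -
  interpret group G by (rule heis_paramD(1)[OF h])
  have "\<theta> 0 0 0 \<otimes>\<^bsub>G\<^esub> \<theta> 0 0 0 = \<theta> 0 0 0" by (simp add: heis_paramD(4)[OF h])
  then show ?thesis using heis_paramD(3)[OF h] by (metis r_cancel_one')
qed

lemma heis_param_inv:
  assumes h: "heis_param G N \<alpha> \<beta> \<theta>"
  shows "inv\<^bsub>G\<^esub> \<theta> x y z = \<theta> (- x) (- y) (- z + y * x)"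
proof -
  interpret group G by (rule heis_paramD(1)[OF h])
  have "\<theta> (- x) (- y) (- z + y * x) \<otimes>\<^bsub>G\<^esub> \<theta> x y z = \<one>\<^bsub>G\<^esub>"
    by (simp add: heis_paramD(4)[OF h] heis_param_one[OF h])
  then show ?thesis using heis_paramD(3)[OF h] by (intro inv_equality)
qed

lemma heis_param_center:
  assumes h: "heis_param G N \<alpha> \<beta> \<theta>"
  shows "\<theta> 0 0 z = (if even z then \<theta> 0 0 0 else \<theta> 0 0 1)" "\<theta> 0 0 1 \<noteq> \<theta> 0 0 0"
  unfolding if_distrib by (auto simp: heis_paramD(5)[OF h] intro!: exI[of _ 0])

text \<open>Commutators have only a central coordinate, and that of \<open>\<theta> 0 1 0\<close>
  and \<open>\<theta> 1 0 0\<close> is 1. This makes the elements used in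
  \<open>derived_identifications\<close> explicit.\<close>

lemma heis_param_derived:
  assumes h: "heis_param G N \<alpha> \<beta> \<theta>"
  shows "derived G (carrier G) - {\<one>\<^bsub>G\<^esub>} = {\<theta> 0 0 1}"
proof -
  interpret group G by (rule heis_paramD(1)[OF h])
  let ?c = "\<theta> 0 0 1"
  note mult = heis_paramD(4)[OF h] and inv = heis_param_inv[OF h] and one = heis_param_one[OF h]
  have comm: "g \<otimes>\<^bsub>G\<^esub> k \<otimes>\<^bsub>G\<^esub> inv\<^bsub>G\<^esub> g \<otimes>\<^bsub>G\<^esub> inv\<^bsub>G\<^esub> k \<in> {\<one>\<^bsub>G\<^esub>, ?c}"
    if gk: "g \<in> carrier G" "k \<in> carrier G" for g k
  proof -
    obtain x y z x' y' z' where "g = \<theta> x y z" "k = \<theta> x' y' z'"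
      using heis_paramD(6)[OF h gk(1)] heis_paramD(6)[OF h gk(2)] by blast
    then have "\<exists>w. g \<otimes>\<^bsub>G\<^esub> k \<otimes>\<^bsub>G\<^esub> inv\<^bsub>G\<^esub> g \<otimes>\<^bsub>G\<^esub> inv\<^bsub>G\<^esub> k = \<theta> 0 0 w"
      by (simp add: mult inv) blast
    then show ?thesis using heis_param_center(1)[OF h] one by (metis insert_iff)
  qed
  have "generate G (derived_set G (carrier G)) \<subseteq> {\<one>\<^bsub>G\<^esub>, ?c}"
  proof
    fix g assume "g \<in> generate G (derived_set G (carrier G))"
    then show "g \<in> {\<one>\<^bsub>G\<^esub>, ?c}"
    proof induction
      case (incl g)
      then show ?case using comm by auto
    next
      case (inv g)
      then have "g \<in> {\<one>\<^bsub>G\<^esub>, ?c}" using comm by auto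
      moreover have "inv\<^bsub>G\<^esub> ?c = ?c"
        using heis_param_center(1)[OF h, of "- 1"] by (simp add: heis_param_inv[OF h])
      ultimately show ?case by auto
    next
      case (eng g k)
      moreover have "?c \<otimes>\<^bsub>G\<^esub> ?c = \<one>\<^bsub>G\<^esub>"
        using heis_param_center(1)[OF h, of 2] by (simp add: mult one)
      ultimately show ?case using heis_paramD(3)[OF h, of 0 0 1] by auto
    qed simp
  qed
  moreover have "?c \<in> generate G (derived_set G (carrier G))"
  proof (rule generate.incl)
    have "\<theta> 0 1 0 \<otimes>\<^bsub>G\<^esub> \<theta> 1 0 0 \<otimes>\<^bsub>G\<^esub> inv\<^bsub>G\<^esub> \<theta> 0 1 0 \<otimes>\<^bsub>G\<^esub> inv\<^bsub>G\<^esub> \<theta> 1 0 0 = \<theta> 0 0 1"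
      by (simp add: mult inv)
    then show "?c \<in> derived_set G (carrier G)"
      using heis_paramD(3)[OF h] by (metis (no_types, lifting) UN_iff singletonI)
  qed
  ultimately show ?thesis
    using heis_param_center(2)[OF h] one unfolding derived_def by auto
qed

text \<open>The coordinates \<open>x\<close>, \<open>y\<close> of the factors are kept apart; their central parts are merged in \<open>z\<close>.\<close>

locale central_heis = group G for G (structure) +
  fixes k :: nat and N :: "nat \<Rightarrow> nat" and \<alpha> \<beta> :: "nat \<Rightarrow> int"
    and \<Theta> :: "(nat \<Rightarrow> int) \<Rightarrow> (nat \<Rightarrow> int) \<Rightarrow> int \<Rightarrow> 'a"
  assumes Theta_closed [simp]: "\<Theta> x y z \<in> carrier G"
    and Theta_surj: "g \<in> carrier G \<Longrightarrow> \<exists>x y z. g = \<Theta> x y z"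
    and Theta_mult: "\<Theta> x y z \<otimes> \<Theta> x' y' z'
      = \<Theta> (\<lambda>i. x i + x' i) (\<lambda>i. y i + y' i) (z + z' + (\<Sum>i<k. y i * x' i))"
    and Theta_eq: "\<Theta> x y z = \<Theta> x' y' z' \<longleftrightarrow> (\<exists>p q. (\<forall>i<k. x' i = x i + 2 ^ N i * p i \<and> y' i = y i + 2 * q i)
      \<and> even (z' - z - (\<Sum>i<k. \<alpha> i * p i + \<beta> i * q i)))"

text \<open>The subgroup divided out consists of central tuples with even total exponent. So the
  coordinates of the factors survive, while of the central exponents only the sum modulo 2
  remains.\<close>

theorem central_product_heis:
  fixes G :: "('a, 'b) monoid_scheme" and Gs :: "('x, 'c) monoid_scheme list"
  assumes "group G" and iso: "G \<cong> central_product Gs" and "Gs \<noteq> []"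
    and params: "\<And>i. i < length Gs \<Longrightarrow> heis_param (Gs ! i) (N i) (\<alpha> i) (\<beta> i) (\<theta> i)"
  shows "\<exists>\<Theta>. central_heis G (length Gs) N \<alpha> \<beta> \<Theta>"
proof -
  interpret G: group G by fact
  define k where "k = length Gs"
  define D where "D = direct_product Gs"
  have k: "0 < k" using assms(3) by (simp add: k_def)
  note par = params[folded k_def]
  have D_eq: "D = product_group {..<k} (\<lambda>i. Gs ! i)" by (simp add: D_def direct_product_def k_def)
  interpret D: group D unfolding D_eq using heis_paramD(1)[OF par] by (intro product_group) auto
  define T where "T x y z = (\<lambda>i\<in>{..<k}. \<theta> i (x i) (y i) (z i))" for x y z :: "nat \<Rightarrow> int"
  have T_closed: "T x y z \<in> carrier D" for x y z
    using heis_paramD(3)[OF par] by (auto simp: D_eq T_def)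
  have T_mult: "T x y z \<otimes>\<^bsub>D\<^esub> T x' y' z'
      = T (\<lambda>i. x i + x' i) (\<lambda>i. y i + y' i) (\<lambda>i. z i + z' i + y i * x' i)" for x y z x' y' z'
    using heis_paramD(4)[OF par] by (auto simp: D_eq T_def fun_eq_iff)
  have T_surj: "\<exists>x y z. d = T x y z" if d: "d \<in> carrier D" for d
  proof -
    have "\<forall>i\<in>{..<k}. \<exists>v. d i = \<theta> i (fst v) (fst (snd v)) (snd (snd v))"
      using d heis_paramD(6)[OF par] by (fastforce simp: D_eq)
    then obtain v where "\<forall>i\<in>{..<k}. d i = \<theta> i (fst (v i)) (fst (snd (v i))) (snd (snd (v i)))"
      by (metis (no_types, lifting) bchoice)
    then have "d = T (\<lambda>i. fst (v i)) (\<lambda>i. fst (snd (v i))) (\<lambda>i. snd (snd (v i)))"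
      using d by (auto simp: D_eq T_def fun_eq_iff PiE_def extensional_def)
    then show ?thesis by blast
  qed
  have T_eq: "T x y z = T x' y' z' \<longleftrightarrow> (\<forall>i<k. heis_eq (N i) (\<alpha> i) (\<beta> i) (x i, y i, z i) (x' i, y' i, z' i))"
    for x y z x' y' z'
    unfolding T_def using heis_paramD(5)[OF par] by (auto simp: fun_eq_iff)
  define nul :: "nat \<Rightarrow> int" where "nul = (\<lambda>_. 0)"
  have T_one: "\<one>\<^bsub>D\<^esub> = T nul nul nul"
    using heis_param_one[OF par] by (auto simp: D_eq T_def fun_eq_iff nul_def)
  have T_central: "T nul nul z \<otimes>\<^bsub>D\<^esub> d = d \<otimes>\<^bsub>D\<^esub> T nul nul z" if "d \<in> carrier D" for d z
    using T_surj[OF that] by (auto simp: T_mult nul_def add.commute)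
  have T_parity: "T nul nul z = T nul nul z'" if "\<And>i. i < k \<Longrightarrow> even (z' i - z i)" for z z'
    unfolding T_eq using that by (auto intro!: exI[of _ 0])
  \<comment> \<open>Central exponent \<open>n\<close> in factor \<open>j\<close> alone; the
    identified elements are those with exponents \<open>e i 1 + e j 1\<close>.\<close>
  define e :: "nat \<Rightarrow> int \<Rightarrow> nat \<Rightarrow> int" where "e j n = (\<lambda>i. if i = j then n else 0)" for j n
  define K where "K = derived_identifications Gs"
  define Z where "Z = generate D K"
  have K_closed: "K \<subseteq> carrier D" by (auto simp: K_def derived_identifications_def D_def)
  have der: "derived (Gs ! i) (carrier (Gs ! i)) - {\<theta> i 0 0 0} = {\<theta> i 0 0 1}" if "i < k" for i
    using heis_param_derived[OF par[OF that]] heis_param_one[OF par[OF that]] by simp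
  have K_mem: "d \<in> K \<longleftrightarrow> (\<exists>i<k. \<exists>j<k. i \<noteq> j \<and> d = T nul nul (\<lambda>l. e i 1 l + e j 1 l))" for d
  proof -
    have "d \<in> K \<longleftrightarrow> d \<in> carrier D \<and> (\<exists>i<k. \<exists>j<k. i \<noteq> j \<and> d i = \<theta> i 0 0 1 \<and> d j = \<theta> j 0 0 1 \<and>
        (\<forall>l<k. l \<noteq> i \<longrightarrow> l \<noteq> j \<longrightarrow> d l = \<theta> l 0 0 0))"
      unfolding K_def derived_identifications_def k_def[symmetric] D_def[symmetric]
      by (simp add: der heis_param_one[OF par] del: Diff_iff cong: conj_cong)
    also have "\<dots> \<longleftrightarrow> (\<exists>i<k. \<exists>j<k. i \<noteq> j \<and> d = T nul nul (\<lambda>l. e i 1 l + e j 1 l))"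
    proof -
      have "(d \<in> carrier D \<and> d i = \<theta> i 0 0 1 \<and> d j = \<theta> j 0 0 1 \<and>
          (\<forall>l<k. l \<noteq> i \<longrightarrow> l \<noteq> j \<longrightarrow> d l = \<theta> l 0 0 0)) \<longleftrightarrow> d = T nul nul (\<lambda>l. e i 1 l + e j 1 l)"
        if ij: "i < k" "j < k" "i \<noteq> j" for i j
      proof
        assume "d = T nul nul (\<lambda>l. e i 1 l + e j 1 l)"
        then show "d \<in> carrier D \<and> d i = \<theta> i 0 0 1 \<and> d j = \<theta> j 0 0 1 \<and>
          (\<forall>l<k. l \<noteq> i \<longrightarrow> l \<noteq> j \<longrightarrow> d l = \<theta> l 0 0 0)"
          using T_closed ij by (simp add: T_def e_def nul_def)
      next
        assume *: "d \<in> carrier D \<and> d i = \<theta> i 0 0 1 \<and> d j = \<theta> j 0 0 1 \<and>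
          (\<forall>l<k. l \<noteq> i \<longrightarrow> l \<noteq> j \<longrightarrow> d l = \<theta> l 0 0 0)"
        show "d = T nul nul (\<lambda>l. e i 1 l + e j 1 l)"
        proof
          fix l
          show "d l = T nul nul (\<lambda>l. e i 1 l + e j 1 l) l"
          proof (cases "l < k")
            case True
            then show ?thesis using * ij by (cases "l = i"; cases "l = j") (auto simp: T_def e_def nul_def)
          next
            case False
            then show ?thesis using * by (auto simp: T_def D_eq PiE_def extensional_def)
          qed
        qed
      qed
      then show ?thesis by blast
    qed
    finally show ?thesis .
  qed
  have Z_sub: "subgroup Z D" unfolding Z_def by (rule D.generate_is_subgroup[OF K_closed])
  \<comment> \<open>Parity of the total central exponent is the invariant that keeps the common
    commutator from becoming trivial.\<close>
  have Z_even: "\<exists>z. d = T nul nul z \<and> even (\<Sum>i<k. z i)" if "d \<in> Z" for d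
    using that unfolding Z_def
  proof induction
    case one
    then show ?case using T_one by (intro exI[of _ nul]) (simp add: nul_def)
  next
    case (incl d)
    then obtain i j where "i < k" "j < k" "d = T nul nul (\<lambda>l. e i 1 l + e j 1 l)" using K_mem by blast
    then show ?case by (intro exI[of _ "\<lambda>l. e i 1 l + e j 1 l"]) (simp add: sum.distrib e_def)
  next
    case (inv d)
    then obtain i j where ij: "i < k" "j < k" "d = T nul nul (\<lambda>l. e i 1 l + e j 1 l)" using K_mem by blast
    have "d \<otimes>\<^bsub>D\<^esub> d = \<one>\<^bsub>D\<^esub>"
      unfolding ij(3) T_mult T_one by (simp add: nul_def) (rule T_parity[unfolded nul_def], simp)
    then have "inv\<^bsub>D\<^esub> d = d" using ij T_closed by (intro D.inv_equality) auto
    then show ?case using ij by (intro exI[of _ "\<lambda>l. e i 1 l + e j 1 l"]) (simp add: sum.distrib e_def)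
  next
    case (eng d d')
    then obtain z z' where "d = T nul nul z" "even (\<Sum>i<k. z i)" "d' = T nul nul z'" "even (\<Sum>i<k. z' i)" by blast
    then show ?case by (intro exI[of _ "\<lambda>i. z i + z' i"]) (simp add: T_mult nul_def sum.distrib)
  qed
  have normal: "Z \<lhd> D"
  proof (rule D.normal_invI[OF Z_sub])
    fix d g assume *: "d \<in> Z" "g \<in> carrier D"
    then obtain z where z: "d = T nul nul z" using Z_even by blast
    have "g \<otimes>\<^bsub>D\<^esub> d \<otimes>\<^bsub>D\<^esub> inv\<^bsub>D\<^esub> g = d \<otimes>\<^bsub>D\<^esub> g \<otimes>\<^bsub>D\<^esub> inv\<^bsub>D\<^esub> g"
      using T_central[OF *(2), of z] by (simp add: z)
    also have "\<dots> = d" using * subgroup.subset[OF Z_sub] by (simp add: D.m_assoc subset_iff)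
    finally show "g \<otimes>\<^bsub>D\<^esub> d \<otimes>\<^bsub>D\<^esub> inv\<^bsub>D\<^esub> g \<in> Z" using * by simp
  qed
  interpret Z: normal Z D by (rule normal)
  have cp: "central_product Gs = D Mod Z"
    by (simp add: central_product_def D_def Z_def K_def)
  obtain \<phi> where \<phi>: "\<phi> \<in> iso (D Mod Z) G"
    using iso group.iso_set_sym[OF \<open>group G\<close>] unfolding cp is_iso_def by blast
  define \<kappa> where "\<kappa> = (\<lambda>d. \<phi> (Z #>\<^bsub>D\<^esub> d))"
  have \<kappa>_hom: "\<kappa> \<in> hom D G"
  proof -
    have "\<phi> \<circ> (\<lambda>d. Z #>\<^bsub>D\<^esub> d) \<in> hom D G"
      using Z.r_coset_hom_Mod \<phi> by (intro hom_compose[of _ D "D Mod Z"]) (auto simp: iso_def)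
    then show ?thesis by (simp add: \<kappa>_def comp_def)
  qed
  interpret \<kappa>: group_hom D G \<kappa> by unfold_locales (rule \<kappa>_hom)
  have \<kappa>_surj: "\<kappa> ` carrier D = carrier G"
  proof -
    have "(\<lambda>d. Z #>\<^bsub>D\<^esub> d) ` carrier D = carrier (D Mod Z)" by (auto simp: FactGroup_def RCOSETS_def)
    from this[symmetric] have "\<kappa> ` carrier D = \<phi> ` carrier (D Mod Z)"
      by (simp only: \<kappa>_def image_image)
    then show ?thesis using \<phi> by (auto simp: iso_def bij_betw_def)
  qed
  have \<kappa>_ker: "d \<in> Z" if d: "d \<in> carrier D" "\<kappa> d = \<one>\<^bsub>G\<^esub>" for d
  proof -
    have "\<kappa> d = \<kappa> \<one>\<^bsub>D\<^esub>" using d by simp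
    moreover have "inj_on \<phi> (carrier (D Mod Z))" using \<phi> by (auto simp: iso_def bij_betw_def)
    moreover have "Z #>\<^bsub>D\<^esub> d \<in> carrier (D Mod Z)" "Z #>\<^bsub>D\<^esub> \<one>\<^bsub>D\<^esub> \<in> carrier (D Mod Z)"
      using d by (auto simp: FactGroup_def RCOSETS_def)
    ultimately have "Z #>\<^bsub>D\<^esub> d = Z #>\<^bsub>D\<^esub> \<one>\<^bsub>D\<^esub>" by (auto simp: \<kappa>_def dest: inj_onD)
    moreover have "d \<in> Z #>\<^bsub>D\<^esub> d" by (rule D.rcos_self[OF d(1) Z_sub])
    moreover have "Z #>\<^bsub>D\<^esub> \<one>\<^bsub>D\<^esub> = Z" using Z.subset by simp
    ultimately show ?thesis by simp
  qed
  have \<kappa>_Z: "\<kappa> d = \<one>\<^bsub>G\<^esub>" if d: "d \<in> Z" for d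
  proof -
    have "Z #>\<^bsub>D\<^esub> d = Z #>\<^bsub>D\<^esub> \<one>\<^bsub>D\<^esub>"
      using d D.coset_join2[OF _ Z_sub d] Z.subset by (simp add: subset_iff)
    then have "\<kappa> d = \<kappa> \<one>\<^bsub>D\<^esub>" by (simp add: \<kappa>_def)
    then show ?thesis by simp
  qed
  \<comment> \<open>Central elements of factor 0 serve as the reference; by \<open>single\<close>
    those of the other factors have the same images.\<close>
  define C where "C n = \<kappa> (T nul nul (e 0 n))" for n
  have C_closed: "C n \<in> carrier G" for n by (simp add: C_def T_closed)
  have C_add: "C (m + n) = C m \<otimes>\<^bsub>G\<^esub> C n" for m n
  proof -
    have "T nul nul (e 0 m) \<otimes>\<^bsub>D\<^esub> T nul nul (e 0 n) = T nul nul (e 0 (m + n))"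
      by (simp add: T_mult nul_def) (rule arg_cong[where f = "T _ _"], auto simp: e_def)
    then show ?thesis unfolding C_def by (metis T_closed \<kappa>.hom_mult)
  qed
  have C_cong: "C m = C n" if "even (m - n)" for m n
    unfolding C_def using that by (intro arg_cong[where f = \<kappa>] T_parity) (auto simp: e_def)
  have C0: "C 0 = \<one>\<^bsub>G\<^esub>"
  proof -
    have "e 0 0 = nul" by (auto simp: e_def nul_def)
    then show ?thesis by (simp add: C_def T_one[symmetric])
  qed
  have single: "\<kappa> (T nul nul (e j n)) = C n" if j: "j < k" for j n
  proof (cases "j = 0 \<or> even n")
    case True
    show ?thesis
    proof (cases "j = 0")
      case False
      then have n: "even n" using True by simp
      have "T nul nul (e j n) = T nul nul nul" by (rule T_parity) (use n in \<open>auto simp: e_def nul_def\<close>)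
      then show ?thesis using C0 C_cong[of n 0] n by (simp add: T_one[symmetric])
    qed (simp add: C_def)
  next
    case False
    have "T nul nul (e j n) \<otimes>\<^bsub>D\<^esub> T nul nul (e 0 n) = T nul nul (\<lambda>l. e j n l + e 0 n l)"
      by (simp add: T_mult nul_def)
    also have "\<dots> = T nul nul (\<lambda>l. e j 1 l + e 0 1 l)" by (rule T_parity) (use False in \<open>auto simp: e_def\<close>)
    also have "\<dots> \<in> Z"
      unfolding Z_def
    proof (rule generate.incl)
      have "j \<noteq> 0" using False by simp
      then show "T nul nul (\<lambda>l. e j 1 l + e 0 1 l) \<in> K" unfolding K_mem using j k by blast
    qed
    finally have "\<kappa> (T nul nul (e j n)) \<otimes>\<^bsub>G\<^esub> C n = \<one>\<^bsub>G\<^esub>"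
      unfolding C_def using \<kappa>_Z T_closed by (metis \<kappa>.hom_mult)
    moreover have "C (n + n) = C 0" by (rule C_cong) simp
    then have "C n \<otimes>\<^bsub>G\<^esub> C n = \<one>\<^bsub>G\<^esub>" by (simp only: C_add C0)
    ultimately have "\<kappa> (T nul nul (e j n)) \<otimes>\<^bsub>G\<^esub> C n = C n \<otimes>\<^bsub>G\<^esub> C n" by simp
    then show ?thesis using C_closed T_closed by (simp add: G.r_cancel)
  qed
  have center: "\<kappa> (T nul nul z) = C (\<Sum>i<k. z i)" for z
  proof -
    have "j \<le> k \<Longrightarrow> \<kappa> (T nul nul (\<lambda>i. if i < j then z i else 0)) = C (\<Sum>i<j. z i)" for j
    proof (induction j)
      case 0
      have "(\<lambda>i. if i < 0 then z i else 0) = nul" by (simp add: nul_def)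
      then show ?case by (simp add: C0 T_one[symmetric])
    next
      case (Suc j)
      have "T nul nul (\<lambda>i. if i < Suc j then z i else 0)
          = T nul nul (\<lambda>i. if i < j then z i else 0) \<otimes>\<^bsub>D\<^esub> T nul nul (e j (z j))"
        by (simp add: T_mult nul_def) (rule arg_cong[where f = "T _ _"], auto simp: e_def)
      then show ?case using Suc single[of j] T_closed by (simp add: C_add)
    qed
    from this[of k] have "\<kappa> (T nul nul (\<lambda>i. if i < k then z i else 0)) = C (\<Sum>i<k. z i)" by simp
    moreover have "T nul nul (\<lambda>i. if i < k then z i else 0) = T nul nul z" by (rule T_parity) simp
    ultimately show ?thesis by simp
  qed
  have split: "\<kappa> (T x y z) = \<kappa> (T x y nul) \<otimes>\<^bsub>G\<^esub> C (\<Sum>i<k. z i)" for x y z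
  proof -
    have "T x y nul \<otimes>\<^bsub>D\<^esub> T nul nul z = T x y z" by (simp add: T_mult nul_def)
    then show ?thesis using center T_closed by (metis \<kappa>.hom_mult)
  qed
  \<comment> \<open>The merged central exponent is stored in factor 0, which exists as
    \<open>Gs\<close> is nonempty.\<close>
  define \<Theta> where "\<Theta> x y z = \<kappa> (T x y (e 0 z))" for x y z
  have sum_e: "(\<Sum>i<k. e 0 z i) = z" for z using k by (simp add: e_def)
  have \<Theta>_split: "\<Theta> x y z = \<kappa> (T x y nul) \<otimes>\<^bsub>G\<^esub> C z" for x y z
    unfolding \<Theta>_def split[of x y "e 0 z"] sum_e ..
  have "central_heis G k N \<alpha> \<beta> \<Theta>"
  proof
    show "\<Theta> x y z \<in> carrier G" for x y z by (simp add: \<Theta>_def T_closed)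
    show "\<exists>x y z. g = \<Theta> x y z" if g: "g \<in> carrier G" for g
    proof -
      obtain d where d: "d \<in> carrier D" "g = \<kappa> d" using g \<kappa>_surj by blast
      obtain x y z where "d = T x y z" using T_surj[OF d(1)] by blast
      then have "g = \<Theta> x y (\<Sum>i<k. z i)" by (simp only: d(2) split[of x y z] \<Theta>_split)
      then show ?thesis by blast
    qed
    show "\<Theta> x y z \<otimes>\<^bsub>G\<^esub> \<Theta> x' y' z'
        = \<Theta> (\<lambda>i. x i + x' i) (\<lambda>i. y i + y' i) (z + z' + (\<Sum>i<k. y i * x' i))" for x y z x' y' z'
    proof -
      have "\<Theta> x y z \<otimes>\<^bsub>G\<^esub> \<Theta> x' y' z' = \<kappa> (T x y (e 0 z) \<otimes>\<^bsub>D\<^esub> T x' y' (e 0 z'))"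
        unfolding \<Theta>_def by (simp add: T_closed)
      also have "\<dots> = \<Theta> (\<lambda>i. x i + x' i) (\<lambda>i. y i + y' i) (z + z' + (\<Sum>i<k. y i * x' i))"
        by (simp only: T_mult split[of _ _ "\<lambda>i. e 0 z i + e 0 z' i + y i * x' i"] \<Theta>_split sum.distrib sum_e)
      finally show ?thesis .
    qed
    show "\<Theta> x y z = \<Theta> x' y' z' \<longleftrightarrow> (\<exists>p q. (\<forall>i<k. x' i = x i + 2 ^ N i * p i \<and> y' i = y i + 2 * q i)
      \<and> even (z' - z - (\<Sum>i<k. \<alpha> i * p i + \<beta> i * q i)))" for x y z x' y' z'
    proof
      assume eq: "\<Theta> x y z = \<Theta> x' y' z'"
      let ?d = "T x y (e 0 z)" and ?d' = "T x' y' (e 0 z')"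
      have "\<kappa> (inv\<^bsub>D\<^esub> ?d \<otimes>\<^bsub>D\<^esub> ?d') = \<one>\<^bsub>G\<^esub>" using eq T_closed by (simp add: \<Theta>_def)
      then have "inv\<^bsub>D\<^esub> ?d \<otimes>\<^bsub>D\<^esub> ?d' \<in> Z" using T_closed by (intro \<kappa>_ker) auto
      then obtain w where w: "inv\<^bsub>D\<^esub> ?d \<otimes>\<^bsub>D\<^esub> ?d' = T nul nul w" "even (\<Sum>i<k. w i)" using Z_even by blast
      then have "?d' = ?d \<otimes>\<^bsub>D\<^esub> T nul nul w" 
        using D.inv_solve_left'[of "T nul nul w" ?d ?d'] T_closed by simp
      then have "T x y (\<lambda>i. e 0 z i + w i) = T x' y' (e 0 z')" by (simp add: T_mult nul_def)
      then have "\<forall>i. \<exists>p q. i < k \<longrightarrow> x' i = x i + 2 ^ N i * p \<and> y' i = y i + 2 * q \<and>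
          even (e 0 z' i - (e 0 z i + w i) - \<alpha> i * p - \<beta> i * q)" unfolding T_eq by simp
      then obtain p q where pq: "\<And>i. i < k \<Longrightarrow> x' i = x i + 2 ^ N i * p i \<and> y' i = y i + 2 * q i \<and>
          even (e 0 z' i - (e 0 z i + w i) - \<alpha> i * p i - \<beta> i * q i)" by metis
      \<comment> \<open>Adding the parity conditions of all factors leaves one condition on the
        merged exponent.\<close>
      have "even (\<Sum>i<k. e 0 z' i - (e 0 z i + w i) - \<alpha> i * p i - \<beta> i * q i)"
        using pq by (intro dvd_sum) simp
      also have "(\<Sum>i<k. e 0 z' i - (e 0 z i + w i) - \<alpha> i * p i - \<beta> i * q i)
          = (z' - z - (\<Sum>i<k. \<alpha> i * p i + \<beta> i * q i)) - (\<Sum>i<k. w i)"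
        by (simp add: sum_subtractf sum.distrib sum_e)
      finally have "even (z' - z - (\<Sum>i<k. \<alpha> i * p i + \<beta> i * q i))" using w(2) by simp
      then show "\<exists>p q. (\<forall>i<k. x' i = x i + 2 ^ N i * p i \<and> y' i = y i + 2 * q i)
        \<and> even (z' - z - (\<Sum>i<k. \<alpha> i * p i + \<beta> i * q i))" using pq by blast
    next
      assume "\<exists>p q. (\<forall>i<k. x' i = x i + 2 ^ N i * p i \<and> y' i = y i + 2 * q i)
        \<and> even (z' - z - (\<Sum>i<k. \<alpha> i * p i + \<beta> i * q i))"
      then obtain p q where pq: "\<forall>i<k. x' i = x i + 2 ^ N i * p i \<and> y' i = y i + 2 * q i"
        "even (z' - z - (\<Sum>i<k. \<alpha> i * p i + \<beta> i * q i))" by blast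
      \<comment> \<open>The central correction caused by reducing the coordinates of factor
        \<open>i\<close>.\<close>
      define w where "w i = \<alpha> i * p i + \<beta> i * q i" for i
      have "T x y (e 0 z) = T x' y' (\<lambda>i. w i + e 0 z i)"
        unfolding T_eq heis_eq.simps
      proof (intro allI impI)
        fix i assume "i < k"
        then show "\<exists>p q. x' i = x i + 2 ^ N i * p \<and> y' i = y i + 2 * q \<and>
            even (w i + e 0 z i - e 0 z i - \<alpha> i * p - \<beta> i * q)"
          using pq(1) by (intro exI[of _ "p i"] exI[of _ "q i"]) (simp add: w_def)
      qed
      then have "\<Theta> x y z = \<kappa> (T x' y' nul) \<otimes>\<^bsub>G\<^esub> C ((\<Sum>i<k. w i) + z)"
        unfolding \<Theta>_def by (simp only: split[of x' y' "\<lambda>i. w i + e 0 z i"] sum.distrib sum_e)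
      also have "C ((\<Sum>i<k. w i) + z) = C z'"
        by (rule C_cong) (use pq(2) in \<open>simp add: w_def algebra_simps\<close>)
      finally show "\<Theta> x y z = \<Theta> x' y' z'" by (simp only: \<Theta>_split)
    qed
  qed
  then show ?thesis unfolding k_def by blast
qed

lemma heis_sum_delta:
  fixes f :: "nat \<Rightarrow> int"
  assumes "j < k"
  shows "(\<Sum>i<k. f i * of_bool (i = j)) = f j" "(\<Sum>i<k. of_bool (i = j) * f i) = f j"
proof -
  have "(\<Sum>i<k. f i * of_bool (i = j)) = (\<Sum>i<k. if i = j then f i else 0)" by (rule sum.cong) auto
  then show 1: "(\<Sum>i<k. f i * of_bool (i = j)) = f j" using assms by simp
  show "(\<Sum>i<k. of_bool (i = j) * f i) = f j" using 1 by (simp only: mult.commute)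
qed

lemma even_mod_diff: "even (w mod 2 - w)" for w :: int
  by presburger

section \<open>Squares, commutators and the quotient by \<open>c\<close> in coordinates\<close>

context central_heis
begin

definition c where "c = \<Theta> (\<lambda>_. 0) (\<lambda>_. 0) 1"

lemma Theta_eqI:
  assumes "\<And>i. i < k \<Longrightarrow> x' i = x i + 2 ^ N i * p i" "\<And>i. i < k \<Longrightarrow> y' i = y i + 2 * q i"
    and "even (z' - z - (\<Sum>i<k. \<alpha> i * p i + \<beta> i * q i))"
  shows "\<Theta> x y z = \<Theta> x' y' z'"
  unfolding Theta_eq by (rule exI[of _ p], rule exI[of _ q]) (use assms in auto)

lemma Theta_cong:
  assumes "\<And>i. i < k \<Longrightarrow> x' i = x i" "\<And>i. i < k \<Longrightarrow> y' i = y i" "even (z' - z)"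
  shows "\<Theta> x y z = \<Theta> x' y' z'"
  by (rule Theta_eqI[where p = "\<lambda>_. 0" and q = "\<lambda>_. 0"]) (use assms in auto)

lemma one_Theta: "\<one> = \<Theta> (\<lambda>_. 0) (\<lambda>_. 0) 0"
proof -
  have "\<Theta> (\<lambda>_. 0) (\<lambda>_. 0) 0 \<otimes> \<Theta> (\<lambda>_. 0) (\<lambda>_. 0) 0 = \<Theta> (\<lambda>_. 0) (\<lambda>_. 0) 0" by (simp add: Theta_mult)
  then show ?thesis using Theta_closed by (metis r_cancel_one')
qed

lemma c_closed: "c \<in> carrier G"
  by (simp add: c_def)

lemma c_square: "c \<otimes> c = \<one>"
  unfolding c_def one_Theta Theta_mult by (rule Theta_cong) auto

lemma Theta_c: "\<Theta> x y z \<otimes> c = \<Theta> x y (z + 1)" "c \<otimes> \<Theta> x y z = \<Theta> x y (z + 1)"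
  by (simp_all add: c_def Theta_mult add.commute)

lemma c_ne: "c \<noteq> \<one>"
proof
  assume "c = \<one>"
  then obtain p q :: "nat \<Rightarrow> int" where pq: "\<forall>i<k. 0 = (0::int) + 2 ^ N i * p i \<and> 0 = (0::int) + 2 * q i"
    and "even (0 - 1 - (\<Sum>i<k. \<alpha> i * p i + \<beta> i * q i))"
    unfolding c_def one_Theta Theta_eq by blast
  moreover from pq have "(\<Sum>i<k. \<alpha> i * p i + \<beta> i * q i) = 0" by (intro sum.neutral) auto
  ultimately show False by simp
qed

text \<open>The commutator is \<open>c\<close> to the power of an alternating bilinear form in the
  coordinates, read modulo 2.\<close>

lemma Theta_commute:
  "\<Theta> x y z \<otimes> \<Theta> x' y' z' = (if even ((\<Sum>i<k. y i * x' i) - (\<Sum>i<k. y' i * x i))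
     then \<Theta> x' y' z' \<otimes> \<Theta> x y z else \<Theta> x' y' z' \<otimes> \<Theta> x y z \<otimes> c)"
proof (cases "even ((\<Sum>i<k. y i * x' i) - (\<Sum>i<k. y' i * x i))")
  case True
  then show ?thesis unfolding if_P[OF True] Theta_mult by (intro Theta_cong) auto
next
  case False
  then show ?thesis unfolding if_not_P[OF False] Theta_mult Theta_c by (intro Theta_cong) auto
qed

lemma commute_or_c:
  assumes "g \<in> carrier G" "h \<in> carrier G"
  shows "g \<otimes> h = h \<otimes> g \<or> g \<otimes> h = h \<otimes> g \<otimes> c"
proof -
  obtain x y z where g: "g = \<Theta> x y z" using Theta_surj[OF assms(1)] by blast
  obtain x' y' z' where h: "h = \<Theta> x' y' z'" using Theta_surj[OF assms(2)] by blast
  show ?thesis unfolding g h Theta_commute[of x y z x' y' z'] by simp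
qed

lemma c_central: "g \<in> carrier G \<Longrightarrow> c \<otimes> g = g \<otimes> c"
  using Theta_surj[of g] by (auto simp: Theta_c)

lemma finite_carrier: "finite (carrier G)"
proof -
  let ?F = "(\<lambda>(x, y, z). \<Theta> x y z) ` ((\<Pi>\<^sub>E i\<in>{..<k}. {0..<2 ^ N i}) \<times> (\<Pi>\<^sub>E i\<in>{..<k}. {0..<2}) \<times> {0, 1})"
  have "carrier G \<subseteq> ?F"
  proof
    fix g assume "g \<in> carrier G"
    then obtain x y z where g: "g = \<Theta> x y z" using Theta_surj by blast
    let ?x = "\<lambda>i\<in>{..<k}. x i mod 2 ^ N i" and ?y = "\<lambda>i\<in>{..<k}. y i mod 2"
    let ?z = "z + (\<Sum>i<k. \<alpha> i * - (x i div 2 ^ N i) + \<beta> i * - (y i div 2))"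
    have "g = \<Theta> ?x ?y ?z"
      unfolding g
      by (rule Theta_eqI[where p = "\<lambda>i. - (x i div 2 ^ N i)" and q = "\<lambda>i. - (y i div 2)"])
        (simp_all add: minus_mult_div_eq_mod)
    also have "\<dots> = \<Theta> ?x ?y (?z mod 2)"
      by (rule Theta_cong) (simp_all only: even_mod_diff)
    finally have "g = \<Theta> ?x ?y (?z mod 2)" .
    moreover have "?z mod 2 \<in> {0, 1}" by auto
    moreover have "?x \<in> (\<Pi>\<^sub>E i\<in>{..<k}. {0..<2 ^ N i})" "?y \<in> (\<Pi>\<^sub>E i\<in>{..<k}. {0..<2})" by auto
    ultimately show "g \<in> ?F" by (intro image_eqI[where x = "(?x, ?y, ?z mod 2)"] SigmaI) simp_all
  qed
  moreover have "finite ?F" by (intro finite_imageI finite_cartesian_product finite_PiE) auto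
  ultimately show ?thesis by (rule finite_subset)
qed

sublocale finite_group G
  by unfold_locales (rule finite_carrier)

lemma Theta_square:
  "\<Theta> x y z \<otimes> \<Theta> x y z = \<Theta> (\<lambda>i. 2 * x i) (\<lambda>i. 2 * y i) (2 * z + (\<Sum>i<k. y i * x i))"
  by (simp only: Theta_mult mult_2)

lemma Theta_kernel:
  "\<Theta> x y z \<in> {\<one>, c} \<longleftrightarrow> (\<forall>i<k. 2 ^ N i dvd x i \<and> even (y i))"
proof
  assume "\<Theta> x y z \<in> {\<one>, c}"
  then have "\<exists>z'. \<Theta> (\<lambda>_. 0) (\<lambda>_. 0) z' = \<Theta> x y z" by (auto simp: one_Theta c_def)
  then show "\<forall>i<k. 2 ^ N i dvd x i \<and> even (y i)" unfolding Theta_eq by auto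
next
  assume "\<forall>i<k. 2 ^ N i dvd x i \<and> even (y i)"
  then have "\<forall>i. \<exists>p q. i < k \<longrightarrow> x i = 2 ^ N i * p \<and> y i = 2 * q" unfolding dvd_def by blast
  then obtain p q where pq: "\<And>i. i < k \<Longrightarrow> x i = 2 ^ N i * p i \<and> y i = 2 * q i" by metis
  define w where "w = z - (\<Sum>i<k. \<alpha> i * p i + \<beta> i * q i)"
  have "\<Theta> (\<lambda>_. 0) (\<lambda>_. 0) w = \<Theta> x y z"
    by (rule Theta_eqI[where p = p and q = q]) (use pq in \<open>auto simp: w_def\<close>)
  moreover have "\<Theta> (\<lambda>_. 0) (\<lambda>_. 0) w = \<Theta> (\<lambda>_. 0) (\<lambda>_. 0) (w mod 2)"
    by (rule Theta_cong) (simp_all only: even_mod_diff)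
  moreover have "w mod 2 = 0 \<or> w mod 2 = 1" by auto
  ultimately show "\<Theta> x y z \<in> {\<one>, c}" by (auto simp: one_Theta c_def)
qed

lemma two_primary_G: "two_primary G"
  unfolding two_primary_def
proof
  fix g assume "g \<in> carrier G"
  then obtain x y z where g: "g = \<Theta> x y z" using Theta_surj by blast
  have iter: "\<exists>w. (group_square G ^^ j) g = \<Theta> (\<lambda>i. 2 ^ j * x i) (\<lambda>i. 2 ^ j * y i) w" for j
  proof (induction j)
    case 0
    then show ?case by (auto simp: g)
  next
    case (Suc j)
    then obtain w where "(group_square G ^^ j) g = \<Theta> (\<lambda>i. 2 ^ j * x i) (\<lambda>i. 2 ^ j * y i) w" by blast
    then have "(group_square G ^^ Suc j) g = group_square G (\<Theta> (\<lambda>i. 2 ^ j * x i) (\<lambda>i. 2 ^ j * y i) w)"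
      by simp
    then show ?case unfolding group_square_def[of G "\<Theta> _ _ _"] Theta_square by (auto simp: mult.assoc)
  qed
  \<comment> \<open>Large enough for \<open>2 ^ j\<close> to kill every coordinate modulo
    \<open>c\<close>; one further squaring removes \<open>c\<close>.\<close>
  define j where "j = Suc (\<Sum>i<k. N i)"
  obtain w where w: "(group_square G ^^ j) g = \<Theta> (\<lambda>i. 2 ^ j * x i) (\<lambda>i. 2 ^ j * y i) w" using iter by blast
  have "(2::int) ^ N i dvd 2 ^ j * x i" if "i < k" for i
  proof -
    have "N i \<le> j" using member_le_sum[of i "{..<k}" N] that by (simp add: j_def)
    then show ?thesis by (intro dvd_mult2 le_imp_power_dvd)
  qed
  moreover have "even (2 ^ j * y i)" for i by (simp add: j_def)
  ultimately have "(group_square G ^^ j) g \<in> {\<one>, c}"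
    unfolding w Theta_kernel by blast
  moreover have "(group_square G ^^ Suc j) g = group_square G ((group_square G ^^ j) g)" by simp
  moreover have "group_square G \<one> = \<one>" "group_square G c = \<one>"
    unfolding group_square_def by (simp_all add: c_square)
  ultimately have "(group_square G ^^ Suc j) g = \<one>" by (elim insertE emptyE) simp_all
  then show "\<exists>j. (group_square G ^^ j) g = \<one>" by blast
qed

text \<open>Odd pairing means \<open>g h = h g c\<close>, so the square of \<open>g h\<close> is
  \<open>g (h h) g c = c c\<close>.\<close>

lemma inverted:
  assumes "\<Theta> x y z \<otimes> \<Theta> x y z = c" and "\<Theta> x' y' z' \<otimes> \<Theta> x' y' z' = \<one>"
    and "odd ((\<Sum>i<k. y i * x' i) - (\<Sum>i<k. y' i * x i))"
  shows "(\<Theta> x y z \<otimes> \<Theta> x' y' z') \<otimes> (\<Theta> x y z \<otimes> \<Theta> x' y' z') = \<one>"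
proof -
  let ?g = "\<Theta> x y z" and ?h = "\<Theta> x' y' z'"
  have "?g \<otimes> ?h = ?h \<otimes> ?g \<otimes> c" using Theta_commute[of x y z x' y' z'] assms(3) by simp
  then have "(?g \<otimes> ?h) \<otimes> (?g \<otimes> ?h) = (?g \<otimes> ?h) \<otimes> (?h \<otimes> ?g \<otimes> c)" by simp
  also have "\<dots> = ?g \<otimes> (?h \<otimes> ?h) \<otimes> ?g \<otimes> c" using c_closed by (simp add: m_assoc)
  finally show ?thesis using assms(1,2) by (simp add: c_square)
qed

text \<open>The two elements differ by one whose coordinates are the differences, and
  \<open>Theta_kernel\<close> decides. So \<open>A\<close> is a product of cyclic groups of orders
  \<open>2 ^ N i\<close> and 2, one of each for every factor.\<close>

lemma quotient_eq:
  assumes "double_cover G A \<pi> c"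
  shows "\<pi> (\<Theta> x y z) = \<pi> (\<Theta> x' y' z') \<longleftrightarrow> (\<forall>i<k. 2 ^ N i dvd x' i - x i \<and> even (y' i - y i))"
proof -
  interpret D: double_cover G A \<pi> c by fact
  let ?d = "\<Theta> (\<lambda>i. x' i - x i) (\<lambda>i. y' i - y i) (z' - z - (\<Sum>i<k. y i * (x' i - x i)))"
  have mult: "\<Theta> x y z \<otimes> ?d = \<Theta> x' y' z'" unfolding Theta_mult by (rule Theta_cong) auto
  have "\<pi> (\<Theta> x y z) = \<pi> (\<Theta> x' y' z') \<longleftrightarrow> \<Theta> x y z \<otimes> ?d = \<Theta> x y z \<or> \<Theta> x y z \<otimes> ?d = \<Theta> x y z \<otimes> c"
    unfolding mult using D.pi_eq_iff[of "\<Theta> x y z" "\<Theta> x' y' z'"] by auto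
  also have "\<dots> \<longleftrightarrow> ?d \<in> {\<one>, c}"
    using c_closed r_cancel_one'[of "\<Theta> x y z" ?d] by auto
  also have "\<dots> \<longleftrightarrow> (\<forall>i<k. 2 ^ N i dvd x' i - x i \<and> even (y' i - y i))" by (rule Theta_kernel)
  finally show ?thesis .
qed

end

text \<open>Factor 0 is \<open>M2 (m + 1) 1\<close> with \<open>a ^ 2 ^ m = c\<close>. Factor 1 is
  \<open>M2_11 (n + 1)\<close> with \<open>a ^ 2 ^ (n + 1) = 1\<close>, whence its
  \<open>\<alpha>\<close> is 0. The others are dihedral, except that factor 2 is quaternion in the
  second alternative for \<open>\<beta>\<close>.\<close>

locale special_central_heis = central_heis +
  fixes m n :: nat
  assumes k3: "k \<ge> 3" and m: "m \<ge> 1" and n: "n \<ge> 1"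
    and N_def: "\<And>i. N i = (if i = 0 then m else if i = 1 then n + 1 else 1)"
    and \<alpha>_def: "\<And>i. \<alpha> i = (if i = 1 then 0 else 1)"
    and \<beta>_def: "(\<forall>i. \<beta> i = 0) \<or> (\<forall>i. \<beta> i = of_bool (i = 2))"
begin

abbreviation "A_pair u v \<equiv> \<Theta> (\<lambda>i. if i = 0 then u else if i = 1 then v else 0) (\<lambda>_. 0) 0"

lemma pair_eq:
  assumes "double_cover G A \<pi> c"
  shows "\<pi> (A_pair u v) = \<pi> (A_pair u' v') \<longleftrightarrow> 2 ^ m dvd u' - u \<and> 2 ^ (n + 1) dvd v' - v"
  unfolding quotient_eq[OF assms] using k3 by (auto simp: N_def)

text \<open>Isolates the two candidates, 0 and \<open>2 ^ a\<close>, for a square of order at most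
  two in a cyclic group of order \<open>2 ^ Suc a\<close>.\<close>

lemma half_multiple:
  fixes x :: int
  assumes "2 ^ Suc a dvd 2 * (2 * x)"
  obtains \<epsilon> where "\<epsilon> \<in> {0, 1}" "2 ^ Suc a dvd 2 * x - \<epsilon> * 2 ^ a"
proof -
  have "2 ^ a dvd 2 * x" using assms unfolding power_Suc dvd_mult_cancel_left by simp
  then obtain s where s: "2 * x = 2 ^ a * s" by (rule dvdE)
  have "2 * x - (s mod 2) * 2 ^ a = 2 ^ a * (s - s mod 2)"
    unfolding s by (simp add: algebra_simps)
  also have "s - s mod 2 = 2 * (s div 2)" by (simp add: minus_mod_eq_mult_div)
  finally have "2 ^ Suc a dvd 2 * x - (s mod 2) * 2 ^ a" by (simp add: mult.assoc mult.left_commute)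
  moreover have "s mod 2 \<in> {0, 1}" by auto
  ultimately show thesis by (intro that[of "s mod 2"])
qed

text \<open>Cyclic factors of \<open>A\<close> of order two contribute no squares, which leaves
  those of orders \<open>2 ^ m\<close> and \<open>2 ^ (n + 1)\<close>. The involution
  \<open>2 ^ (m - 1)\<close> of the former is a square only if \<open>m \<ge> 2\<close>; the
  involution \<open>2 ^ n\<close> of the latter always is, as \<open>n \<ge> 1\<close>.\<close>

lemma quotient_square_involutions:
  assumes dc: "double_cover G A \<pi> c"
  shows "square_involutions A = (\<lambda>(u, v). \<pi> (A_pair u v)) ` ((if m = 1 then {0} else {0, 2 ^ (m - 1)}) \<times> {0, 2 ^ n})"
    (is "_ = ?f ` (?U \<times> _)")
proof (intro equalityI subsetI)
  interpret D: double_cover G A \<pi> c by (rule dc)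
  have m': "Suc (m - 1) = m" using m by simp
  have one_A: "\<one>\<^bsub>A\<^esub> = \<pi> (\<Theta> (\<lambda>_. 0) (\<lambda>_. 0) 0)" by (simp add: one_Theta[symmetric])
  have sq: "\<pi> (\<Theta> x y z) \<otimes>\<^bsub>A\<^esub> \<pi> (\<Theta> x y z) = \<pi> (\<Theta> (\<lambda>i. 2 * x i) (\<lambda>i. 2 * y i) (2 * z + (\<Sum>i<k. y i * x i)))" for x y z
    by (simp only: D.pi.hom_mult[symmetric] Theta_closed Theta_square)
  {
    fix b assume "b \<in> square_involutions A"
    then obtain a where a: "a \<in> carrier A" "b = a \<otimes>\<^bsub>A\<^esub> a" "b \<otimes>\<^bsub>A\<^esub> b = \<one>\<^bsub>A\<^esub>"
      by (auto simp: square_involutions_def group_squares_def)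
    obtain g where g: "g \<in> carrier G" "a = \<pi> g" using D.pi_surjE[OF a(1)] by blast
    obtain x y z where "g = \<Theta> x y z" using Theta_surj[OF g(1)] by blast
    then have b: "b = \<pi> (\<Theta> (\<lambda>i. 2 * x i) (\<lambda>i. 2 * y i) (2 * z + (\<Sum>i<k. y i * x i)))"
      using a(2) g(2) sq by simp
    have four: "2 ^ N i dvd 2 * (2 * x i)" if "i < k" for i
      using a(3) that unfolding b sq one_A quotient_eq[OF dc] by simp
    have 0: "2 ^ Suc (m - 1) dvd 2 * (2 * x 0)" "2 ^ Suc n dvd 2 * (2 * x 1)"
      using four[of 0] four[of 1] k3 m' by (simp_all add: N_def)
    obtain \<epsilon> where \<epsilon>: "\<epsilon> \<in> {0, 1}" "2 ^ m dvd 2 * x 0 - \<epsilon> * 2 ^ (m - 1)"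
      using half_multiple[OF 0(1)] m' by metis
    obtain \<delta> where \<delta>: "\<delta> \<in> {0, 1}" "2 ^ Suc n dvd 2 * x 1 - \<delta> * 2 ^ n"
      using half_multiple[OF 0(2)] by metis
    \<comment> \<open>For \<open>m = 1\<close> the square \<open>2 * x 0\<close> is already 0 modulo
      \<open>2 ^ m\<close>, so \<open>\<epsilon>\<close> is dropped.\<close>
    define u where "u = (if m = 1 then 0 else \<epsilon> * 2 ^ (m - 1))"
    have u: "u \<in> ?U" "2 ^ m dvd 2 * x 0 - u" using \<epsilon> by (auto simp: u_def)
    have "b = \<pi> (A_pair u (\<delta> * 2 ^ n))"
    proof -
      have "2 ^ N i dvd 2 * x i - (if i = 0 then u else if i = 1 then \<delta> * 2 ^ n else 0)" for i
        using u(2) \<delta>(2) by (simp add: N_def)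
      then show ?thesis unfolding b by (intro quotient_eq[OF dc, THEN iffD2, symmetric]) simp
    qed
    then show "b \<in> ?f ` (?U \<times> {0, 2 ^ n})"
      using u(1) \<delta>(1) by (intro image_eqI[where x = "(u, \<delta> * 2 ^ n)"]) auto
  next
    fix b assume "b \<in> ?f ` (?U \<times> {0, 2 ^ n})"
    then obtain u v where uv: "u \<in> ?U" "v \<in> {0, 2 ^ n}" "b = \<pi> (A_pair u v)" by auto
    have "\<exists>u'. u = 2 * u'"
    proof (cases "m = 1")
      case False
      then have "m - 1 = Suc (m - 2)" using m by simp
      then have "2 ^ (m - 1) = 2 * (2 ^ (m - 2) :: int)" by simp
      then show ?thesis using uv(1) False by (auto intro: exI[of _ 0])
    qed (use uv(1) in auto)
    then obtain u' where u': "u = 2 * u'" by blast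
    have "\<exists>v'. v = 2 * v'"
    proof -
      have "2 ^ n = 2 * (2 ^ (n - 1) :: int)" using n by (simp add: power_Suc[symmetric] del: power_Suc)
      then show ?thesis using uv(2) by (auto intro: exI[of _ 0])
    qed
    then obtain v' where v': "v = 2 * v'" by blast
    have "\<pi> (A_pair u' v') \<otimes>\<^bsub>A\<^esub> \<pi> (A_pair u' v') = b"
      unfolding sq uv(3) quotient_eq[OF dc] by (auto simp: u' v')
    moreover have "b \<otimes>\<^bsub>A\<^esub> b = \<one>\<^bsub>A\<^esub>"
    proof -
      have "2 ^ m dvd 2 * u" using uv(1) m' by (auto simp: power_Suc[symmetric] simp del: power_Suc split: if_splits)
      moreover have "2 ^ (n + 1) dvd 2 * v" using uv(2) by auto
      ultimately show ?thesis
        unfolding uv(3) sq one_A quotient_eq[OF dc] by (auto simp: N_def)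
    qed
    ultimately show "b \<in> square_involutions A"
      by (auto simp: square_involutions_def group_squares_def intro!: image_eqI[of _ _ "\<pi> (A_pair u' v')"])
  }
qed

text \<open>Origin of the factors 2 and 4: the cyclic factor of order \<open>2 ^ (n + 1)\<close>
  gives two choices, that of order \<open>2 ^ m\<close> two more once
  \<open>m \<ge> 2\<close>.\<close>

lemma card_quotient_square_involutions:
  assumes dc: "double_cover G A \<pi> c"
  shows "card (square_involutions A) = (if m = 1 then 2 else 4)"
proof -
  let ?U = "if m = 1 then {0} else {0, 2 ^ (m - 1)} :: int set"
  have nd: "\<not> 2 ^ Suc a dvd (2 :: int) ^ a" "\<not> 2 ^ Suc a dvd - ((2 :: int) ^ a)" for a
    by (auto dest: zdvd_imp_le)
  obtain m' where m': "m = Suc m'" using m by (cases m) auto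
  have inj: "inj_on (\<lambda>(u, v). \<pi> (A_pair u v)) (?U \<times> {0, 2 ^ n})"
  proof (rule inj_onI, clarify)
    fix u v u' v' assume *: "u \<in> ?U" "v \<in> {0, 2 ^ n}" "u' \<in> ?U" "v' \<in> {0, 2 ^ n}"
      "\<pi> (A_pair u v) = \<pi> (A_pair u' v')"
    then have d: "2 ^ m dvd u' - u" "2 ^ Suc n dvd v' - v" unfolding pair_eq[OF dc] by auto
    have "u = u'" using *(1,3) d(1) nd[of m'] unfolding m' by (auto split: if_splits)
    moreover have "v = v'" using *(2,4) d(2) nd[of n] by auto
    ultimately show "u = u' \<and> v = v'" by simp
  qed
  show ?thesis
    unfolding quotient_square_involutions[OF dc] card_image[OF inj] by (simp add: card_cartesian_product)
qed

text \<open>Take the generator \<open>a\<close> of factor 0 to the power \<open>2 ^ (m - 2)\<close>: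
  its fourth power is \<open>a ^ 2 ^ m = c\<close>, and its square is an even power of
  \<open>a\<close>, hence central.\<close>

lemma fourth_root:
  assumes "m \<ge> 2"
  obtains r where "r \<in> carrier G" "(r \<otimes> r) \<otimes> (r \<otimes> r) = c"
    "\<And>g. g \<in> carrier G \<Longrightarrow> (r \<otimes> r) \<otimes> g = g \<otimes> (r \<otimes> r)"
proof -
  obtain m' where m': "m = Suc (Suc m')" using assms by (metis Suc_le_D numeral_2_eq_2 Suc_le_mono)
  define x :: "nat \<Rightarrow> int" where "x = (\<lambda>i. 2 ^ m' * of_bool (i = 0))"
  let ?r = "\<Theta> x (\<lambda>_. 0) 0"
  have rr: "?r \<otimes> ?r = \<Theta> (\<lambda>i. 2 * x i) (\<lambda>_. 0) 0" unfolding Theta_square by simp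
  have k0: "0 < k" using k3 by simp
  show thesis
  proof (rule that)
    show "?r \<in> carrier G" by simp
    have "c = \<Theta> (\<lambda>i. 2 * (2 * x i)) (\<lambda>i. 2 * 0) (2 * 0 + (\<Sum>i<k. 0 * (2 * x i)))"
      unfolding c_def
    proof (rule Theta_eqI[where p = "\<lambda>i. of_bool (i = 0)" and q = "\<lambda>_. 0"])
      show "2 * (2 * x i) = 0 + 2 ^ N i * of_bool (i = 0)" for i by (simp add: x_def N_def m')
      show "even (2 * 0 + (\<Sum>i<k. 0 * (2 * x i)) - 1 - (\<Sum>i<k. \<alpha> i * of_bool (i = 0) + \<beta> i * 0))"
        using heis_sum_delta(1)[OF k0, of \<alpha>] by (simp add: \<alpha>_def)
    qed simp
    then show "(?r \<otimes> ?r) \<otimes> (?r \<otimes> ?r) = c" unfolding rr Theta_square by simp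
    fix g assume "g \<in> carrier G"
    then obtain x' y' z' where g: "g = \<Theta> x' y' z'" using Theta_surj by blast
    have "even ((\<Sum>i<k. 0 * x' i) - (\<Sum>i<k. y' i * (2 * x i)))"
      by (simp add: dvd_sum)
    then show "(?r \<otimes> ?r) \<otimes> g = g \<otimes> (?r \<otimes> ?r)"
      unfolding rr g Theta_commute[of "\<lambda>i. 2 * x i"] by simp
  qed
qed

text \<open>The contributions \<open>y i * x i + \<alpha> i * p i + \<beta> i * q i\<close> to the
  exponent of \<open>c\<close> have odd sum. That of factor 1 is even because \<open>x 1\<close> is
  divisible by \<open>2 ^ n\<close>, so another factor contributes an odd amount.\<close>

lemma square_is_c:
  assumes m1: "m = 1" and g: "\<Theta> x y z \<otimes> \<Theta> x y z = c"
  obtains i where "i < k" "i \<noteq> 1" "odd (x i) \<or> odd (y i)"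
proof -
  have "c = \<Theta> (\<lambda>i. 2 * x i) (\<lambda>i. 2 * y i) (2 * z + (\<Sum>i<k. y i * x i))"
    using g unfolding Theta_square by simp
  then obtain p q where pq: "\<forall>i<k. 2 * x i = 0 + 2 ^ N i * p i \<and> 2 * y i = 0 + 2 * q i"
    and e: "even (2 * z + (\<Sum>i<k. y i * x i) - 1 - (\<Sum>i<k. \<alpha> i * p i + \<beta> i * q i))"
    unfolding c_def Theta_eq by blast
  have p: "2 * x i = 2 ^ N i * p i" and q: "y i = q i" if "i < k" for i
    using pq that by simp_all
  from e have "odd ((\<Sum>i<k. y i * x i) + (\<Sum>i<k. \<alpha> i * p i + \<beta> i * q i))" by presburger
  then have "odd (\<Sum>i<k. y i * x i + (\<alpha> i * p i + \<beta> i * q i))" by (subst sum.distrib)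
  then obtain i where i: "i < k" "odd (y i * x i + (\<alpha> i * p i + \<beta> i * q i))"
    using dvd_sum[of "{..<k}" 2 "\<lambda>i. y i * x i + (\<alpha> i * p i + \<beta> i * q i)"] by auto
  have "i \<noteq> 1"
  proof
    assume "i = 1"
    then have "2 * x 1 = 2 ^ Suc n * p 1" using p[OF i(1)] by (simp add: N_def)
    then have "even (x 1)" using n by (cases n) auto
    moreover have "\<alpha> 1 = 0" "\<beta> 1 = 0" using \<beta>_def by (auto simp: \<alpha>_def)
    ultimately show False using i(2) \<open>i = 1\<close> by simp
  qed
  moreover from this have "x i = p i" using p[OF i(1)] m1 by (simp add: N_def split: if_splits)
  then have "odd (x i) \<or> odd (y i)" using i(2) q[OF i(1)] by auto
  ultimately show thesis using that i(1) by blast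
qed

text \<open>For \<open>m = 1\<close> and \<open>x 1 = 0\<close> squaring is a quadratic form modulo
  2: the exponent of \<open>c\<close> is the sum of
  \<open>y i * x i + x i + \<beta> i * y i\<close>.\<close>

lemma involution_Theta:
  assumes m1: "m = 1" and "x 1 = 0"
    and "even (2 * z + (\<Sum>i<k. y i * x i) - (\<Sum>i<k. x i + \<beta> i * y i))"
  shows "\<Theta> x y z \<otimes> \<Theta> x y z = \<one>"
proof -
  have "\<Theta> (\<lambda>_. 0) (\<lambda>_. 0) 0 = \<Theta> (\<lambda>i. 2 * x i) (\<lambda>i. 2 * y i) (2 * z + (\<Sum>i<k. y i * x i))"
  proof (rule Theta_eqI[where p = x and q = y])
    show "2 * x i = 0 + 2 ^ N i * x i" for i using assms(2) m1 by (cases "i = 1") (simp_all add: N_def)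
    have \<alpha>x: "\<alpha> i * x i = x i" for i using assms(2) by (cases "i = 1") (simp_all add: \<alpha>_def)
    show "even (2 * z + (\<Sum>i<k. y i * x i) - 0 - (\<Sum>i<k. \<alpha> i * x i + \<beta> i * y i))"
      using assms(3) by (simp only: \<alpha>x diff_0_right)
  qed simp
  then show ?thesis unfolding Theta_square one_Theta by simp
qed

text \<open>A dihedral factor in which \<open>g\<close> has an odd coordinate contains a suitable
  reflection; factor 0 counts as dihedral when \<open>m = 1\<close>. In the quaternion factor
  \<open>c\<close> is the only involution, so there an element of order four is multiplied by the
  generator \<open>a\<close> of factor 0, which has the same square \<open>c\<close>.\<close>

lemma inverting_involution:
  assumes m1: "m = 1" and g: "\<Theta> x y z \<otimes> \<Theta> x y z = c"
  obtains x' y' z' where "\<Theta> x' y' z' \<otimes> \<Theta> x' y' z' = \<one>" "odd ((\<Sum>i<k. y i * x' i) - (\<Sum>i<k. y' i * x i))"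
proof -
  let ?e = "\<lambda>j l. of_bool (l = j) :: int"
  note delta = heis_sum_delta
  have bool_sq: "(\<Sum>l<k. ?e j l * ?e j' l) = of_bool (j = j')" if "j < k" for j j'
    using delta(2)[OF that, of "?e j'"] by simp
  show thesis
  proof (cases "\<exists>j<k. j \<noteq> 1 \<and> \<beta> j = 0 \<and> (odd (x j) \<or> odd (y j))")
    case True
    then obtain j where j: "j < k" "j \<noteq> 1" "\<beta> j = 0" "odd (x j) \<or> odd (y j)" by blast
    show thesis
    proof (cases "odd (x j)")
      case True
      show thesis
      proof (rule that)
        \<comment> \<open>The reflection \<open>b\<close> of factor \<open>j\<close>, which pairs
          with \<open>x j\<close>.\<close>
        show "\<Theta> (\<lambda>_. 0) (?e j) 0 \<otimes> \<Theta> (\<lambda>_. 0) (?e j) 0 = \<one>"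
          by (rule involution_Theta[OF m1]) (simp_all add: delta(1)[OF j(1)] j(3))
        show "odd ((\<Sum>l<k. y l * 0) - (\<Sum>l<k. ?e j l * x l))"
          using True by (simp add: delta(2)[OF j(1)])
      qed
    next
      case False
      show thesis
      proof (rule that)
        \<comment> \<open>The reflection \<open>a b\<close> of factor \<open>j\<close>, up to
          \<open>c\<close>; it pairs with \<open>y j - x j\<close>, which is odd here.\<close>
        show "\<Theta> (?e j) (?e j) 1 \<otimes> \<Theta> (?e j) (?e j) 1 = \<one>"
          by (rule involution_Theta[OF m1])
            (use j(2,3) delta(2)[OF j(1), of "\<lambda>_. 1"] in
              \<open>simp_all add: delta(1)[OF j(1)] bool_sq[OF j(1)] sum.distrib\<close>)
        show "odd ((\<Sum>l<k. y l * ?e j l) - (\<Sum>l<k. ?e j l * x l))"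
          using False j(4) by (simp add: delta[OF j(1)])
      qed
    qed
  next
    case False
    obtain i where i: "i < k" "i \<noteq> 1" "odd (x i) \<or> odd (y i)" using square_is_c[OF m1 g] .
    have k02: "0 < k" "2 < k" using k3 by auto
    have "\<beta> i \<noteq> 0" using False i by blast
    then have \<beta>: "\<beta> l = of_bool (l = 2)" for l using \<beta>_def by auto
    then have i2: "i = 2" using \<open>\<beta> i \<noteq> 0\<close> by (cases "i = 2") auto
    \<comment> \<open>Hence the auxiliary generator \<open>a\<close> of factor 0 commutes with
      \<open>g\<close>, and only factor 2 decides the parity.\<close>
    have even0: "even (x 0)" "even (y 0)" using False k02 \<beta> by auto
    show thesis
    proof (cases "odd (x 2)")
      case True
      show thesis
      proof (rule that)
        show "\<Theta> (?e 0) (?e 2) 0 \<otimes> \<Theta> (?e 0) (?e 2) 0 = \<one>"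
          by (rule involution_Theta[OF m1])
            (use delta(2)[OF k02(1), of "\<lambda>_. 1"] delta(2)[OF k02(2), of "\<lambda>_. 1"] in
              \<open>simp_all add: bool_sq[OF k02(2)] sum.distrib \<beta>\<close>)
        show "odd ((\<Sum>l<k. y l * ?e 0 l) - (\<Sum>l<k. ?e 2 l * x l))"
          using True even0 by (simp add: delta(1)[OF k02(1)] delta(2)[OF k02(2)])
      qed
    next
      case x2: False
      show thesis
      proof (rule that)
        show "\<Theta> (\<lambda>l. ?e 0 l + ?e 2 l) (\<lambda>_. 0) 0 \<otimes> \<Theta> (\<lambda>l. ?e 0 l + ?e 2 l) (\<lambda>_. 0) 0 = \<one>"
          by (rule involution_Theta[OF m1])
            (use delta(2)[OF k02(1), of "\<lambda>_. 1"] delta(2)[OF k02(2), of "\<lambda>_. 1"] in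
              \<open>simp_all add: sum.distrib\<close>)
        show "odd ((\<Sum>l<k. y l * (?e 0 l + ?e 2 l)) - (\<Sum>l<k. 0 * x l))"
          using x2 even0 i(3) i2
          by (simp add: distrib_left sum.distrib delta(1)[OF k02(1)] delta(1)[OF k02(2)])
      qed
    qed
  qed
qed

theorem card_unitaries_special:
  assumes F: "CHAR('f::{field,finite}) = 2"
  shows "card (unitaries G :: ('a \<Rightarrow> 'f) set) = (if m = 1 then 2 else 4) * CARD('f) ^ unitary_exponent G"
proof -
  obtain A :: "nat monoid" and \<pi> where dc: "double_cover G A \<pi> c"
    by (rule central_quotient[OF c_closed c_square c_ne commute_or_c c_central])
  interpret D: double_cover G A \<pi> c by (rule dc)
  have card: "card (square_involutions A) = (if m = 1 then 2 else 4)"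
    by (rule card_quotient_square_involutions[OF dc])
  have card_A: "card (unitaries A :: (nat \<Rightarrow> 'f) set) = (if m = 1 then 2 else 4) * CARD('f) ^ unitary_exponent A"
    unfolding card[symmetric]
    by (rule card_unitaries_abelian[OF F D.A.finite_group_axioms D.A_comm D.two_primary_quotient[OF two_primary_G]])
      (use card in auto)
  show ?thesis
  proof (rule D.card_unitaries_cover[OF F _ card_A])
    fix g assume g: "g \<in> carrier G" "g \<otimes> g = c"
    show "(\<exists>h\<in>carrier G. h \<otimes> h = \<one> \<and> (g \<otimes> h) \<otimes> (g \<otimes> h) = \<one>) \<or>
      (\<exists>s\<in>carrier G. \<exists>p\<in>carrier G. s \<otimes> s = \<one> \<and> g \<otimes> s = s \<otimes> g \<and> g \<otimes> s = p \<otimes> p)"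
    proof (cases "m = 1")
      case True
      obtain x y z where xyz: "g = \<Theta> x y z" using Theta_surj[OF g(1)] by blast
      obtain x' y' z' where h: "\<Theta> x' y' z' \<otimes> \<Theta> x' y' z' = \<one>"
        "odd ((\<Sum>i<k. y i * x' i) - (\<Sum>i<k. y' i * x i))"
        using inverting_involution[OF True g(2)[unfolded xyz]] .
      show ?thesis
        unfolding xyz using inverted[OF g(2)[unfolded xyz] h] h(1) Theta_closed by blast
    next
      case False
      then have "m \<ge> 2" using m by simp
      then obtain r where "r \<in> carrier G" "(r \<otimes> r) \<otimes> (r \<otimes> r) = c"
        "\<And>g. g \<in> carrier G \<Longrightarrow> (r \<otimes> r) \<otimes> g = g \<otimes> (r \<otimes> r)" using fourth_root by blast
      from D.fourth_root_lifts[OF this g] show ?thesis ..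
    qed
  qed
qed

end

theorem corollary4p13:
  fixes G :: "('a, 'b) monoid_scheme"
    and m n k l :: nat
  assumes "CHAR('f::{field, finite}) = 2"
    and "m \<ge> 1" and "n > m" and "k \<ge> 3" and "l \<in> {1, 2}"
    and "group G"
    and "G \<cong> central_product
           ([M2 (m + 1) 1, M2_11 (n + 1), if l = 1 then D8 else Q8] @ replicate (k - 3) D8)"
  shows "(m = 1 \<longrightarrow>
            card (V_star G :: ('a \<Rightarrow> 'f) set)
              = 2 * CARD('f) ^ ((order G + card (Omega1 G)) div 2 - 1)) \<and>
         (m \<ge> 2 \<longrightarrow>
            card (V_star G :: ('a \<Rightarrow> 'f) set)
              = 4 * CARD('f) ^ ((order G + card (Omega1 G)) div 2 - 1))"
proof -
  define Gs where "Gs = [M2 (m + 1) 1, M2_11 (n + 1), if l = 1 then D8 else Q8] @ replicate (k - 3) D8"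
  define N where "N i = (if i = 0 then m else if i = 1 then n + 1 else 1)" for i :: nat
  define \<alpha> where "\<alpha> i = (if i = 1 then 0 else 1 :: int)" for i :: nat
  \<comment> \<open>Only a quaternion factor at position 2 has \<open>b ^ 2 = c\<close>.\<close>
  define \<beta> where "\<beta> i = (if l = 1 then 0 else of_bool (i = 2) :: int)" for i :: nat
  have len: "length Gs = k" using assms(4) by (simp add: Gs_def)
  have "\<exists>\<theta>. heis_param (Gs ! i) (N i) (\<alpha> i) (\<beta> i) \<theta>" if "i < k" for i
  proof -
    consider "i = 0" | "i = 1" | "i = 2" | "i \<ge> 3" by linarith
    then show ?thesis
    proof cases
      case 1
      then show ?thesis using M2_param[OF assms(2)] by (simp add: Gs_def N_def \<alpha>_def \<beta>_def)
    next
      case 2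
      then show ?thesis using M2_11_param[of "n + 1"] by (simp add: Gs_def N_def \<alpha>_def \<beta>_def)
    next
      case 3
      then have "Gs ! i = (if l = 1 then D8 else Q8)" by (simp add: Gs_def numeral_2_eq_2)
      then show ?thesis using 3 D8_param Q8_param by (simp add: N_def \<alpha>_def \<beta>_def)
    next
      case 4
      then have "Gs ! i = D8" using that by (simp add: Gs_def nth_append nth_Cons' )
      then show ?thesis using 4 D8_param by (simp add: N_def \<alpha>_def \<beta>_def)
    qed
  qed
  then have "\<forall>i. \<exists>\<theta>. i < k \<longrightarrow> heis_param (Gs ! i) (N i) (\<alpha> i) (\<beta> i) \<theta>" by blast
  then obtain \<theta> where "\<And>i. i < length Gs \<Longrightarrow> heis_param (Gs ! i) (N i) (\<alpha> i) (\<beta> i) (\<theta> i)"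
    unfolding len by metis
  moreover have "Gs \<noteq> []" by (simp add: Gs_def)
  ultimately obtain \<Theta> where "central_heis G k N \<alpha> \<beta> \<Theta>"
    using central_product_heis[OF assms(6) assms(7)[folded Gs_def]] unfolding len by blast
  then interpret central_heis G k N \<alpha> \<beta> \<Theta> .
  interpret special_central_heis G k N \<alpha> \<beta> \<Theta> m n
    by unfold_locales (use assms in \<open>auto simp: N_def \<alpha>_def \<beta>_def\<close>)
  show ?thesis
    using card_unitaries_special[OF assms(1)] V_star_eq_unitaries[OF assms(1)]
    by (simp add: unitary_exponent_def)
qed

end
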